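(* Let $F$ be a functor from the category of commutative $\mathbb{C}$-algebras to the category of abelian groups. Assume that: (a) $F$ commutes with filtered colimits; (b) the functor $D\mapsto F(C(D))$ from the category of compact polyhedra to abelian groups is homotopy invariant. Then the functor $X\mapsto F(C(X))$ from the category of compact Hausdorff spaces to abelian groups is homotopy invariant.
   Context: $C(X)$ is the algebra of continuous functions $X\to\mathbb{C}$. The category of compact polyhedra is the full subcategory of the category of compact Hausdorff spaces and continuous maps consisting of the spaces homeomorphic to finite simplicial complexes. A contravariant functor $G$ on either category is homotopy invariant if for every object $X$ the inclusion $X\to X\times[0,1]$, $x\mapsto(x,0)$, induces an isomorphism $G(X\times[0,1])\to G(X)$. Filtered colimits are colimits of algebras (purely algebraic). *)

theory Defs
  imports
    "HOL-Analysis.Analysis"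
    "HOL-Algebra.Module"
begin

section \<open>Categories and functors\<close>

text \<open>An arrow may belong to several hom-sets, so identities, composition and the action of a
  functor on arrows take the objects involved as arguments: \<open>Comp C X Y Z g f\<close> is
  \<open>g\<close> after \<open>f\<close> for \<open>f : X \<rightarrow> Y\<close> and \<open>g : Y \<rightarrow> Z\<close>.\<close>

record ('o, 'm) cat =
  Obj :: "'o set"
  Mor :: "'o \<Rightarrow> 'o \<Rightarrow> 'm set"
  Ident :: "'o \<Rightarrow> 'm"
  Comp :: "'o \<Rightarrow> 'o \<Rightarrow> 'o \<Rightarrow> 'm \<Rightarrow> 'm \<Rightarrow> 'm"

definition is_category :: "('o, 'm) cat \<Rightarrow> bool" where
  "is_category C \<longleftrightarrow>
     (\<forall>X\<in>Obj C. Ident C X \<in> Mor C X X) \<and>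
     (\<forall>X\<in>Obj C. \<forall>Y\<in>Obj C. \<forall>Z\<in>Obj C. \<forall>f\<in>Mor C X Y. \<forall>g\<in>Mor C Y Z.
        Comp C X Y Z g f \<in> Mor C X Z) \<and>
     (\<forall>X\<in>Obj C. \<forall>Y\<in>Obj C. \<forall>f\<in>Mor C X Y.
        Comp C X X Y f (Ident C X) = f \<and> Comp C X Y Y (Ident C Y) f = f) \<and>
     (\<forall>W\<in>Obj C. \<forall>X\<in>Obj C. \<forall>Y\<in>Obj C. \<forall>Z\<in>Obj C.
        \<forall>f\<in>Mor C W X. \<forall>g\<in>Mor C X Y. \<forall>h\<in>Mor C Y Z.
        Comp C W Y Z h (Comp C W X Y g f) = Comp C W X Z (Comp C X Y Z h g) f)"

definition opposite :: "('o, 'm) cat \<Rightarrow> ('o, 'm) cat" where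
  "opposite C = \<lparr>Obj = Obj C, Mor = (\<lambda>X Y. Mor C Y X), Ident = Ident C,
     Comp = (\<lambda>X Y Z g f. Comp C Z Y X f g)\<rparr>"

definition full_subcategory :: "('o, 'm) cat \<Rightarrow> ('o \<Rightarrow> bool) \<Rightarrow> ('o, 'm) cat" where
  "full_subcategory C P = C\<lparr>Obj := {X \<in> Obj C. P X}\<rparr>"

record ('o1, 'm1, 'o2, 'm2) fctr =
  omap :: "'o1 \<Rightarrow> 'o2"
  mmap :: "'o1 \<Rightarrow> 'o1 \<Rightarrow> 'm1 \<Rightarrow> 'm2"

definition is_functor ::
  "('o1, 'm1) cat \<Rightarrow> ('o2, 'm2) cat \<Rightarrow> ('o1, 'm1, 'o2, 'm2) fctr \<Rightarrow> bool" where
  "is_functor C D F \<longleftrightarrow>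
     (\<forall>X\<in>Obj C. omap F X \<in> Obj D) \<and>
     (\<forall>X\<in>Obj C. \<forall>Y\<in>Obj C. \<forall>f\<in>Mor C X Y. mmap F X Y f \<in> Mor D (omap F X) (omap F Y)) \<and>
     (\<forall>X\<in>Obj C. mmap F X X (Ident C X) = Ident D (omap F X)) \<and>
     (\<forall>X\<in>Obj C. \<forall>Y\<in>Obj C. \<forall>Z\<in>Obj C. \<forall>f\<in>Mor C X Y. \<forall>g\<in>Mor C Y Z.
        mmap F X Z (Comp C X Y Z g f) =
        Comp D (omap F X) (omap F Y) (omap F Z) (mmap F Y Z g) (mmap F X Y f))"

definition fctr_comp ::
  "('o2, 'm2, 'o3, 'm3) fctr \<Rightarrow> ('o1, 'm1, 'o2, 'm2) fctr \<Rightarrow> ('o1, 'm1, 'o3, 'm3) fctr" where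
  "fctr_comp G F = \<lparr>omap = (\<lambda>X. omap G (omap F X)),
     mmap = (\<lambda>X Y f. mmap G (omap F X) (omap F Y) (mmap F X Y f))\<rparr>"


section \<open>Filtered colimits\<close>

definition is_filtered :: "('j, 'a) cat \<Rightarrow> bool" where
  "is_filtered J \<longleftrightarrow> is_category J \<and> Obj J \<noteq> {} \<and>
     (\<forall>i\<in>Obj J. \<forall>j\<in>Obj J. \<exists>k\<in>Obj J. Mor J i k \<noteq> {} \<and> Mor J j k \<noteq> {}) \<and>
     (\<forall>i\<in>Obj J. \<forall>j\<in>Obj J. \<forall>a\<in>Mor J i j. \<forall>b\<in>Mor J i j.
        \<exists>k\<in>Obj J. \<exists>c\<in>Mor J j k. Comp J i j k c a = Comp J i j k c b)"

definition is_cocone ::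
  "('j, 'a) cat \<Rightarrow> ('o, 'm) cat \<Rightarrow> ('j, 'a, 'o, 'm) fctr \<Rightarrow> 'o \<Rightarrow> ('j \<Rightarrow> 'm) \<Rightarrow> bool" where
  "is_cocone J C D L \<iota> \<longleftrightarrow> L \<in> Obj C \<and>
     (\<forall>j\<in>Obj J. \<iota> j \<in> Mor C (omap D j) L) \<and>
     (\<forall>i\<in>Obj J. \<forall>j\<in>Obj J. \<forall>a\<in>Mor J i j.
        Comp C (omap D i) (omap D j) L (\<iota> j) (mmap D i j a) = \<iota> i)"

definition is_colimit ::
  "('j, 'a) cat \<Rightarrow> ('o, 'm) cat \<Rightarrow> ('j, 'a, 'o, 'm) fctr \<Rightarrow> 'o \<Rightarrow> ('j \<Rightarrow> 'm) \<Rightarrow> bool" where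
  "is_colimit J C D L \<iota> \<longleftrightarrow> is_cocone J C D L \<iota> \<and>
     (\<forall>M \<kappa>. is_cocone J C D M \<kappa> \<longrightarrow>
        (\<exists>!u. u \<in> Mor C L M \<and> (\<forall>j\<in>Obj J. Comp C (omap D j) L M u (\<iota> j) = \<kappa> j)))"

definition preserves_colimits_of_shape ::
  "('j, 'a) cat \<Rightarrow> ('o1, 'm1) cat \<Rightarrow> ('o2, 'm2) cat \<Rightarrow> ('o1, 'm1, 'o2, 'm2) fctr \<Rightarrow> bool" where
  "preserves_colimits_of_shape J C C' F \<longleftrightarrow>
     (\<forall>D L \<iota>. is_functor J C D \<and> is_colimit J C D L \<iota> \<longrightarrow>
        is_colimit J C' (fctr_comp F D) (omap F L) (\<lambda>j. mmap F (omap D j) L (\<iota> j)))"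


section \<open>Commutative complex algebras and abelian groups\<close>

text \<open>HOL has no type of all sets, so each category has its carriers in one fixed but arbitrary
  type, which plays the role of the universe. Arrows are made extensional, so that equality of
  arrows is equality on the carrier.

  The locale \<^locale>\<open>algebra\<close> includes commutativity and a unit, and ring homomorphisms
  preserve the unit.\<close>

definition complex_ring :: "complex ring" where
  "complex_ring = \<lparr>carrier = UNIV, mult = (*), one = 1, zero = 0, add = (+)\<rparr>"

type_synonym 'u calg = "(complex, 'u) module"

definition comm_algebras :: "('u calg, 'u \<Rightarrow> 'u) cat" where
  "comm_algebras =
    \<lparr>Obj = {A. algebra complex_ring A},
     Mor = (\<lambda>A B. {h \<in> extensional (carrier A). h \<in> ring_hom A B \<and>
       (\<forall>c. \<forall>a\<in>carrier A. h (c \<odot>\<^bsub>A\<^esub> a) = c \<odot>\<^bsub>B\<^esub> h a)}),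
     Ident = (\<lambda>A. restrict id (carrier A)),
     Comp = (\<lambda>A B C g f. compose (carrier A) g f)\<rparr>"

definition abelian_groups :: "('g monoid, 'g \<Rightarrow> 'g) cat" where
  "abelian_groups =
    \<lparr>Obj = {G. comm_group G},
     Mor = (\<lambda>G H. {h \<in> extensional (carrier G). h \<in> hom G H}),
     Ident = (\<lambda>G. restrict id (carrier G)),
     Comp = (\<lambda>G H K g f. compose (carrier G) g f)\<rparr>"

text \<open>Small index categories have their objects and arrows in the same universe \<open>'u\<close> as the
  algebras.\<close>

definition commutes_with_filtered_colimits ::
  "('u calg, 'u \<Rightarrow> 'u, 'g monoid, 'g \<Rightarrow> 'g) fctr \<Rightarrow> bool" where
  "commutes_with_filtered_colimits F \<longleftrightarrow>
     (\<forall>J :: ('u, 'u) cat. is_filtered J \<longrightarrow>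
        preserves_colimits_of_shape J comm_algebras abelian_groups F)"


section \<open>Compact Hausdorff spaces and compact polyhedra\<close>

definition compact_hausdorff :: "('x topology, 'x \<Rightarrow> 'x) cat" where
  "compact_hausdorff =
    \<lparr>Obj = {X. compact_space X \<and> Hausdorff_space X},
     Mor = (\<lambda>X Y. {f \<in> extensional (topspace X). continuous_map X Y f}),
     Ident = (\<lambda>X. restrict id (topspace X)),
     Comp = (\<lambda>X Y Z g f. compose (topspace X) g f)\<rparr>"

text \<open>The library's \<^const>\<open>simplicial_complex\<close> lives in a Euclidean space whose dimension is
  fixed by its type. As the dimension must range over all of \<open>\<nat>\<close> here, simplicial complexes
  are abstract ones, with vertices in \<open>\<nat>\<close>; the realization consists of the barycentric
  coordinate functions, and since the complex is finite the topology of pointwise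
  convergence on it is the usual one.\<close>

definition finite_simplicial_complex :: "nat set set \<Rightarrow> bool" where
  "finite_simplicial_complex K \<longleftrightarrow> finite K \<and> (\<forall>S\<in>K. finite S \<and> S \<noteq> {}) \<and>
     (\<forall>S\<in>K. \<forall>T. T \<noteq> {} \<and> T \<subseteq> S \<longrightarrow> T \<in> K)"

definition realization :: "nat set set \<Rightarrow> (nat \<Rightarrow> real) topology" where
  "realization K = subtopology (powertop_real UNIV)
     {t. (\<forall>v. 0 \<le> t v) \<and> {v. t v \<noteq> 0} \<in> K \<and> (\<Sum>v | t v \<noteq> 0. t v) = 1}"

definition is_polyhedron :: "'x topology \<Rightarrow> bool" where
  "is_polyhedron X \<longleftrightarrow>
     (\<exists>K. finite_simplicial_complex K \<and> X homeomorphic_space realization K)"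

definition compact_polyhedra :: "('x topology, 'x \<Rightarrow> 'x) cat" where
  "compact_polyhedra = full_subcategory compact_hausdorff is_polyhedron"

definition cont_algebra :: "'x topology \<Rightarrow> ('x \<Rightarrow> complex) calg" where
  "cont_algebra X =
    \<lparr>carrier = {f \<in> extensional (topspace X). continuous_map X euclidean f},
     mult = (\<lambda>f g. \<lambda>x\<in>topspace X. f x * g x),
     one = (\<lambda>x\<in>topspace X. 1),
     zero = (\<lambda>x\<in>topspace X. 0),
     add = (\<lambda>f g. \<lambda>x\<in>topspace X. f x + g x),
     smult = (\<lambda>c f. \<lambda>x\<in>topspace X. c * f x)\<rparr>"

text \<open>As a functor on the opposite category, an arrow from \<open>Y\<close> to \<open>X\<close> is a continuous map
  \<open>\<phi> : X \<rightarrow> Y\<close>.\<close>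

definition cont_functor ::
  "('x topology, 'x \<Rightarrow> 'x, ('x \<Rightarrow> complex) calg, ('x \<Rightarrow> complex) \<Rightarrow> ('x \<Rightarrow> complex)) fctr" where
  "cont_functor = \<lparr>omap = cont_algebra,
     mmap = (\<lambda>Y X \<phi>. \<lambda>f\<in>carrier (cont_algebra Y). compose (topspace X) f \<phi>)\<rparr>"

text \<open>\<open>G\<close> is a contravariant functor on \<open>K\<close>, that is, a functor on \<open>opposite K\<close>. The topology
  \<open>X \<times> [0,1]\<close> has points of type \<open>'x \<times> real\<close>, so in \<open>K\<close> it is represented by its
  homeomorphic copies \<open>Y\<close> with points of type \<open>'x\<close>, with \<open>\<theta> : X \<times> [0,1] \<rightarrow> Y\<close> the
  homeomorphism; for functorial \<open>G\<close> the condition does not depend on the choice of the copy.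
  Copies exist as soon as \<open>'x \<times> real\<close> injects into \<open>'x\<close>, see \<open>cylinder_exists\<close>.\<close>

definition homotopy_invariant ::
  "('x topology, 'x \<Rightarrow> 'x) cat \<Rightarrow> ('x topology, 'x \<Rightarrow> 'x, 'g monoid, 'g \<Rightarrow> 'g) fctr \<Rightarrow> bool" where
  "homotopy_invariant K G \<longleftrightarrow>
     (\<forall>X\<in>Obj K. \<forall>Y\<in>Obj K. \<forall>\<theta>.
        homeomorphic_map (prod_topology X (top_of_set {0..1::real})) Y \<theta> \<longrightarrow>
        mmap G Y X (\<lambda>x\<in>topspace X. \<theta> (x, 0)) \<in> iso (omap G Y) (omap G X))"


section \<open>The categories and functors satisfy the axioms\<close>

lemma is_category_opposite: "is_category C \<Longrightarrow> is_category (opposite C)"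
  by (simp add: is_category_def opposite_def)

lemma is_category_full_subcategory: "is_category C \<Longrightarrow> is_category (full_subcategory C P)"
  by (simp add: is_category_def full_subcategory_def)

lemma is_functor_fctr_comp:
  "is_functor C D F \<Longrightarrow> is_functor D E G \<Longrightarrow> is_functor C E (fctr_comp G F)"
  by (simp add: is_functor_def fctr_comp_def)

lemma cring_complex_ring: "cring complex_ring"
proof (rule cringI)
  show "abelian_group complex_ring"
    by (rule abelian_groupI) (auto simp: complex_ring_def intro: exI[of _ "- _"] left_minus)
qed (auto simp: complex_ring_def algebra_simps intro!: comm_monoidI)

lemma is_category_comm_algebras: "is_category (comm_algebras :: ('u calg, 'u \<Rightarrow> 'u) cat)"
proof -
  have smult: "c \<odot>\<^bsub>A\<^esub> a \<in> carrier A"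
    if "algebra complex_ring A" "a \<in> carrier A" for A :: "'u calg" and a c
  proof -
    interpret algebra complex_ring A by fact
    show ?thesis using smult_closed[of c a] that(2) by (simp add: complex_ring_def)
  qed
  have closed: "a \<otimes>\<^bsub>A\<^esub> b \<in> carrier A" "a \<oplus>\<^bsub>A\<^esub> b \<in> carrier A" "\<one>\<^bsub>A\<^esub> \<in> carrier A"
    if "algebra complex_ring A" "a \<in> carrier A" "b \<in> carrier A" for A :: "'u calg" and a b
  proof -
    interpret A: cring A using algebra.M_cring[OF that(1)] .
    show "a \<otimes>\<^bsub>A\<^esub> b \<in> carrier A" "a \<oplus>\<^bsub>A\<^esub> b \<in> carrier A" "\<one>\<^bsub>A\<^esub> \<in> carrier A"
      using that by auto
  qed
  have one: "\<one>\<^bsub>A\<^esub> \<in> carrier A" if "algebra complex_ring A" for A :: "'u calg"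
    using algebra.M_cring[OF that] by (simp add: cring_def ring.ring_simprules)
  show ?thesis
    unfolding is_category_def comm_algebras_def
    by (auto simp: ring_hom_def compose_def smult closed one Pi_iff extensional_def fun_eq_iff)
qed

lemma is_category_abelian_groups: "is_category (abelian_groups :: ('g monoid, 'g \<Rightarrow> 'g) cat)"
proof -
  have closed: "a \<otimes>\<^bsub>G\<^esub> b \<in> carrier G"
    if "comm_group G" "a \<in> carrier G" "b \<in> carrier G" for G :: "'g monoid" and a b
  proof -
    interpret comm_group G by fact
    show ?thesis using that by simp
  qed
  show ?thesis
    unfolding is_category_def abelian_groups_def
    by (auto simp: hom_def compose_def closed Pi_iff extensional_def fun_eq_iff)
qed

lemma is_category_compact_hausdorff:
  "is_category (compact_hausdorff :: ('x topology, 'x \<Rightarrow> 'x) cat)"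
proof -
  have comp: "continuous_map X Z (compose (topspace X) g f)"
    if "continuous_map X Y f" "continuous_map Y Z g" for X Y Z :: "'x topology" and f g
    using continuous_map_compose[OF that] by (rule continuous_map_eq) (simp add: compose_def)
  have pt: "f x \<in> topspace Y" if "continuous_map X Y f" "x \<in> topspace X"
    for X Y :: "'x topology" and f x
    using that by (auto simp: continuous_map_def)
  have ident: "continuous_map X X (restrict id (topspace X))" for X :: "'x topology"
    by (rule continuous_map_eq[OF continuous_map_id]) simp
  show ?thesis
    unfolding is_category_def compact_hausdorff_def
    by (auto simp: comp ident compose_extensional)
      (auto simp: compose_def extensional_def fun_eq_iff dest: pt)
qed

lemma is_category_compact_polyhedra: "is_category compact_polyhedra"
  unfolding compact_polyhedra_def
  by (intro is_category_full_subcategory is_category_compact_hausdorff)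

lemma algebra_cont_algebra: "algebra complex_ring (cont_algebra X)"
proof -
  have r: "continuous_map X euclidean (restrict f (topspace X)) \<longleftrightarrow> continuous_map X euclidean f"
    for f :: "'a \<Rightarrow> complex"
    using continuous_map_eq[of X euclidean f "restrict f (topspace X)"]
      continuous_map_eq[of X euclidean "restrict f (topspace X)" f] by auto
  have mult: "continuous_map X euclidean (\<lambda>x. f x * g x)"
    if "continuous_map X euclidean f" "continuous_map X euclidean g" for f g :: "'a \<Rightarrow> complex"
    using that by (simp add: continuous_map_atin tendsto_mult)
  have carr: "f \<in> carrier (cont_algebra X) \<longleftrightarrow>
      f \<in> extensional (topspace X) \<and> continuous_map X euclidean f" for f
    by (simp add: cont_algebra_def)
  have ops: "mult (cont_algebra X) = (\<lambda>f g. \<lambda>x\<in>topspace X. f x * g x)"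
    "one (cont_algebra X) = (\<lambda>x\<in>topspace X. 1)"
    "zero (cont_algebra X) = (\<lambda>x\<in>topspace X. 0)"
    "add (cont_algebra X) = (\<lambda>f g. \<lambda>x\<in>topspace X. f x + g x)"
    "smult (cont_algebra X) = (\<lambda>c f. \<lambda>x\<in>topspace X. c * f x)"
    by (simp_all add: cont_algebra_def)
  have ext: "f = g" if "f \<in> extensional (topspace X)" "g \<in> extensional (topspace X)"
    "\<And>x. x \<in> topspace X \<Longrightarrow> f x = g x" for f g :: "'a \<Rightarrow> complex"
    using that by (rule extensionalityI)
  have closed: "\<one>\<^bsub>cont_algebra X\<^esub> \<in> carrier (cont_algebra X)"
    "\<zero>\<^bsub>cont_algebra X\<^esub> \<in> carrier (cont_algebra X)"
    "\<lbrakk>f \<in> carrier (cont_algebra X); g \<in> carrier (cont_algebra X)\<rbrakk> \<Longrightarrow>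
      f \<otimes>\<^bsub>cont_algebra X\<^esub> g \<in> carrier (cont_algebra X)"
    "\<lbrakk>f \<in> carrier (cont_algebra X); g \<in> carrier (cont_algebra X)\<rbrakk> \<Longrightarrow>
      f \<oplus>\<^bsub>cont_algebra X\<^esub> g \<in> carrier (cont_algebra X)"
    "f \<in> carrier (cont_algebra X) \<Longrightarrow> c \<odot>\<^bsub>cont_algebra X\<^esub> f \<in> carrier (cont_algebra X)"
    for f g c
    by (simp_all add: carr ops r continuous_map_add mult)
  have mon: "comm_monoid (cont_algebra X)"
  proof (rule comm_monoidI)
  qed (use closed in \<open>auto intro!: ext simp: ops carr algebra_simps\<close>)
  have ab: "abelian_group (cont_algebra X)"
  proof (rule abelian_groupI)
    fix f assume f: "f \<in> carrier (cont_algebra X)"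
    show "\<exists>g\<in>carrier (cont_algebra X). g \<oplus>\<^bsub>cont_algebra X\<^esub> f = \<zero>\<^bsub>cont_algebra X\<^esub>"
    proof
      show "(-1) \<odot>\<^bsub>cont_algebra X\<^esub> f \<in> carrier (cont_algebra X)"
        using f by (rule closed)
      show "((-1) \<odot>\<^bsub>cont_algebra X\<^esub> f) \<oplus>\<^bsub>cont_algebra X\<^esub> f = \<zero>\<^bsub>cont_algebra X\<^esub>"
        by (auto intro!: ext simp: ops)
    qed
  qed (use closed in \<open>auto intro!: ext simp: ops carr algebra_simps\<close>)
  show ?thesis
  proof (rule algebraI)
    show "cring complex_ring" by (rule cring_complex_ring)
    show "cring (cont_algebra X)"
      by (rule cringI[OF ab mon]) (auto intro!: ext simp: ops algebra_simps)
  qed (use closed in \<open>auto intro!: ext simp: ops carr complex_ring_def algebra_simps\<close>)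
qed

lemma is_functor_cont_functor: "is_functor (opposite compact_hausdorff) comm_algebras cont_functor"
proof -
  have hom: "mmap cont_functor Y X \<phi> \<in> Mor comm_algebras (cont_algebra Y) (cont_algebra X)"
    if \<phi>: "\<phi> \<in> Mor compact_hausdorff X Y" for X Y :: "'x topology" and \<phi>
  proof -
    from \<phi> have c: "continuous_map X Y \<phi>" by (simp add: compact_hausdorff_def)
    then have pt: "\<phi> x \<in> topspace Y" if "x \<in> topspace X" for x
      using that by (auto simp: continuous_map_def)
    have comp: "continuous_map X euclidean (compose (topspace X) f \<phi>)"
      if "continuous_map Y euclidean f" for f :: "'x \<Rightarrow> complex"
      using continuous_map_compose[OF c that] by (rule continuous_map_eq) (simp add: compose_def)
    have mem: "f \<in> carrier (cont_algebra Y) \<Longrightarrow> compose (topspace X) f \<phi> \<in> carrier (cont_algebra X)" for f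
      by (simp add: cont_algebra_def comp)
    interpret Y: algebra complex_ring "cont_algebra Y" by (rule algebra_cont_algebra)
    have [simp]: "c \<odot>\<^bsub>cont_algebra Y\<^esub> f \<in> carrier (cont_algebra Y)"
      if "f \<in> carrier (cont_algebra Y)" for c f
      using Y.smult_closed[of c f] that by (simp add: complex_ring_def)
    show ?thesis
      by (auto simp: comm_algebras_def cont_functor_def ring_hom_def mem)
        (auto simp: cont_algebra_def compose_def pt fun_eq_iff)
  qed
  show ?thesis
    unfolding is_functor_def
  proof (intro conjI ballI)
    fix X :: "'x topology"
    show "omap cont_functor X \<in> Obj comm_algebras"
      by (simp add: cont_functor_def comm_algebras_def algebra_cont_algebra)
    show "mmap cont_functor X X (Ident (opposite compact_hausdorff) X) = Ident comm_algebras (omap cont_functor X)"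
      by (auto simp: cont_functor_def comm_algebras_def opposite_def compact_hausdorff_def
          cont_algebra_def compose_def extensional_def fun_eq_iff)
  next
    fix X Y :: "'x topology" and f
    assume "f \<in> Mor (opposite compact_hausdorff) X Y"
    then show "mmap cont_functor X Y f \<in> Mor comm_algebras (omap cont_functor X) (omap cont_functor Y)"
      using hom[of f Y X] by (simp add: opposite_def cont_functor_def)
  next
    fix X Y Z :: "'x topology" and f g
    assume f: "f \<in> Mor (opposite compact_hausdorff) X Y" and g: "g \<in> Mor (opposite compact_hausdorff) Y Z"
    have "compose (topspace Y) a f \<in> carrier (cont_algebra Y)" if "a \<in> carrier (cont_algebra X)" for a
      using hom[of f Y X] f that
      by (auto simp: opposite_def cont_functor_def comm_algebras_def ring_hom_def Pi_iff)
    moreover have "g x \<in> topspace Y" if "x \<in> topspace Z" for x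
      using g that by (auto simp: opposite_def compact_hausdorff_def continuous_map_def)
    ultimately show "mmap cont_functor X Z (Comp (opposite compact_hausdorff) X Y Z g f) =
        Comp comm_algebras (omap cont_functor X) (omap cont_functor Y) (omap cont_functor Z)
          (mmap cont_functor Y Z g) (mmap cont_functor X Y f)"
      by (auto simp: opposite_def cont_functor_def comm_algebras_def compact_hausdorff_def
          compose_def fun_eq_iff)
  qed
qed

lemma cylinder_exists:
  fixes X :: "'x topology" and e :: "'x \<times> real \<Rightarrow> 'x"
  assumes "inj e" and "X \<in> Obj compact_hausdorff"
  shows "\<exists>Y \<in> Obj (compact_hausdorff :: ('x topology, 'x \<Rightarrow> 'x) cat). \<exists>\<theta>.
    homeomorphic_map (prod_topology X (top_of_set {0..1::real})) Y \<theta>"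
proof -
  define P where "P = prod_topology X (top_of_set {0..1::real})"
  define Y where "Y = pullback_topology (range e) (inv_into UNIV e) P"
  have inv: "inv_into UNIV e (e p) = p" for p
    using assms(1) by simp
  have "homeomorphic_maps P Y e (inv_into UNIV e)"
    unfolding homeomorphic_maps_def
  proof (intro conjI ballI)
    show "continuous_map P Y e"
      unfolding Y_def
      by (rule continuous_map_pullback') (auto simp: comp_def inv intro: continuous_map_eq[OF continuous_map_id])
    show "continuous_map Y P (inv_into UNIV e)"
      using continuous_map_pullback[OF continuous_map_id, where A = "range e" and f = "inv_into UNIV e"]
      by (simp add: Y_def)
  qed (auto simp: Y_def topspace_pullback_topology inv)
  then have h: "homeomorphic_map P Y e"
    using homeomorphic_maps_map by blast
  have "compact_space P" "Hausdorff_space P"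
    using assms(2)
    by (auto simp: P_def compact_hausdorff_def compact_space_prod_topology compact_space_subtopology
        Hausdorff_space_prod_topology Hausdorff_space_subtopology)
  then have "compact_space Y" "Hausdorff_space Y"
    using h homeomorphic_compact_space homeomorphic_Hausdorff_space homeomorphic_map_imp_homeomorphic_space
    by blast+
  then have "Y \<in> Obj compact_hausdorff"
    by (simp add: compact_hausdorff_def)
  moreover have "\<exists>\<theta>. homeomorphic_map (prod_topology X (top_of_set {0..1::real})) Y \<theta>"
    using h P_def by metis
  ultimately show ?thesis
    by (rule bexI[rotated])
qed

end

(*
Homotopic maps of compact Hausdorff spaces should induce the same map on F(C(-)). As F commutes with
filtered colimits, every element of F(C(Y)) comes from F(A) for a finitely generated subalgebra A,
say generated by the coordinates of f : Y \<rightarrow> R^n. A homomorphism from A to C(T) is a map from T to the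
Zariski closure V of f(Y), so an element of F(A) can be pulled back along maps T \<rightarrow> V. If two maps
a, b : T \<rightarrow> V are so close that the segments from a(t) to b(t) lie in a neighbourhood U of f(Y) with
a retraction r : U \<rightarrow> V, then (a, b) factors exactly through a polyhedron |K| of pairs (p, q) with
segments in U, and r((1 - s) p + s q) is a homotopy |K| x [0,1] \<rightarrow> V; hence the two pullbacks agree.
A general homotopy is a chain of close maps, since [0,1] is connected.

The retraction exists because compact semialgebraic sets are absolute neighbourhood extensors. This
is shown by cylindrical decomposition, without triangulating: over the other coordinates such a set
is a finite union of pieces between graphs of continuous functions, over semialgebraic bases.
*)

theory Submission
  imports Defs "HOL-Computational_Algebra.Polynomial"
begin

section \<open>Sign patterns of families of real polynomials\<close>

text \<open>\<open>F\<close> is only known to respect algebraic colimits, so no limit can be taken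
  inside \<open>F\<close>: closeness of two maps says nothing until both factor, exactly, through
  one polyhedron over which a homotopy joins them. That homotopy cannot be kept inside f(Y), an
  arbitrary compact set, say a Cantor set. But a homomorphism out of A sees only the polynomial
  relations between the generators, so values in V are just as good, and V has no wild local
  topology. V may be unbounded and is therefore cut by cubes: f(Y) lies in the one of radius B, the
  segments in the one of radius B + 1. All relations on f(Y) together are an infinite system;
  Hilbert's basis theorem makes it finite, hence semialgebraic. All dimensions share the type
  \<open>nat \<Rightarrow> real\<close>, with \<real>^I as the sequences vanishing off I, so that an
  induction on the dimension stays in one type. Universes matter too: the index category of a
  colimit must live in \<open>'x \<Rightarrow> complex\<close> and the polyhedra in
  \<open>'x\<close>. There is room for them, since the cylinder over a nonempty X, realized in
  \<open>'x\<close>, has at least as many points as \<real>.\<close>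

definition gap :: "real set \<Rightarrow> real \<Rightarrow> real \<Rightarrow> real \<Rightarrow> bool" where
  "gap Z t a b \<longleftrightarrow> a \<in> Z \<and> b \<in> Z \<and> a < t \<and> t < b \<and> (\<forall>z\<in>Z. z \<le> a \<or> b \<le> z)"

lemma gap_exists:
  assumes "finite Z" "t \<notin> Z" "lo \<in> Z" "hi \<in> Z" "lo \<le> t" "t \<le> hi"
  shows "\<exists>a b. gap Z t a b"
proof -
  let ?A = "{z\<in>Z. z < t}" and ?B = "{z\<in>Z. t < z}"
  have "lo \<in> ?A" "hi \<in> ?B" using assms by (auto simp: order_less_le)
  then have ne: "?A \<noteq> {}" "?B \<noteq> {}" by blast+
  have fin: "finite ?A" "finite ?B" using assms by auto
  have "gap Z t (Max ?A) (Min ?B)"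
    using Max_in[OF fin(1) ne(1)] Min_in[OF fin(2) ne(2)] Max_ge[OF fin(1)] Min_le[OF fin(2)] assms(2)
    unfolding gap_def by (smt (verit) mem_Collect_eq)
  then show ?thesis by blast
qed

lemma gap_unique: "gap Z t a b \<Longrightarrow> gap Z t c d \<Longrightarrow> a = c \<and> b = d"
  unfolding gap_def by (meson antisym less_le_trans linorder_not_less order.trans order_less_le)

lemma gap_inside: "gap Z t a b \<Longrightarrow> a < u \<Longrightarrow> u < b \<Longrightarrow> gap Z u a b"
  by (auto simp: gap_def)

lemma gap_not_mem: "gap Z t a b \<Longrightarrow> t \<notin> Z"
  by (auto simp: gap_def)

text \<open>Piecewise linear interpolation. The neighbours of a point in \<open>Z\<close> come from
  \<open>gap\<close>, so the finite set never has to be listed in order; surjectivity interpolates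
  backwards on the gaps of the image of \<open>Z\<close>.\<close>

lemma strict_mono_extension:
  fixes M :: real
  assumes fin: "finite Z" and sub: "Z \<subseteq> {-M..M}" and ends: "-M \<in> Z" "M \<in> Z"
    and mono: "strict_mono_on Z \<psi>" and "\<psi> (-M) = -M" "\<psi> M = M"
  shows "\<exists>\<phi>. strict_mono_on {-M..M} \<phi> \<and> \<phi> ` {-M..M} = {-M..M} \<and> (\<forall>z\<in>Z. \<phi> z = \<psi> z)"
proof -
  have less: "\<psi> a < \<psi> b" if "a \<in> Z" "b \<in> Z" "a < b" for a b
    using mono that by (auto simp: strict_mono_on_def)
  have le: "\<psi> a \<le> \<psi> b" if "a \<in> Z" "b \<in> Z" "a \<le> b" for a b
    using less[of a b] that by (cases "a = b") auto
  define \<phi> where "\<phi> t = (if t \<in> Z then \<psi> t else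
     (let (a, b) = (SOME (a, b). gap Z t a b) in \<psi> a + (t - a) / (b - a) * (\<psi> b - \<psi> a)))" for t
  have lin: "\<phi> t = \<psi> a + (t - a) / (b - a) * (\<psi> b - \<psi> a)" if g: "gap Z t a b" for t a b
  proof -
    have "(SOME (a, b). gap Z t a b) = (a, b)"
      by (rule some_equality) (use g gap_unique in auto)
    then show ?thesis using gap_not_mem[OF g] by (simp add: \<phi>_def)
  qed
  have between: "\<psi> a < \<phi> t \<and> \<phi> t < \<psi> b" if g: "gap Z t a b" for t a b
  proof -
    have *: "a < t" "t < b" "\<psi> a < \<psi> b" using g less by (auto simp: gap_def)
    have u: "0 < (t - a) / (b - a)" "(t - a) / (b - a) < 1" using * by auto
    have "0 < (t - a) / (b - a) * (\<psi> b - \<psi> a)" "(t - a) / (b - a) * (\<psi> b - \<psi> a) < 1 * (\<psi> b - \<psi> a)"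
      using * mult_pos_pos[OF u(1)] mult_strict_right_mono[OF u(2)] by (meson diff_gt_0_iff_gt)+
    then show ?thesis unfolding lin[OF g] by simp
  qed
  have ex: "\<exists>a b. gap Z t a b" if "t \<in> {-M..M}" "t \<notin> Z" for t
    using gap_exists[OF fin that(2) ends] that by auto
  have onZ: "\<phi> z = \<psi> z" if "z \<in> Z" for z using that by (simp add: \<phi>_def)
  have smono: "\<phi> s < \<phi> t" if s: "s \<in> {-M..M}" and t: "t \<in> {-M..M}" and "s < t" for s t
  proof (cases "s \<in> Z"; cases "t \<in> Z")
    assume "s \<in> Z" "t \<in> Z" then show ?thesis using less onZ \<open>s < t\<close> by simp
  next
    assume *: "s \<in> Z" "t \<notin> Z"
    then obtain a b where g: "gap Z t a b" using ex t by blast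
    then have "s \<le> a" using * \<open>s < t\<close> by (auto simp: gap_def)
    then have "\<psi> s \<le> \<psi> a" using le[of s a] * g by (auto simp: gap_def)
    then show ?thesis using between[OF g] onZ * by simp
  next
    assume *: "s \<notin> Z" "t \<in> Z"
    then obtain a b where g: "gap Z s a b" using ex s by blast
    then have "b \<le> t" using * \<open>s < t\<close> by (auto simp: gap_def)
    then have "\<psi> b \<le> \<psi> t" using le[of b t] * g by (auto simp: gap_def)
    then show ?thesis using between[OF g] onZ * by simp
  next
    assume *: "s \<notin> Z" "t \<notin> Z"
    obtain a b where g: "gap Z s a b" using ex s * by blast
    obtain c d where h: "gap Z t c d" using ex t * by blast
    show ?thesis
    proof (cases "b \<le> c")
      case True
      then have "\<psi> b \<le> \<psi> c" using le g h by (auto simp: gap_def)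
      then show ?thesis using between[OF g] between[OF h] by simp
    next
      case False
      then have "t < b" using g h by (auto simp: gap_def)
      then have h': "gap Z t a b" using gap_inside[OF g] g \<open>s < t\<close> by (auto simp: gap_def)
      have "\<psi> a < \<psi> b" "a < b" using less g by (auto simp: gap_def)
      then have "(s - a) / (b - a) * (\<psi> b - \<psi> a) < (t - a) / (b - a) * (\<psi> b - \<psi> a)"
        using \<open>s < t\<close> by (intro mult_strict_right_mono divide_strict_right_mono) auto
      then show ?thesis unfolding lin[OF g] lin[OF h'] by simp
    qed
  qed
  have Mpos: "-M \<le> M" using ends sub by force
  have img: "\<phi> t \<in> {-M..M}" if t: "t \<in> {-M..M}" for t
  proof -
    have "\<phi> (-M) \<le> \<phi> t" "\<phi> t \<le> \<phi> M" using smono[of "-M" t] smono[of t M] t Mpos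
      by (cases "t = -M"; cases "t = M"; auto)+
    then show ?thesis using onZ ends assms by simp
  qed
  have surj: "w \<in> \<phi> ` {-M..M}" if w: "w \<in> {-M..M}" for w
  proof (cases "w \<in> \<psi> ` Z")
    case True
    then obtain z where "z \<in> Z" "w = \<phi> z" using onZ by auto
    then show ?thesis using sub by blast
  next
    case False
    have "\<exists>a' b'. gap (\<psi> ` Z) w a' b'"
    proof (rule gap_exists)
      show "-M \<in> \<psi> ` Z" "M \<in> \<psi> ` Z" using imageI[OF ends(1), of \<psi>] imageI[OF ends(2), of \<psi>] assms(6,7) by simp_all
    qed (use fin False w in auto)
    then obtain a b where ab: "a \<in> Z" "b \<in> Z" "gap (\<psi> ` Z) w (\<psi> a) (\<psi> b)"
      by (auto simp: gap_def)
    have psi: "\<psi> a < w" "w < \<psi> b" using ab by (auto simp: gap_def)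
    have "a < b"
      using le[of b a] ab psi by force
    define t where "t = a + (w - \<psi> a) / (\<psi> b - \<psi> a) * (b - a)"
    have u: "0 < (w - \<psi> a) / (\<psi> b - \<psi> a)" "(w - \<psi> a) / (\<psi> b - \<psi> a) < 1" using psi by auto
    have "0 < (w - \<psi> a) / (\<psi> b - \<psi> a) * (b - a)" "(w - \<psi> a) / (\<psi> b - \<psi> a) * (b - a) < 1 * (b - a)"
      using \<open>a < b\<close> mult_pos_pos[OF u(1)] mult_strict_right_mono[OF u(2)] by (meson diff_gt_0_iff_gt)+
    then have t: "a < t" "t < b" by (auto simp: t_def)
    have g: "gap Z t a b"
      unfolding gap_def
    proof (intro conjI ballI ab t)
      fix z assume z: "z \<in> Z"
      then have "\<psi> z \<le> \<psi> a \<or> \<psi> b \<le> \<psi> z" using ab by (auto simp: gap_def)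
      then show "z \<le> a \<or> b \<le> z" using less[of a z] less[of z b] z ab by force
    qed
    have "(t - a) / (b - a) = (w - \<psi> a) / (\<psi> b - \<psi> a)" using \<open>a < b\<close> by (simp add: t_def)
    then have "\<phi> t = w" unfolding lin[OF g] using psi by simp
    moreover have "t \<in> {-M..M}" using t ab sub by force
    ultimately show ?thesis by blast
  qed
  show ?thesis
    by (rule exI[of _ \<phi>]) (use smono img surj onZ in \<open>auto simp: strict_mono_on_def\<close>)
qed

lemma poly_sgn_const:
  fixes p :: "real poly"
  assumes nz: "\<And>u. a < u \<Longrightarrow> u < b \<Longrightarrow> poly p u \<noteq> 0" and u: "a < u" "u < b" and v: "a < v" "v < b"
  shows "sgn (poly p u) = sgn (poly p v)"
proof -
  have *: "sgn (poly p u) = sgn (poly p v)" if "a < u" "u < v" "v < b" for u v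
  proof (rule ccontr)
    assume "sgn (poly p u) \<noteq> sgn (poly p v)"
    moreover have "poly p u \<noteq> 0" "poly p v \<noteq> 0" using nz that by auto
    ultimately have "poly p u * poly p v < 0"
      by (auto simp: sgn_if mult_less_0_iff split: if_splits)
    then obtain x where "u < x" "x < v" "poly p x = 0" using poly_IVT[OF \<open>u < v\<close>] by blast
    then show False using nz that by auto
  qed
  then show ?thesis using u v by (cases u v rule: linorder_cases) (auto simp: *)
qed

text \<open>The factor \<open>s\<close> treats increasing and decreasing polynomials at once. The
  ends of the interval are included because they will be marked points, at which the derivative may
  vanish.\<close>

lemma poly_strict_mono_pderiv:
  fixes p :: "real poly"
  assumes pos: "\<And>u. a < u \<Longrightarrow> u < b \<Longrightarrow> s * poly (pderiv p) u > 0" and "a \<le> u" "u < v" "v \<le> b"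
  shows "s * poly p u < s * poly p v"
proof -
  obtain x where x: "u < x" "x < v" "poly p v - poly p u = (v - u) * poly (pderiv p) x"
    using poly_MVT[OF \<open>u < v\<close>] by blast
  have "(v - u) * (s * poly (pderiv p) x) > 0"
    using pos[of x] x assms(2,3,4) by auto
  also have "(v - u) * (s * poly (pderiv p) x) = s * (poly p v - poly p u)"
    by (simp only: x(3)) (simp add: algebra_simps)
  finally show ?thesis by (simp add: algebra_simps)
qed

section \<open>Matching the sign diagrams of two families of polynomials in one variable\<close>

text \<open>A pair in \<open>G\<close> will be one parametrized polynomial at two parameter points.
  An order isomorphism \<phi> of the interval says that both have the same roots and signs in the
  same order, without numbering any roots.\<close>

definition matches :: "real \<Rightarrow> (real \<Rightarrow> real) \<Rightarrow> (real poly \<times> real poly) set \<Rightarrow> bool" where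
  "matches M \<phi> G \<longleftrightarrow> strict_mono_on {-M..M} \<phi> \<and> \<phi> ` {-M..M} = {-M..M} \<and>
     (\<forall>(p, p')\<in>G. \<forall>t\<in>{-M..M}. sgn (poly p t) = sgn (poly p' (\<phi> t)))"

lemma matches_subset: "matches M \<phi> G \<Longrightarrow> H \<subseteq> G \<Longrightarrow> matches M \<phi> H"
  unfolding matches_def by blast

lemma matches_less_iff:
  assumes "matches M \<phi> G" "s \<in> {-M..M}" "t \<in> {-M..M}"
  shows "\<phi> s < \<phi> t \<longleftrightarrow> s < t" "\<phi> s \<le> \<phi> t \<longleftrightarrow> s \<le> t"
proof -
  have m: "s < t \<Longrightarrow> \<phi> s < \<phi> t" if "s \<in> {-M..M}" "t \<in> {-M..M}" for s t
    using assms(1) that by (auto simp: matches_def strict_mono_on_def)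
  show "\<phi> s < \<phi> t \<longleftrightarrow> s < t" "\<phi> s \<le> \<phi> t \<longleftrightarrow> s \<le> t"
    using m[OF assms(2,3)] m[OF assms(3,2)] by (cases s t rule: linorder_cases; force)+
qed

lemma matches_ends:
  assumes "matches M \<phi> G" "M > 0"
  shows "\<phi> M = M" "\<phi> (-M) = -M"
proof -
  have img: "\<phi> ` {-M..M} = {-M..M}" using assms by (simp add: matches_def)
  have "M \<in> \<phi> ` {-M..M}" "-M \<in> \<phi> ` {-M..M}" unfolding img using assms(2) by auto
  then obtain u v where u: "u \<in> {-M..M}" "\<phi> u = M" and v: "v \<in> {-M..M}" "\<phi> v = -M" by (metis imageE)
  have e: "M \<in> {-M..M}" "-M \<in> {-M..M}" using assms(2) by auto
  then have "\<phi> M \<in> {-M..M}" "\<phi> (-M) \<in> {-M..M}" using img by blast+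
  then show "\<phi> M = M" "\<phi> (-M) = -M"
    using matches_less_iff(2)[OF assms(1) u(1) e(1)] matches_less_iff(2)[OF assms(1) e(2) v(1)] u v by force+
qed

text \<open>Between consecutive marked points the derivative has constant sign, so \<open>q\<close>
  is strictly monotone and has at most one root there; whether it has one is visible from its signs
  at the marked points. As these signs agree for \<open>q'\<close>, the new roots correspond, and
  \<phi> is changed so as to map them to each other.\<close>

lemma matches_add:
  fixes q q' :: "real poly"
  assumes M: "M > 0" and m: "matches M \<phi> G" and fin: "finite G"
    and pd: "(pderiv q, pderiv q') \<in> G"
    and ends: "sgn (poly q M) = sgn (poly q' M)" "sgn (poly q (-M)) = sgn (poly q' (-M))"
    and roots: "\<And>r r' z. (r, r') \<in> G \<Longrightarrow> r \<noteq> 0 \<Longrightarrow> z \<in> {-M..M} \<Longrightarrow> poly r z = 0 \<Longrightarrow>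
      sgn (poly q z) = sgn (poly q' (\<phi> z))"
  shows "\<exists>\<phi>2. matches M \<phi>2 (insert (q, q') G)"
proof -
  note lt = matches_less_iff(1)[OF m] and le = matches_less_iff(2)[OF m]
  have img: "\<phi> ` {-M..M} = {-M..M}" using m by (simp add: matches_def)
  have sg: "sgn (poly r t) = sgn (poly r' (\<phi> t))" if "(r, r') \<in> G" "t \<in> {-M..M}" for r r' t
    using m that by (auto simp: matches_def)
  have eM: "M \<in> {-M..M}" "-M \<in> {-M..M}" using M by auto
  note \<phi>M = matches_ends[OF m M]
  have zero: "poly r' t = 0" if "(0, r') \<in> G" "t \<in> {-M..M}" for r' t
  proof -
    obtain u where "u \<in> {-M..M}" "t = \<phi> u" using img \<open>t \<in> _\<close> by blast
    then show ?thesis using sg[OF that(1), of u] by (simp add: sgn_zero_iff)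
  qed
  show ?thesis
  proof (cases "pderiv q = 0")
    case True
    have "pderiv q' = 0"
    proof (rule ccontr)
      assume "pderiv q' \<noteq> 0"
      then have "finite {x. poly (pderiv q') x = 0}" by (rule poly_roots_finite)
      moreover have "{-M..M} \<subseteq> {x. poly (pderiv q') x = 0}" using zero pd True by auto
      ultimately have "finite {-M..M}" by (rule rev_finite_subset)
      then show False using M infinite_Icc[of "-M" M] by simp
    qed
    then obtain c c' where "q = [:c:]" "q' = [:c':]"
      using True by (metis pderiv_iszero)
    then have "\<forall>t\<in>{-M..M}. sgn (poly q t) = sgn (poly q' (\<phi> t))" using ends by simp
    then have "matches M \<phi> (insert (q, q') G)" using m by (auto simp: matches_def)
    then show ?thesis by blast
  next
    case False
    \<comment> \<open>The marked points. A member equal to 0 would contribute infinitely many roots;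
      for it \<open>zero\<close> has settled the sign on the whole interval.\<close>
    define Z where "Z = {-M, M} \<union> {z\<in>{-M..M}. \<exists>(r, r')\<in>G. r \<noteq> 0 \<and> poly r z = 0}"
    have Zsub: "Z \<subseteq> {-M..M}" using M by (auto simp: Z_def)
    have "finite (\<Union>(r, r')\<in>G. if r = 0 then {} else {x. poly r x = 0})"
      using fin by (auto simp: poly_roots_finite)
    then have finZ: "finite Z"
      unfolding Z_def by (auto elim!: rev_finite_subset)
    have endZ: "-M \<in> Z" "M \<in> Z" by (auto simp: Z_def)
    have sgZ: "sgn (poly q z) = sgn (poly q' (\<phi> z))" if "z \<in> Z" for z
      using that roots ends \<phi>M by (auto simp: Z_def)
    have nz: "poly r u \<noteq> 0" if "gap Z t a b" "a < u" "u < b" "(r, r') \<in> G" "r \<noteq> 0" for t a b u r r'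
    proof
      assume "poly r u = 0"
      moreover have "u \<in> {-M..M}" using that Zsub by (force simp: gap_def)
      ultimately have "u \<in> Z" using that by (auto simp: Z_def)
      then show False using that by (auto simp: gap_def)
    qed
    \<comment> \<open>One direction \<open>s\<close> serves both polynomials: \<phi> carries the
      sign of the derivative of \<open>q\<close> in this gap to the sign of the derivative of
      \<open>q'\<close> in the image gap.\<close>
    have mono: "\<exists>s. s \<noteq> 0 \<and> (\<forall>u v. a \<le> u \<longrightarrow> u < v \<longrightarrow> v \<le> b \<longrightarrow> s * poly q u < s * poly q v) \<and>
        (\<forall>u v. \<phi> a \<le> u \<longrightarrow> u < v \<longrightarrow> v \<le> \<phi> b \<longrightarrow> s * poly q' u < s * poly q' v)"
      if g: "gap Z t a b" for t a b
    proof -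
      define s where "s = sgn (poly (pderiv q) t)"
      have t: "a < t" "t < b" using g by (auto simp: gap_def)
      have ab: "a \<in> {-M..M}" "b \<in> {-M..M}" using g Zsub by (auto simp: gap_def)
      have s: "s \<noteq> 0" using nz[OF g t pd False] by (simp add: s_def sgn_zero_iff)
      have su: "sgn (poly (pderiv q) u) = s" if "a < u" "u < b" for u
        unfolding s_def by (rule poly_sgn_const[of a b]) (use nz[OF g _ _ pd False] that t in auto)
      have p1: "s * poly (pderiv q) u > 0" if "a < u" "u < b" for u
        using su[OF that] s by (auto simp: sgn_if zero_less_mult_iff split: if_splits)
      have p2: "s * poly (pderiv q') w > 0" if w: "\<phi> a < w" "w < \<phi> b" for w
      proof -
        have "\<phi> a \<in> {-M..M}" "\<phi> b \<in> {-M..M}" using ab img by blast+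
        then have "w \<in> \<phi> ` {-M..M}" using w img by auto
        then obtain u where u: "u \<in> {-M..M}" "w = \<phi> u" by blast
        then have "a < u" "u < b" using w lt ab by auto
        then have "sgn (poly (pderiv q') w) = s" using sg[OF pd] u su by metis
        then show ?thesis using s by (auto simp: sgn_if zero_less_mult_iff split: if_splits)
      qed
      show ?thesis
        by (rule exI[of _ s]) (use s poly_strict_mono_pderiv[OF p1] poly_strict_mono_pderiv[OF p2] in blast)
    qed
    define N where "N = {n\<in>{-M..M}. poly q n = 0}"
    have "q \<noteq> 0" using False by auto
    then have finN: "finite N" using poly_roots_finite[of q] by (auto simp: N_def elim!: rev_finite_subset)
    \<comment> \<open>\<open>n'\<close> is the partner of the root \<open>n\<close>: a root of
      \<open>q'\<close> in the image of the gap around \<open>n\<close>, supplied by the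
      intermediate value theorem.\<close>
    define good where "good n n' \<longleftrightarrow> (\<exists>a b. gap Z n a b \<and> \<phi> a < n' \<and> n' < \<phi> b \<and> poly q' n' = 0)" for n n'
    have good_ex: "\<exists>n'. good n n'" if n: "n \<in> N" "n \<notin> Z" for n
    proof -
      obtain a b where g: "gap Z n a b"
        using gap_exists[OF finZ n(2) endZ] n by (auto simp: N_def)
      obtain s where s: "s \<noteq> 0" "\<And>u v. a \<le> u \<Longrightarrow> u < v \<Longrightarrow> v \<le> b \<Longrightarrow> s * poly q u < s * poly q v"
        using mono[OF g] by blast
      have ab: "a \<in> Z" "b \<in> Z" "a < n" "n < b" using g by (auto simp: gap_def)
      have "s * poly q a < 0" "0 < s * poly q b"
        using s(2)[of a n] s(2)[of n b] ab n by (auto simp: N_def)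
      then have "sgn (poly q a) * sgn (poly q b) < 0"
        by (auto simp: mult_less_0_iff zero_less_mult_iff)
      then have "poly q' (\<phi> a) * poly q' (\<phi> b) < 0"
        using sgZ ab by (auto simp: mult_less_0_iff)
      moreover have "\<phi> a < \<phi> b" using lt ab Zsub by (metis (no_types, lifting) order.strict_trans subsetD)
      ultimately show ?thesis using poly_IVT[of "\<phi> a" "\<phi> b" q'] g unfolding good_def by blast
    qed
    define \<psi> where "\<psi> n = (if n \<in> Z then \<phi> n else (SOME n'. good n n'))" for n
    have \<psi>Z: "\<psi> z = \<phi> z" if "z \<in> Z" for z using that by (simp add: \<psi>_def)
    have \<psi>N: "\<phi> a < \<psi> n \<and> \<psi> n < \<phi> b \<and> poly q' (\<psi> n) = 0" if "n \<in> N" "gap Z n a b" for n a b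
    proof -
      have "n \<notin> Z" using gap_not_mem that by blast
      then have "good n (\<psi> n)" using good_ex[OF that(1)] by (simp add: \<psi>_def someI_ex)
      then show ?thesis using gap_unique[OF that(2)] by (auto simp: good_def)
    qed
    have Nsub: "N \<subseteq> {-M..M}" by (auto simp: N_def)
    have gapN: "\<exists>a b. gap Z t a b" if "t \<in> {-M..M}" "t \<notin> Z" for t
      using gap_exists[OF finZ that(2) endZ] that by auto
    \<comment> \<open>A gap contains at most one root of \<open>q\<close>, so two different roots
      outside \<open>Z\<close> are separated by a marked point, and so are their partners.\<close>
    have sm: "\<psi> u < \<psi> v" if u: "u \<in> Z \<union> N" and v: "v \<in> Z \<union> N" and uv: "u < v" for u v
    proof -
      have R: "u \<in> {-M..M}" "v \<in> {-M..M}" using u v Zsub Nsub by auto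
      consider "u \<in> Z" "v \<in> Z" | "u \<in> Z" "v \<notin> Z" | "u \<notin> Z" "v \<in> Z" | "u \<notin> Z" "v \<notin> Z" by blast
      then show ?thesis
      proof cases
        case 1 then show ?thesis using \<psi>Z lt R uv by simp
      next
        case 2
        obtain c d where g: "gap Z v c d" using gapN R 2 by blast
        then have "u \<le> c" "c \<in> Z" using 2 uv by (auto simp: gap_def)
        then have "\<phi> u \<le> \<phi> c" using le Zsub R by auto
        then show ?thesis using \<psi>N[OF _ g] v 2 \<psi>Z by force
      next
        case 3
        obtain a b where g: "gap Z u a b" using gapN R 3 by blast
        then have "b \<le> v" "b \<in> Z" using 3 uv by (auto simp: gap_def)
        then have "\<phi> b \<le> \<phi> v" using le Zsub R by auto
        then show ?thesis using \<psi>N[OF _ g] u 3 \<psi>Z by force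
      next
        case 4
        obtain a b where g: "gap Z u a b" using gapN R 4 by blast
        obtain c d where h: "gap Z v c d" using gapN R 4 by blast
        have "b \<le> v"
        proof (rule ccontr)
          assume "\<not> b \<le> v"
          then have ord: "a \<le> u" "v \<le> b" using g by (auto simp: gap_def)
          obtain s where s: "\<And>u v. a \<le> u \<Longrightarrow> u < v \<Longrightarrow> v \<le> b \<Longrightarrow> s * poly q u < s * poly q v"
            using mono[OF g] by blast
          have "s * poly q u < s * poly q v" using s[OF ord(1) uv ord(2)] .
          then show False using u v 4 by (auto simp: N_def)
        qed
        then have "b \<le> c" "b \<in> Z" "c \<in> Z" using g h by (auto simp: gap_def)
        then have "\<phi> b \<le> \<phi> c" using le[of b c] subsetD[OF Zsub] by blast
        then show ?thesis using \<psi>N[OF _ g] \<psi>N[OF _ h] u v 4 by force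
      qed
    qed
    have "\<exists>\<phi>2. strict_mono_on {-M..M} \<phi>2 \<and> \<phi>2 ` {-M..M} = {-M..M} \<and> (\<forall>z\<in>Z \<union> N. \<phi>2 z = \<psi> z)"
      by (rule strict_mono_extension)
        (use finZ finN Zsub Nsub endZ sm \<psi>Z \<phi>M in \<open>auto simp: strict_mono_on_def\<close>)
    then obtain \<phi>2 where \<phi>2: "strict_mono_on {-M..M} \<phi>2" "\<phi>2 ` {-M..M} = {-M..M}"
      "\<And>z. z \<in> Z \<union> N \<Longrightarrow> \<phi>2 z = \<psi> z" by blast
    have lt2: "\<phi>2 s < \<phi>2 t" if "s \<in> {-M..M}" "t \<in> {-M..M}" "s < t" for s t
      using \<phi>2(1) that by (auto simp: strict_mono_on_def)
    have gap2: "\<phi> a < \<phi>2 t \<and> \<phi>2 t < \<phi> b" if "gap Z t a b" for t a b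
    proof -
      have "a \<in> Z" "b \<in> Z" "a < t" "t < b" using that by (auto simp: gap_def)
      moreover have "a \<in> {-M..M}" "b \<in> {-M..M}" using calculation Zsub by auto
      ultimately show ?thesis using lt2[of a t] lt2[of t b] \<phi>2(3)[of a] \<phi>2(3)[of b] \<psi>Z[of a] \<psi>Z[of b] by auto
    qed
    have G2: "sgn (poly r t) = sgn (poly r' (\<phi>2 t))" if r: "(r, r') \<in> G" and t: "t \<in> {-M..M}" for r r' t
    proof (cases "r = 0")
      case True
      moreover have "\<phi>2 t \<in> {-M..M}" using \<phi>2(2) t by blast
      ultimately show ?thesis using zero r by simp
    next
      case False
      show ?thesis
      proof (cases "t \<in> Z")
        case True then show ?thesis using \<phi>2(3) \<psi>Z sg[OF r t] by simp
      next
        case tZ: False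
        then obtain a b where g: "gap Z t a b" using gapN t by blast
        have ab: "a \<in> {-M..M}" "b \<in> {-M..M}" "a < t" "t < b" using g Zsub by (auto simp: gap_def)
        have "\<phi>2 t \<in> \<phi> ` {-M..M}" using \<phi>2(2) t img by blast
        then obtain u where u: "u \<in> {-M..M}" "\<phi>2 t = \<phi> u" by blast
        then have "a < u" "u < b" using gap2[OF g] lt ab by auto
        then have "sgn (poly r t) = sgn (poly r u)"
          by (intro poly_sgn_const[of a b]) (use nz[OF g _ _ r False] ab in auto)
        then show ?thesis using sg[OF r u(1)] u by simp
      qed
    qed
    have Q2: "sgn (poly q t) = sgn (poly q' (\<phi>2 t))" if t: "t \<in> {-M..M}" for t
    proof (cases "t \<in> Z")
      case True then show ?thesis using \<phi>2(3) \<psi>Z sgZ by simp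
    next
      case False
      then obtain a b where g: "gap Z t a b" using gapN t by blast
      have ab: "a \<in> {-M..M}" "b \<in> {-M..M}" "a < t" "t < b" "a \<in> Z" "b \<in> Z" using g Zsub by (auto simp: gap_def)
      obtain s where s: "s \<noteq> 0" "\<And>u v. a \<le> u \<Longrightarrow> u < v \<Longrightarrow> v \<le> b \<Longrightarrow> s * poly q u < s * poly q v"
        "\<And>u v. \<phi> a \<le> u \<Longrightarrow> u < v \<Longrightarrow> v \<le> \<phi> b \<Longrightarrow> s * poly q' u < s * poly q' v"
        using mono[OF g] by blast
      have pos: "sgn x = sgn y" if "s * x > 0" "s * y > 0" for x y
        using that by (auto simp: zero_less_mult_iff)
      have neg: "sgn x = sgn y" if "s * x < 0" "s * y < 0" for x y
        using that by (auto simp: mult_less_0_iff)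
      have sgs: "s * y \<ge> 0" if "sgn x = sgn y" "s * x \<ge> 0" for x y :: real
        using that by (auto simp: sgn_if zero_le_mult_iff split: if_splits)
      have sgs': "s * y \<le> 0" if "sgn x = sgn y" "s * x \<le> 0" for x y :: real
        using that by (auto simp: sgn_if mult_le_0_iff split: if_splits)
      note b2 = gap2[OF g]
      show ?thesis
      proof (cases "\<exists>n\<in>N. a < n \<and> n < b")
        case True
        then obtain n where n: "n \<in> N" "a < n" "n < b" by blast
        have gn: "gap Z n a b" using gap_inside[OF g n(2,3)] .
        have n2: "\<phi>2 n = \<psi> n" using n \<phi>2(3) by blast
        have q0: "poly q n = 0" "poly q' (\<phi>2 n) = 0" using n n2 \<psi>N[OF n(1) gn] by (auto simp: N_def)
        have nR: "n \<in> {-M..M}" using n Nsub by blast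
        have nb: "\<phi> a < \<phi>2 n" "\<phi>2 n < \<phi> b" using \<psi>N[OF n(1) gn] n2 by auto
        show ?thesis
        proof (cases t n rule: linorder_cases)
          case less
          show ?thesis
            by (rule neg) (use s(2)[of t n] s(3)[of "\<phi>2 t" "\<phi>2 n"] lt2[OF t nR less] less q0 b2 ab n nb in auto)
        next
          case equal then show ?thesis using q0 by simp
        next
          case greater
          show ?thesis
            by (rule pos) (use s(2)[of n t] s(3)[of "\<phi>2 n" "\<phi>2 t"] lt2[OF nR t greater] greater q0 b2 ab n nb in auto)
        qed
      next
        case noN: False
        \<comment> \<open>Without a root inside, the increasing \<open>s * q\<close> is either
          nonnegative at the left end, hence positive inside, or nonpositive at the right end, hence
          negative inside. The same end decides for \<open>q'\<close>.\<close>
        have "s * poly q a \<ge> 0 \<or> s * poly q b \<le> 0"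
        proof (rule ccontr)
          assume "\<not> ?thesis"
          then have "poly q a * poly q b < 0" using s(1)
            by (auto simp: zero_less_mult_iff mult_less_0_iff not_le)
          then obtain x where x: "a < x" "x < b" "poly q x = 0" using poly_IVT[of a b q] ab by auto
          then have "x \<in> N" using ab by (auto simp: N_def)
          then show False using noN x by blast
        qed
        then show ?thesis
        proof
          assume p: "s * poly q a \<ge> 0"
          then have "s * poly q' (\<phi> a) \<ge> 0" using sgs[OF sgZ] ab by blast
          then show ?thesis
            by (intro pos) (use s(2)[of a t] s(3)[of "\<phi> a" "\<phi>2 t"] b2 ab p in auto)
        next
          assume p: "s * poly q b \<le> 0"
          then have "s * poly q' (\<phi> b) \<le> 0" using sgs'[OF sgZ] ab by blast
          then show ?thesis
            by (intro neg) (use s(2)[of t b] s(3)[of "\<phi>2 t" "\<phi> b"] b2 ab p in auto)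
        qed
      qed
    qed
    have "matches M \<phi>2 (insert (q, q') G)"
      using \<phi>2 G2 Q2 by (auto simp: matches_def)
    then show ?thesis by blast
  qed
qed

section \<open>Polynomial functions, and polynomials whose coefficients are polynomial
  functions\<close>

text \<open>Polynomials in the variables indexed by \<open>I\<close>, taken as functions on the
  whole sequence space. One type then serves every number of variables.\<close>

inductive_set polyfun :: "nat set \<Rightarrow> ((nat \<Rightarrow> real) \<Rightarrow> real) set" for I :: "nat set" where
  coord: "i \<in> I \<Longrightarrow> (\<lambda>x. x i) \<in> polyfun I"
| const: "(\<lambda>x. c) \<in> polyfun I"
| add: "f \<in> polyfun I \<Longrightarrow> g \<in> polyfun I \<Longrightarrow> (\<lambda>x. f x + g x) \<in> polyfun I"
| mult: "f \<in> polyfun I \<Longrightarrow> g \<in> polyfun I \<Longrightarrow> (\<lambda>x. f x * g x) \<in> polyfun I"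

lemma polyfun_cmult: "f \<in> polyfun I \<Longrightarrow> (\<lambda>x. c * f x) \<in> polyfun I"
  by (intro polyfun.mult polyfun.const)

lemma polyfun_diff: "f \<in> polyfun I \<Longrightarrow> g \<in> polyfun I \<Longrightarrow> (\<lambda>x. f x - g x) \<in> polyfun I"
  using polyfun.add[of f I "\<lambda>x. (-1) * g x"] polyfun_cmult[of g I "-1"] by simp

lemma polyfun_sum:
  "(\<And>i. i \<in> A \<Longrightarrow> f i \<in> polyfun I) \<Longrightarrow> (\<lambda>x. \<Sum>i\<in>A. f i x) \<in> polyfun I"
  by (induction A rule: infinite_finite_induct) (auto intro: polyfun.intros)

lemma polyfun_prod:
  "(\<And>i. i \<in> A \<Longrightarrow> f i \<in> polyfun I) \<Longrightarrow> (\<lambda>x. \<Prod>i\<in>A. f i x) \<in> polyfun I"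
  by (induction A rule: infinite_finite_induct) (auto intro: polyfun.intros)

lemma polyfun_power: "f \<in> polyfun I \<Longrightarrow> (\<lambda>x. f x ^ n) \<in> polyfun I"
  by (induction n) (auto intro: polyfun.intros)

lemma continuous_on_polyfun: "f \<in> polyfun I \<Longrightarrow> continuous_on S f"
proof (induction rule: polyfun.induct)
  case (coord i)
  show ?case by (rule continuous_on_subset[OF continuous_on_product_coordinates]) simp
qed (intro continuous_intros; assumption)+

text \<open>\<open>d\<close> is a bound that is uniform in the parameter; the actual degree may drop
  where leading coefficients vanish.\<close>

definition polycoeffs :: "nat set \<Rightarrow> nat \<Rightarrow> ((nat \<Rightarrow> real) \<Rightarrow> real poly) \<Rightarrow> bool" where
  "polycoeffs I d q \<longleftrightarrow> (\<forall>i. (\<lambda>y. coeff (q y) i) \<in> polyfun I) \<and> (\<forall>y. degree (q y) \<le> d)"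

lemma polycoeffs_mono: "polycoeffs I d q \<Longrightarrow> d \<le> e \<Longrightarrow> polycoeffs I e q"
  by (auto simp: polycoeffs_def intro: order_trans)

lemma polycoeffs_coeff: "polycoeffs I d q \<Longrightarrow> (\<lambda>y. coeff (q y) i) \<in> polyfun I"
  by (simp add: polycoeffs_def)

lemma polycoeffs_eval:
  assumes "polycoeffs I d q" "f \<in> polyfun I"
  shows "(\<lambda>y. poly (q y) (f y)) \<in> polyfun I"
proof -
  have "poly p t = (\<Sum>i\<le>d. coeff p i * t ^ i)" if "degree p \<le> d" for p :: "real poly" and t
    unfolding poly_altdef
    by (rule sum.mono_neutral_left) (use that in \<open>auto simp: coeff_eq_0\<close>)
  then have *: "(\<lambda>y. poly (q y) (f y)) = (\<lambda>y. \<Sum>i\<le>d. coeff (q y) i * f y ^ i)"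
    using assms by (auto simp: polycoeffs_def)
  show ?thesis unfolding *
    by (intro polyfun_sum polyfun.mult polyfun_power assms polycoeffs_coeff[OF assms(1)])
qed

lemma polycoeffs_pderiv:
  assumes "polycoeffs I d q"
  shows "polycoeffs I (d - 1) (\<lambda>y. pderiv (q y))"
  using assms by (auto simp: polycoeffs_def coeff_pderiv degree_pderiv diff_le_mono
    intro!: polyfun.mult polyfun.const polyfun.add)

lemma polycoeffs_const: "f \<in> polyfun I \<Longrightarrow> polycoeffs I d (\<lambda>y. [:f y:])"
  unfolding polycoeffs_def
proof (intro conjI allI)
  fix i assume "f \<in> polyfun I"
  then show "(\<lambda>y. coeff [:f y:] i) \<in> polyfun I"
    by (cases i) (auto intro: polyfun.const)
qed simp

lemma polycoeffs_mult:
  assumes p: "polycoeffs I d p" and q: "polycoeffs I e q"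
  shows "polycoeffs I (d + e) (\<lambda>y. p y * q y)"
  unfolding polycoeffs_def
proof (intro conjI allI)
  show "(\<lambda>y. coeff (p y * q y) i) \<in> polyfun I" for i
    unfolding coeff_mult
    by (intro polyfun_sum polyfun.mult polycoeffs_coeff[OF p] polycoeffs_coeff[OF q])
  show "degree (p y * q y) \<le> d + e" for y
    by (rule order_trans[OF degree_mult_le]) (use p q in \<open>auto simp: polycoeffs_def intro: add_mono\<close>)
qed

lemma polycoeffs_add:
  assumes p: "polycoeffs I d p" and q: "polycoeffs I d q"
  shows "polycoeffs I d (\<lambda>y. p y + q y)"
  using assms by (auto simp: polycoeffs_def intro!: polyfun.add degree_add_le)

text \<open>Pseudo-division. In each step \<open>q\<close> is multiplied by the square of the
  leading coefficient of \<open>r\<close>, not by that coefficient, so the total factor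
  \<open>c\<close> is positive and the remainder has the sign of \<open>q\<close> at the roots of
  \<open>r\<close>. One remainder serves all parameters where \<open>r\<close> has degree exactly
  \<open>e\<close>.\<close>

lemma polycoeffs_remainder:
  assumes "polycoeffs I n q" and r: "\<And>i. (\<lambda>y. coeff (r y) i) \<in> polyfun I" and e: "1 \<le> e"
  shows "\<exists>s. polycoeffs I (e - 1) s \<and> (\<forall>y. degree (r y) \<le> e \<longrightarrow> coeff (r y) e \<noteq> 0 \<longrightarrow>
    (\<exists>c>0. \<forall>t. poly (r y) t = 0 \<longrightarrow> poly (s y) t = c * poly (q y) t))"
  using assms(1)
proof (induction n arbitrary: q)
  case 0
  then show ?case
    by (intro exI[of _ q]) (auto intro: polycoeffs_mono intro!: exI[of _ 1])
next
  case (Suc n)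
  show ?case
  proof (cases "Suc n < e")
    case True
    then show ?thesis
      by (intro exI[of _ q]) (auto intro: polycoeffs_mono[OF Suc.prems] intro!: exI[of _ 1])
  next
    case False
    \<comment> \<open>Cutting \<open>r\<close> off at degree \<open>e\<close> keeps the degree of
      \<open>q1\<close> down even at parameters where \<open>r\<close> has larger degree; where its
      degree is at most \<open>e\<close>, nothing is cut.\<close>
    define r' where "r' y = (\<Sum>i\<le>e. monom (coeff (r y) i) i)" for y
    have cr': "coeff (r' y) i = (if i \<le> e then coeff (r y) i else 0)" for y i
      by (simp add: r'_def coeff_sum if_distrib cong: if_cong)
    define q1 where "q1 y = Polynomial.smult (coeff (r y) e ^ 2) (q y) -
      monom (coeff (r y) e * coeff (q y) (Suc n)) (Suc n - e) * r' y" for y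
    have cq1: "coeff (q1 y) i = coeff (r y) e ^ 2 * coeff (q y) i -
      (if i < Suc n - e \<or> \<not> i - (Suc n - e) \<le> e then 0
       else coeff (r y) e * coeff (q y) (Suc n) * coeff (r y) (i - (Suc n - e)))" for y i
      by (simp add: q1_def coeff_monom_mult cr')
    have "polycoeffs I n q1"
      unfolding polycoeffs_def
    proof (intro conjI allI)
      fix i
      show "(\<lambda>y. coeff (q1 y) i) \<in> polyfun I"
        unfolding cq1
        by (cases "i < Suc n - e \<or> \<not> i - (Suc n - e) \<le> e")
          (simp_all only: if_True if_False,
            (intro polyfun_diff polyfun.mult polyfun_power polyfun.const r polycoeffs_coeff[OF Suc.prems])+)
    next
      fix y
      show "degree (q1 y) \<le> n"
      proof (rule degree_le, intro allI impI)
        fix i assume "n < i"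
        show "coeff (q1 y) i = 0"
        proof (cases "i = Suc n")
          case True
          then show ?thesis using False by (simp add: cq1 power2_eq_square)
        next
          case F: False
          then have "degree (q y) < i" using Suc.prems \<open>n < i\<close> by (auto simp: polycoeffs_def intro: le_less_trans)
          moreover have "\<not> i - (Suc n - e) \<le> e" using F False \<open>n < i\<close> by auto
          ultimately show ?thesis by (simp add: cq1 coeff_eq_0)
        qed
      qed
    qed
    from Suc.IH[OF this] obtain s where s: "polycoeffs I (e - 1) s"
      "\<And>y. degree (r y) \<le> e \<Longrightarrow> coeff (r y) e \<noteq> 0 \<Longrightarrow>
        \<exists>c>0. \<forall>t. poly (r y) t = 0 \<longrightarrow> poly (s y) t = c * poly (q1 y) t" by blast
    have "\<exists>c>0. \<forall>t. poly (r y) t = 0 \<longrightarrow> poly (s y) t = c * poly (q y) t"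
      if y: "degree (r y) \<le> e" "coeff (r y) e \<noteq> 0" for y
    proof -
      obtain c where c: "c > 0" "\<And>t. poly (r y) t = 0 \<Longrightarrow> poly (s y) t = c * poly (q1 y) t"
        using s(2)[OF y] by blast
      have "r' y = r y" using y(1) by (simp add: r'_def poly_as_sum_of_monoms')
      then have "poly (q1 y) t = coeff (r y) e ^ 2 * poly (q y) t" if "poly (r y) t = 0" for t
        using that by (simp add: q1_def)
      then show ?thesis
        by (intro exI[of _ "c * coeff (r y) e ^ 2"]) (use c y in auto)
    qed
    then show ?thesis using s(1) by blast
  qed
qed

lemma degree_eq_of_sgn_coeffs:
  fixes p q :: "real poly"
  assumes "degree p \<le> d" "degree q \<le> d" "\<And>i. i \<le> d \<Longrightarrow> sgn (coeff p i) = sgn (coeff q i)"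
  shows "degree p = degree q"
proof -
  have "coeff p i = 0 \<longleftrightarrow> coeff q i = 0" for i
    using assms(1,2) assms(3)[of i] by (cases "i \<le> d") (auto simp: sgn_zero_iff coeff_eq_0; metis sgn_zero_iff)+
  then show ?thesis by (simp add: degree_def)
qed

section \<open>Elimination of one variable\<close>

definition same_signs :: "((nat \<Rightarrow> real) \<Rightarrow> real) set \<Rightarrow> (nat \<Rightarrow> real) \<Rightarrow> (nat \<Rightarrow> real) \<Rightarrow> bool" where
  "same_signs P y y' \<longleftrightarrow> (\<forall>p\<in>P. sgn (p y) = sgn (p y'))"

lemma same_signs_mono: "same_signs P y y' \<Longrightarrow> Q \<subseteq> P \<Longrightarrow> same_signs Q y y'"
  by (auto simp: same_signs_def)

definition fam :: "((nat \<Rightarrow> real) \<Rightarrow> real poly) set \<Rightarrow> (nat \<Rightarrow> real) \<Rightarrow> (nat \<Rightarrow> real) \<Rightarrow> (real poly \<times> real poly) set" where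
  "fam Q y y' = (\<lambda>q. (q y, q y')) ` Q"

text \<open>Quantifier elimination without formulas: the order pattern of roots and signs on the
  interval is decided by the signs of finitely many polynomials in the parameters.\<close>

definition sign_determined :: "real \<Rightarrow> nat set \<Rightarrow> ((nat \<Rightarrow> real) \<Rightarrow> real poly) set \<Rightarrow> bool" where
  "sign_determined M I Q \<longleftrightarrow> (\<exists>P. finite P \<and> P \<subseteq> polyfun I \<and>
     (\<forall>y y'. same_signs P y y' \<longrightarrow> (\<exists>\<phi>. matches M \<phi> (fam Q y y'))))"

lemma sign_determined_subset: "sign_determined M I Q \<Longrightarrow> R \<subseteq> Q \<Longrightarrow> sign_determined M I R"
  unfolding sign_determined_def fam_def by (meson image_mono matches_subset)

text \<open>Hoermander's elimination: at a root of another polynomial of the family, or of its own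
  derivative, \<open>q\<close> has the sign of a remainder of lower degree, and between these roots it is
  monotone. One remainder is needed for each possible value \<open>e\<close> of the degree of the divisor.\<close>

lemma sign_determined_insert:
  assumes M: "M > 0" and G: "finite G" "\<And>r. r \<in> G \<Longrightarrow> polycoeffs I (Suc d) r"
    and q: "polycoeffs I (Suc d) q" "(\<lambda>y. pderiv (q y)) \<in> G"
    and IH: "\<And>R. finite R \<Longrightarrow> (\<And>r. r \<in> R \<Longrightarrow> polycoeffs I d r) \<Longrightarrow> sign_determined M I (G \<union> R)"
  shows "sign_determined M I (insert q G)"
proof -
  have "\<forall>r\<in>G. \<forall>e\<in>{1..Suc d}. \<exists>s. polycoeffs I (e - 1) s \<and> (\<forall>y. degree (r y) \<le> e \<longrightarrow> coeff (r y) e \<noteq> 0 \<longrightarrow>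
      (\<exists>c>0. \<forall>t. poly (r y) t = 0 \<longrightarrow> poly (s y) t = c * poly (q y) t))"
    using polycoeffs_remainder[OF q(1)] polycoeffs_coeff[OF G(2)] by simp
  then obtain S where S: "\<And>r e. r \<in> G \<Longrightarrow> e \<in> {1..Suc d} \<Longrightarrow> polycoeffs I (e - 1) (S r e)"
    "\<And>r e y. r \<in> G \<Longrightarrow> e \<in> {1..Suc d} \<Longrightarrow> degree (r y) \<le> e \<Longrightarrow> coeff (r y) e \<noteq> 0 \<Longrightarrow>
      \<exists>c>0. \<forall>t. poly (r y) t = 0 \<longrightarrow> poly (S r e y) t = c * poly (q y) t"
    by metis
  \<comment> \<open>The values of \<open>q\<close> at the two ends, as polynomials of degree 0 in
    the last variable, so that \<open>IH\<close> covers their signs together with the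
    remainders.\<close>
  define Ends where "Ends = {\<lambda>y. [:poly (q y) M:], \<lambda>y. [:poly (q y) (-M):]}"
  define Rems where "Rems = (\<lambda>(r, e). S r e) ` (G \<times> {1..Suc d})"
  have "sign_determined M I (G \<union> (Ends \<union> Rems))"
  proof (rule IH)
    show "finite (Ends \<union> Rems)" using G by (simp add: Ends_def Rems_def)
    fix r assume "r \<in> Ends \<union> Rems"
    then show "polycoeffs I d r"
    proof
      assume "r \<in> Ends"
      then show ?thesis unfolding Ends_def
        by (auto intro!: polycoeffs_const polycoeffs_eval[OF q(1)] polyfun.const)
    next
      assume "r \<in> Rems"
      then obtain r0 e where "r = S r0 e" "r0 \<in> G" "e \<in> {1..Suc d}" by (auto simp: Rems_def)
      then show ?thesis using polycoeffs_mono[OF S(1)] by auto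
    qed
  qed
  then obtain P where P: "finite P" "P \<subseteq> polyfun I"
    "\<And>y y'. same_signs P y y' \<Longrightarrow> \<exists>\<phi>. matches M \<phi> (fam (G \<union> (Ends \<union> Rems)) y y')"
    unfolding sign_determined_def by blast
  \<comment> \<open>The signs of the coefficients fix the actual degree of every divisor, and with
    it which of its remainders is the valid one at both parameters.\<close>
  define C where "C = (\<lambda>(r, i). \<lambda>y. coeff (r y) i) ` (G \<times> {..Suc d})"
  show ?thesis
    unfolding sign_determined_def
  proof (intro exI[of _ "P \<union> C"] conjI allI impI)
    show "finite (P \<union> C)" using P G by (simp add: C_def)
    show "P \<union> C \<subseteq> polyfun I" using P polycoeffs_coeff[OF G(2)] by (auto simp: C_def)
    fix y y' assume ss: "same_signs (P \<union> C) y y'"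
    obtain \<phi> where \<phi>: "matches M \<phi> (fam (G \<union> (Ends \<union> Rems)) y y')"
      using P(3) same_signs_mono[OF ss] by blast
    have sg: "sgn (poly (r y) t) = sgn (poly (r y') (\<phi> t))"
      if "r \<in> G \<union> (Ends \<union> Rems)" "t \<in> {-M..M}" for r t
      using \<phi> that unfolding matches_def fam_def by blast
    have deg: "degree (r y) = degree (r y')" if r: "r \<in> G" for r
    proof (rule degree_eq_of_sgn_coeffs)
      show "degree (r y) \<le> Suc d" "degree (r y') \<le> Suc d" using G(2)[OF r] by (auto simp: polycoeffs_def)
      fix i assume "i \<le> Suc d"
      then have "(\<lambda>y. coeff (r y) i) \<in> C" using r by (force simp: C_def)
      then show "sgn (coeff (r y) i) = sgn (coeff (r y') i)"
        using bspec[OF ss[unfolded same_signs_def], of "\<lambda>y. coeff (r y) i"] by simp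
    qed
    have "\<exists>\<phi>2. matches M \<phi>2 (insert (q y, q y') (fam G y y'))"
    proof (rule matches_add[OF M])
      show "matches M \<phi> (fam G y y')" by (rule matches_subset[OF \<phi>]) (auto simp: fam_def)
      show "finite (fam G y y')" using G by (simp add: fam_def)
      show "(pderiv (q y), pderiv (q y')) \<in> fam G y y'" using q(2) by (force simp: fam_def)
      show "sgn (poly (q y) M) = sgn (poly (q y') M)"
        using sg[of "\<lambda>y. [:poly (q y) M:]" M] M by (simp add: Ends_def)
      show "sgn (poly (q y) (-M)) = sgn (poly (q y') (-M))"
        using sg[of "\<lambda>y. [:poly (q y) (-M):]" M] M by (simp add: Ends_def)
      fix r r' z assume "(r, r') \<in> fam G y y'" and nz: "r \<noteq> 0" and z: "z \<in> {-M..M}" "poly r z = 0"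
      then obtain f where f: "f \<in> G" "r = f y" "r' = f y'" by (auto simp: fam_def)
      define e where "e = degree (f y)"
      have "e \<noteq> 0"
      proof
        assume "e = 0"
        then obtain c where "f y = [:c:]" unfolding e_def by (rule degree_eq_zeroE)
        then show False using nz z f by simp
      qed
      then have e: "e \<in> {1..Suc d}" using G(2)[OF f(1)] by (auto simp: polycoeffs_def e_def)
      have e': "e = degree (f y')" using deg[OF f(1)] e_def by simp
      have ne: "coeff (f y) e \<noteq> 0" using nz f by (simp add: e_def)
      have ne': "coeff (f y') e \<noteq> 0" using e' \<open>e \<noteq> 0\<close> by auto
      obtain c where c: "c > 0" "poly (S f e y) z = c * poly (q y) z"
        using S(2)[OF f(1) e _ ne] e_def f z by auto
      have "poly (f y') (\<phi> z) = 0" using sg[of f z] f z by (simp add: sgn_zero_iff)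
      then obtain c' where c': "c' > 0" "poly (S f e y') (\<phi> z) = c' * poly (q y') (\<phi> z)"
        using S(2)[OF f(1) e _ ne'] e' by auto
      have "S f e \<in> Rems" using f(1) e by (force simp: Rems_def)
      then have "sgn (poly (S f e y) z) = sgn (poly (S f e y') (\<phi> z))" using sg z by blast
      then show "sgn (poly (q y) z) = sgn (poly (q y') (\<phi> z))"
        using c c' by (simp add: sgn_mult)
    qed
    then show "\<exists>\<phi>. matches M \<phi> (fam (insert q G) y y')" by (simp add: fam_def)
  qed
qed

text \<open>Double induction: on the degree bound, and inside it on the number of members of top
  degree, collected in \<open>Q1\<close>. The derivative of a removed member and all remainders have
  lower degree and go into \<open>Q2\<close>, which may grow freely.\<close>

theorem sign_determined_polycoeffs:
  assumes "M > 0" "finite Q" "\<And>q. q \<in> Q \<Longrightarrow> polycoeffs I d q"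
  shows "sign_determined M I Q"
  using assms(2,3)
proof (induction d arbitrary: Q)
  case 0
  define P where "P = (\<lambda>q y. coeff (q y) 0) ` Q"
  have "matches M id (fam Q y y')" if ss: "same_signs P y y'" for y y'
    unfolding matches_def
  proof (intro conjI ballI; clarify?)
    fix p p' t assume "(p, p') \<in> fam Q y y'"
    then obtain q where q: "q \<in> Q" "p = q y" "p' = q y'" by (auto simp: fam_def)
    then have "degree p = 0" "degree p' = 0" using 0(2) by (auto simp: polycoeffs_def)
    then have "poly p t = coeff p 0" "poly p' t = coeff p' 0" by (auto elim!: degree_eq_zeroE)
    then show "sgn (poly p t) = sgn (poly p' (id t))"
      using ss q by (auto simp: same_signs_def P_def)
  qed (auto simp: strict_mono_on_def)
  moreover have "finite P" "P \<subseteq> polyfun I" using 0(1) polycoeffs_coeff[OF 0(2)] by (auto simp: P_def)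
  ultimately show ?case unfolding sign_determined_def by blast
next
  case (Suc d)
  have main: "sign_determined M I (Q1 \<union> Q2)"
    if "finite Q1" "\<And>q. q \<in> Q1 \<Longrightarrow> polycoeffs I (Suc d) q" "finite Q2" "\<And>q. q \<in> Q2 \<Longrightarrow> polycoeffs I d q"
    for Q1 Q2
    using that
  proof (induction Q1 arbitrary: Q2 rule: finite_induct)
    case empty
    then show ?case using Suc.IH by simp
  next
    case (insert q Q1)
    let ?pd = "\<lambda>y. pderiv (q y)"
    have pd: "polycoeffs I d ?pd" using polycoeffs_pderiv[OF insert.prems(1)[of q]] by simp
    have "sign_determined M I (insert q (Q1 \<union> insert ?pd Q2))"
    proof (rule sign_determined_insert[OF assms(1)])
      show "finite (Q1 \<union> insert ?pd Q2)" using insert by simp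
      show "polycoeffs I (Suc d) r" if "r \<in> Q1 \<union> insert ?pd Q2" for r
        using that insert.prems pd polycoeffs_mono[of I d _ "Suc d"] by auto
      show "polycoeffs I (Suc d) q" using insert.prems by simp
      fix R :: "((nat \<Rightarrow> real) \<Rightarrow> real poly) set"
      assume "finite R" "\<And>r. r \<in> R \<Longrightarrow> polycoeffs I d r"
      then have "sign_determined M I (Q1 \<union> (insert ?pd Q2 \<union> R))"
        using insert.prems pd by (intro insert.IH) auto
      then show "sign_determined M I (Q1 \<union> insert ?pd Q2 \<union> R)" by (simp only: Un_assoc)
    qed simp
    then show ?case by (rule sign_determined_subset) auto
  qed
  show ?case using main[of Q "{}"] Suc.prems by simp
qed

section \<open>Continuous selections of roots\<close>

text \<open>Where \<open>p'\<close> has no zero inside \<open>[a, b]\<close>, this is the point of \<open>[a, b]\<close> at which \<open>p\<^sup>2\<close> is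
  minimal, expressed by the sign of its derivative.\<close>

definition is_clamp :: "real poly \<Rightarrow> real \<Rightarrow> real \<Rightarrow> real \<Rightarrow> bool" where
  "is_clamp p a b t \<longleftrightarrow> a \<le> t \<and> t \<le> b \<and>
     (\<forall>u. a < u \<longrightarrow> u < b \<longrightarrow> (u < t \<longrightarrow> poly p u * poly (pderiv p) u < 0) \<and>
       (t < u \<longrightarrow> poly p u * poly (pderiv p) u > 0))"

definition clamp_root :: "real poly \<Rightarrow> real \<Rightarrow> real \<Rightarrow> real" where
  "clamp_root p a b = (THE t. is_clamp p a b t)"

text \<open>Clamping to the intervals cut out by the same functions of the derivative yields continuous
  functions of \<open>p\<close> that are always defined, even where roots become complex.\<close>

fun rho :: "real \<Rightarrow> nat \<Rightarrow> real poly \<Rightarrow> nat \<Rightarrow> real" where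
  "rho M 0 p i = (if i = 0 then -M else M)"
| "rho M (Suc d) p i = (if i = 0 then -M else if Suc d < i then M
     else clamp_root p (rho M d (pderiv p) (i - 1)) (rho M d (pderiv p) i))"

lemma is_clamp_unique:
  assumes "is_clamp p a b s" "is_clamp p a b t"
  shows "s = t"
proof -
  have False if "is_clamp p a b s" "is_clamp p a b t" "s < t" for s t
  proof -
    have "a < (s + t) / 2" "(s + t) / 2 < b" "s < (s + t) / 2" "(s + t) / 2 < t"
      using that by (auto simp: is_clamp_def)
    then show False using that unfolding is_clamp_def by (meson order.asym)
  qed
  then show ?thesis using assms by (meson linorder_cases)
qed

text \<open>\<open>p\<close> is strictly monotone on the interval, so the clamp is the left end, the
  right end or the only root in between, according to the signs of \<open>p\<close> at the
  ends.\<close>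

lemma is_clamp_exists:
  assumes "a \<le> b" and nz: "\<And>u. a < u \<Longrightarrow> u < b \<Longrightarrow> poly (pderiv p) u \<noteq> 0"
  shows "\<exists>t. is_clamp p a b t"
proof (cases "a = b")
  case True then show ?thesis by (auto simp: is_clamp_def)
next
  case False
  define s where "s = sgn (poly (pderiv p) ((a + b) / 2))"
  have mid: "a < (a + b) / 2" "(a + b) / 2 < b" using assms(1) False by auto
  have s: "s \<noteq> 0" using nz[OF mid] by (simp add: s_def sgn_zero_iff)
  have su: "sgn (poly (pderiv p) u) = s" if "a < u" "u < b" for u
    unfolding s_def by (rule poly_sgn_const[of a b]) (use nz that mid in auto)
  have pos: "s * poly (pderiv p) u > 0" if "a < u" "u < b" for u
    using su[OF that] s by (auto simp: sgn_if zero_less_mult_iff split: if_splits)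
  have mono: "s * poly p u < s * poly p v" if "a \<le> u" "u < v" "v \<le> b" for u v
    by (rule poly_strict_mono_pderiv[of a b s p]) (use pos that in auto)
  have neg_iff: "poly p u * poly (pderiv p) u < 0 \<longleftrightarrow> s * poly p u < 0"
    and pos_iff: "poly p u * poly (pderiv p) u > 0 \<longleftrightarrow> s * poly p u > 0" if "a < u" "u < b" for u
    using pos[OF that] by (auto simp: mult_less_0_iff zero_less_mult_iff)
  consider "s * poly p a \<ge> 0" | "s * poly p b \<le> 0" | "s * poly p a < 0" "s * poly p b > 0" by linarith
  then show ?thesis
  proof cases
    case 1
    have "poly p u * poly (pderiv p) u > 0" if "a < u" "u < b" for u
      using pos_iff[OF that] mono[of a u] that 1 by simp
    then have "is_clamp p a b a"
      using assms(1) by (simp add: is_clamp_def)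
    then show ?thesis ..
  next
    case 2
    have "poly p u * poly (pderiv p) u < 0" if "a < u" "u < b" for u
      using neg_iff[OF that] mono[of u b] that 2 by simp
    then have "is_clamp p a b b"
      using assms(1) by (simp add: is_clamp_def)
    then show ?thesis ..
  next
    case 3
    then have "poly p a * poly p b < 0" by (auto simp: mult_less_0_iff zero_less_mult_iff)
    then obtain t where t: "a < t" "t < b" "poly p t = 0" using poly_IVT[of a b p] False assms(1) by auto
    have "poly p u * poly (pderiv p) u < 0" if "a < u" "u < b" "u < t" for u
      using neg_iff[OF that(1,2)] mono[of u t] that t by simp
    moreover have "poly p u * poly (pderiv p) u > 0" if "a < u" "u < b" "t < u" for u
      using pos_iff[OF that(1,2)] mono[of t u] that t by simp
    ultimately have "is_clamp p a b t"
      using t by (simp add: is_clamp_def)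
    then show ?thesis ..
  qed
qed

lemma clamp_root_eq: "is_clamp p a b t \<Longrightarrow> clamp_root p a b = t"
  unfolding clamp_root_def using is_clamp_unique by blast

lemma is_clamp_clamp_root:
  assumes "a \<le> b" "\<And>u. a < u \<Longrightarrow> u < b \<Longrightarrow> poly (pderiv p) u \<noteq> 0"
  shows "is_clamp p a b (clamp_root p a b)"
  using is_clamp_exists[OF assms] clamp_root_eq by metis

text \<open>For degree \<open>d\<close> the points are numbered from 0 to \<open>Suc d\<close>, both
  ends of the interval included. Larger indices repeat the upper end, which makes the sequence
  monotone without a bound on the index.\<close>

lemma rho_0: "rho M d p 0 = -M"
  by (cases d) auto

lemma rho_gt: "d < i \<Longrightarrow> rho M d p i = M"
proof (induction d arbitrary: p i)
  case (Suc d)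
  show ?case using Suc.prems by simp
qed simp

text \<open>Between two consecutive points of the derivative, the square of \<open>p\<close>
  decreases up to the clamp and increases after it, so \<open>p\<close> can vanish only at the clamp
  itself. Interlacing with the points of the derivative gives monotonicity in the index.\<close>

lemma rho_mono_no_root:
  assumes "M > 0" "degree p = d"
  shows "rho M d p i \<le> rho M d p (Suc i)"
    and "rho M d p i < u \<Longrightarrow> u < rho M d p (Suc i) \<Longrightarrow> p \<noteq> 0 \<Longrightarrow> poly p u \<noteq> 0"
proof -
  have "(\<forall>i. rho M d p i \<le> rho M d p (Suc i)) \<and>
     (\<forall>i u. rho M d p i < u \<longrightarrow> u < rho M d p (Suc i) \<longrightarrow> (d = 0 \<and> p = 0) \<or> poly p u \<noteq> 0)"
    using assms(2)
  proof (induction d arbitrary: p)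
    case 0
    then obtain c where "p = [:c:]" by (rule degree_eq_zeroE)
    then show ?case using assms(1) by simp
  next
    case (Suc d)
    let ?h = "rho M d (pderiv p)" and ?r = "rho M (Suc d) p"
    have dp: "degree (pderiv p) = d" "pderiv p \<noteq> 0"
      using Suc.prems by (auto simp: degree_pderiv pderiv_eq_0_iff)
    have h: "?h i \<le> ?h (Suc i)" "?h i < u \<Longrightarrow> u < ?h (Suc i) \<Longrightarrow> poly (pderiv p) u \<noteq> 0" for i u
      using Suc.IH[OF dp(1)] dp(2) by blast+
    have c: "is_clamp p (?h i) (?h (Suc i)) (?r (Suc i))" if "i \<le> d" for i
      using is_clamp_clamp_root[OF h] that by simp
    have cases4: "i = 0 \<or> (\<exists>j. i = Suc j \<and> Suc j \<le> d) \<or> i = Suc d \<or> Suc d < i" for i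
      by (cases i) auto
    have top: "?r i = M" if "Suc d < i" for i using that by simp
    have h0: "?h 0 = -M" "?h (Suc d) = M" using rho_0 rho_gt by auto
    have b: "?h i \<le> ?r (Suc i) \<and> ?r (Suc i) \<le> ?h (Suc i)" if "i \<le> d" for i
      using c[OF that] unfolding is_clamp_def by blast
    have "?r i \<le> ?r (Suc i)" for i
    proof -
      consider "i = 0" | j where "i = Suc j" "Suc j \<le> d" | "i = Suc d" | "Suc d < i"
        using cases4[of i] by blast
      then show ?thesis
      proof cases
        case 1 then show ?thesis using b[of 0] h0 rho_0[of M "Suc d" p] by (simp del: rho.simps)
      next
        case 2 then show ?thesis unfolding 2(1) using b[of j] b[of "Suc j"] 2(2) by (meson Suc_leD order_trans)
      next
        case 3 then show ?thesis using b[of d] h0 top[of "Suc (Suc d)"] by (simp del: rho.simps)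
      next
        case 4 then show ?thesis using top[of i] top[of "Suc i"] by linarith
      qed
    qed
    moreover have "poly p u \<noteq> 0" if u: "?r i < u" "u < ?r (Suc i)" for i u
    proof -
      \<comment> \<open>The end \<open>?h (Suc j)\<close> is included, since the interval from one
        clamp to the next passes through it. The inequality on \<open>p * pderiv p\<close> holds
        only inside, so the growth of the square of \<open>p\<close> is used here.\<close>
      have right: "poly p u \<noteq> 0" if "j \<le> d" "?r (Suc j) < u" "u \<le> ?h (Suc j)" for j u
      proof -
        have "1 * poly (p * p) (?r (Suc j)) < 1 * poly (p * p) u"
        proof (rule poly_strict_mono_pderiv[of "?r (Suc j)" "?h (Suc j)"])
          fix v assume "?r (Suc j) < v" "v < ?h (Suc j)"
          moreover have "?h j < v" using b[OF that(1)] calculation by linarith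
          ultimately have "poly p v * poly (pderiv p) v > 0"
            using c[OF that(1)] unfolding is_clamp_def by blast
          then show "0 < 1 * poly (pderiv (p * p)) v" by (simp add: pderiv_mult mult.commute)
        qed (use that in auto)
        moreover have "0 \<le> poly (p * p) (?r (Suc j))" by (simp only: poly_mult zero_le_square)
        ultimately have "poly (p * p) u > 0" by linarith
        then show ?thesis by auto
      qed
      have left: "poly p u \<noteq> 0" if "j \<le> d" "?h j < u" "u < ?r (Suc j)" for j u
      proof -
        have "u < ?h (Suc j)" using b[OF that(1)] that(3) by linarith
        then have "poly p u * poly (pderiv p) u < 0"
          using c[OF that(1)] that(2,3) unfolding is_clamp_def by blast
        then show ?thesis by auto
      qed
      consider "i = 0" | j where "i = Suc j" "Suc j \<le> d" | "i = Suc d" | "Suc d < i"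
        using cases4[of i] by blast
      then show ?thesis
      proof cases
        case 1 then show ?thesis using left[of 0 u] u h0 rho_0[of M "Suc d" p] by (simp del: rho.simps)
      next
        case 2 then show ?thesis using left[of "Suc j" u] right[of j u] u by (cases "u \<le> ?h (Suc j)") (simp_all del: rho.simps)
      next
        case 3 then show ?thesis using right[of d u] h0 u top[of "Suc (Suc d)"] by (simp del: rho.simps)
      next
        case 4 then show ?thesis using top[of i] top[of "Suc i"] u by linarith
      qed
    qed
    ultimately show ?case by blast
  qed
  note * = this
  show "rho M d p i \<le> rho M d p (Suc i)" using * by blast
  show "poly p u \<noteq> 0" if "rho M d p i < u" "u < rho M d p (Suc i)" "p \<noteq> 0"
    using * that by blast
qed


lemma rho_bounds: assumes "M > 0" "degree p = d" shows "rho M d p i \<in> {-M..M}"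
proof -
  have m: "mono (rho M d p)" using rho_mono_no_root(1)[OF assms] by (rule mono_iff_le_Suc[THEN iffD2, rule_format])
  have "rho M d p 0 \<le> rho M d p i" "rho M d p i \<le> rho M d p (max i (Suc d))"
    by (rule monoD[OF m], simp)+
  then show ?thesis by (simp add: rho_0 rho_gt)
qed

lemma is_clamp_rho:
  assumes "M > 0" "degree p = Suc d" "i \<le> d"
  shows "is_clamp p (rho M d (pderiv p) i) (rho M d (pderiv p) (Suc i)) (rho M (Suc d) p (Suc i))"
proof -
  have dp: "degree (pderiv p) = d" "pderiv p \<noteq> 0"
    using assms by (auto simp: degree_pderiv pderiv_eq_0_iff)
  show ?thesis
    using is_clamp_clamp_root[OF rho_mono_no_root(1)[OF assms(1) dp(1)] rho_mono_no_root(2)[OF assms(1) dp(1) _ _ dp(2)]] assms(3)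
    by simp
qed

definition derivs :: "real poly \<Rightarrow> nat \<Rightarrow> real poly" where
  "derivs p k = (pderiv ^^ k) p"

lemma derivs_0: "derivs p 0 = p" and derivs_Suc: "derivs (pderiv p) k = derivs p (Suc k)"
  by (simp_all add: derivs_def funpow_swap1)

text \<open>\<open>is_clamp\<close> speaks only of the order and of the signs of \<open>p\<close>
  and its derivative. Both are preserved by \<phi>, so \<phi> maps a clamp to a clamp, and clamps
  are unique. All higher derivatives take part because of the recursion.\<close>

lemma rho_matches:
  assumes M: "M > 0"
  shows "degree p = d \<Longrightarrow> degree p' = d \<Longrightarrow> matches M \<phi> ((\<lambda>k. (derivs p k, derivs p' k)) ` {..d}) \<Longrightarrow>
    \<phi> (rho M d p i) = rho M d p' i"
proof (induction d arbitrary: p p' i)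
  case 0
  then show ?case using matches_ends[OF 0(3) M] by simp
next
  case (Suc d)
  have dp: "degree (pderiv p) = d" "degree (pderiv p') = d"
    using Suc.prems by (auto simp: degree_pderiv)
  have sub: "(\<lambda>k. (derivs (pderiv p) k, derivs (pderiv p') k)) ` {..d} \<subseteq> (\<lambda>k. (derivs p k, derivs p' k)) ` {..Suc d}"
    by (auto simp: derivs_Suc)
  have IH: "\<phi> (rho M d (pderiv p) j) = rho M d (pderiv p') j" for j
    using Suc.IH[OF dp matches_subset[OF Suc.prems(3) sub]] .
  note ends = matches_ends[OF Suc.prems(3) M]
  note lt = matches_less_iff[OF Suc.prems(3)]
  have img: "\<phi> ` {-M..M} = {-M..M}" using Suc.prems(3) by (simp add: matches_def)
  have "i = 0 \<or> (\<exists>j. i = Suc j \<and> j \<le> d) \<or> Suc d < i"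
    by (cases i) auto
  then consider "i = 0" | j where "i = Suc j" "j \<le> d" | "Suc d < i"
    by blast
  then show ?case
  proof cases
    case 1 then show ?thesis using ends by (simp add: rho_0)
  next
    case 3 then show ?thesis using ends by (simp add: rho_gt)
  next
    case 2
    define a b t where "a = rho M d (pderiv p) j" "b = rho M d (pderiv p) (Suc j)" "t = rho M (Suc d) p (Suc j)"
    have c: "is_clamp p a b t" unfolding a_b_t_def by (rule is_clamp_rho[OF M Suc.prems(1) 2(2)])
    have r: "a \<in> {-M..M}" "b \<in> {-M..M}" "t \<in> {-M..M}"
      unfolding a_b_t_def using rho_bounds M dp Suc.prems by blast+
    have "is_clamp p' (\<phi> a) (\<phi> b) (\<phi> t)"
      unfolding is_clamp_def
    proof (intro conjI allI impI)
      show "\<phi> a \<le> \<phi> t" "\<phi> t \<le> \<phi> b" using c lt r by (auto simp: is_clamp_def)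
      fix w assume w: "\<phi> a < w" "w < \<phi> b"
      have "\<phi> a \<in> {-M..M}" "\<phi> b \<in> {-M..M}" using r img by blast+
      then have "w \<in> \<phi> ` {-M..M}" using w unfolding img by auto
      then obtain u where u: "u \<in> {-M..M}" "w = \<phi> u" by blast
      then have ub: "a < u" "u < b" using w lt r by auto
      have "sgn (poly (derivs p k) u) = sgn (poly (derivs p' k) w)" if "k \<le> Suc d" for k
        using Suc.prems(3) u that unfolding matches_def by auto
      from this[of 0] this[of 1]
      have *: "sgn (poly p u * poly (pderiv p) u) = sgn (poly p' w * poly (pderiv p') w)"
        by (simp add: derivs_def sgn_mult)
      show "poly p' w * poly (pderiv p') w < 0" if "w < \<phi> t"
      proof -
        have "u < t" using that u lt r by auto
        then have "poly p u * poly (pderiv p) u < 0" using c ub by (simp add: is_clamp_def)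
        then show ?thesis using * by (metis sgn_less)
      qed
      show "0 < poly p' w * poly (pderiv p') w" if "\<phi> t < w"
      proof -
        have "t < u" using that u lt r by auto
        then have "poly p u * poly (pderiv p) u > 0" using c ub by (simp add: is_clamp_def)
        then show ?thesis using * by (metis sgn_greater)
      qed
    qed
    then have "is_clamp p' (rho M d (pderiv p') j) (rho M d (pderiv p') (Suc j)) (\<phi> t)"
      by (simp add: a_b_t_def IH)
    then have "\<phi> t = rho M (Suc d) p' (Suc j)"
      using is_clamp_unique is_clamp_rho[OF M Suc.prems(2) 2(2)] by blast
    then show ?thesis using 2 by (simp add: a_b_t_def)
  qed
qed

text \<open>That the clamp is at least, or at most, a point \<open>u\<close> strictly inside the
  interval follows from one strict sign of \<open>p * pderiv p\<close> at \<open>u\<close>, and this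
  is an open condition on the parameter. Outside the interval the continuity of its ends is
  enough.\<close>

lemma continuous_on_clamp:
  fixes a b t :: "'a::topological_space \<Rightarrow> real"
  assumes c: "\<And>y. y \<in> S \<Longrightarrow> is_clamp (q y) (a y) (b y) (t y)"
    and a: "continuous_on S a" and b: "continuous_on S b"
    and g: "\<And>u. continuous_on S (\<lambda>y. poly (q y) u * poly (pderiv (q y)) u)"
  shows "continuous_on S t"
  unfolding continuous_on_def
proof
  fix y0 assume y0: "y0 \<in> S"
  have lim: "(a \<longlongrightarrow> a y0) (at y0 within S)" "(b \<longlongrightarrow> b y0) (at y0 within S)"
    "((\<lambda>y. poly (q y) u * poly (pderiv (q y)) u) \<longlongrightarrow> poly (q y0) u * poly (pderiv (q y0)) u) (at y0 within S)" for u
    using a b g y0 by (simp_all add: continuous_on_def)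
  have inS: "eventually (\<lambda>y. y \<in> S) (at y0 within S)"
    by (simp add: eventually_at_filter)
  show "(t \<longlongrightarrow> t y0) (at y0 within S)"
  proof (rule order_tendstoI)
    fix w assume w: "w < t y0"
    show "\<forall>\<^sub>F y in at y0 within S. w < t y"
    proof (cases "w < a y0")
      case True
      show ?thesis
        using order_tendstoD(1)[OF lim(1) True] inS
        by eventually_elim (use c in \<open>force simp: is_clamp_def\<close>)
    next
      case False
      show ?thesis
      proof -
        define u where "u = (w + t y0) / 2"
        have tb: "t y0 \<le> b y0" using c[OF y0] by (simp add: is_clamp_def)
        have u: "w < u" "u < t y0" "a y0 < u" "u < b y0" using w False tb by (auto simp: u_def)
        have "poly (q y0) u * poly (pderiv (q y0)) u < 0"
          using c[OF y0] u by (simp add: is_clamp_def)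
        from order_tendstoD(2)[OF lim(3) this] order_tendstoD(2)[OF lim(1) u(3)] order_tendstoD(1)[OF lim(2) u(4)] inS
        show ?thesis
        proof eventually_elim
          case (elim y)
          then have "u \<le> t y" using c[OF elim(4)] unfolding is_clamp_def by (meson not_less order.asym)
          then show ?case using u by simp
        qed
      qed
    qed
  next
    fix w assume w: "t y0 < w"
    show "\<forall>\<^sub>F y in at y0 within S. t y < w"
    proof (cases "b y0 < w")
      case True
      show ?thesis
        using order_tendstoD(2)[OF lim(2) True] inS
        by eventually_elim (use c in \<open>force simp: is_clamp_def\<close>)
    next
      case False
      define u where "u = (w + t y0) / 2"
      have tb: "a y0 \<le> t y0" using c[OF y0] by (simp add: is_clamp_def)
      have u: "u < w" "t y0 < u" "a y0 < u" "u < b y0" using w False tb by (auto simp: u_def)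
      have "poly (q y0) u * poly (pderiv (q y0)) u > 0"
        using c[OF y0] u by (simp add: is_clamp_def)
      from order_tendstoD(1)[OF lim(3) this] order_tendstoD(2)[OF lim(1) u(3)] order_tendstoD(1)[OF lim(2) u(4)] inS
      show ?thesis
      proof eventually_elim
        case (elim y)
        then have "t y \<le> u" using c[OF elim(4)] unfolding is_clamp_def by (meson not_less order.asym)
        then show ?case using u by simp
      qed
    qed
  qed
qed

lemma continuous_on_rho:
  fixes q :: "'a::topological_space \<Rightarrow> real poly"
  assumes M: "M > 0"
  shows "(\<And>y. y \<in> S \<Longrightarrow> degree (q y) = d) \<Longrightarrow> (\<And>k u. continuous_on S (\<lambda>y. poly (derivs (q y) k) u)) \<Longrightarrow>
    continuous_on S (\<lambda>y. rho M d (q y) i)"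
proof (induction d arbitrary: q i)
  case 0 then show ?case by simp
next
  case (Suc d)
  have dp: "degree (pderiv (q y)) = d" if "y \<in> S" for y
    using Suc.prems(1)[OF that] by (auto simp: degree_pderiv)
  have IH: "continuous_on S (\<lambda>y. rho M d (pderiv (q y)) j)" for j
    by (rule Suc.IH) (use dp Suc.prems(2) in \<open>auto simp: derivs_Suc\<close>)
  have "i = 0 \<or> (\<exists>j. i = Suc j \<and> j \<le> d) \<or> Suc d < i"
    by (cases i) auto
  then consider "i = 0" | j where "i = Suc j" "j \<le> d" | "Suc d < i"
    by blast
  then show ?case
  proof cases
    case 2
    show ?thesis unfolding 2(1)
    proof (rule continuous_on_clamp[OF is_clamp_rho[OF M Suc.prems(1) 2(2)] IH IH])
      show "continuous_on S (\<lambda>y. poly (q y) u * poly (pderiv (q y)) u)" for u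
        using continuous_on_mult[OF Suc.prems(2)[of 0 u] Suc.prems(2)[of 1 u]] by (simp add: derivs_def)
    qed
  qed (simp_all add: rho_0 rho_gt)
qed

section \<open>Absolute neighbourhood extensors\<close>

text \<open>Extension problems are posed on closed subsets \<open>W\<close> of the sequence space.
  The freedom in \<open>W\<close> is what the gluing of two sets uses, as it extends over parts of
  \<open>W\<close> separately.\<close>

definition ANE :: "(nat \<Rightarrow> real) set \<Rightarrow> bool" where
  "ANE Z \<longleftrightarrow> (\<forall>W A (f :: (nat \<Rightarrow> real) \<Rightarrow> nat \<Rightarrow> real).
     closed W \<and> closed A \<and> A \<subseteq> W \<and> continuous_on A f \<and> f ` A \<subseteq> Z \<longrightarrow>
     (\<exists>V g. open V \<and> A \<subseteq> V \<and> continuous_on (W \<inter> V) g \<and> g ` (W \<inter> V) \<subseteq> Z \<and> (\<forall>x\<in>A. g x = f x)))"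

lemma ANE_I:
  assumes "\<And>W A (f :: (nat \<Rightarrow> real) \<Rightarrow> nat \<Rightarrow> real). closed W \<Longrightarrow> closed A \<Longrightarrow> A \<subseteq> W \<Longrightarrow>
    continuous_on A f \<Longrightarrow> f ` A \<subseteq> Z \<Longrightarrow>
    \<exists>V g. open V \<and> A \<subseteq> V \<and> continuous_on (W \<inter> V) g \<and> g ` (W \<inter> V) \<subseteq> Z \<and> (\<forall>x\<in>A. g x = f x)"
  shows "ANE Z"
  unfolding ANE_def by (intro allI impI; elim conjE; rule assms)

lemma ANE_D:
  fixes f :: "(nat \<Rightarrow> real) \<Rightarrow> nat \<Rightarrow> real"
  assumes "ANE Z" "closed W" "closed A" "A \<subseteq> W" "continuous_on A f" "f ` A \<subseteq> Z"
  obtains V g where "open V" "A \<subseteq> V" "continuous_on (W \<inter> V) g" "g ` (W \<inter> V) \<subseteq> Z" "\<And>x. x \<in> A \<Longrightarrow> g x = f x"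
proof -
  have "closed W \<and> closed A \<and> A \<subseteq> W \<and> continuous_on A f \<and> f ` A \<subseteq> Z" using assms by simp
  from assms(1)[unfolded ANE_def, rule_format, OF this] show thesis using that by blast
qed

lemma ANE_empty: "ANE {}"
  by (rule ANE_I) (auto intro!: exI[of _ "{}"])

lemma ANE_singleton: "ANE {a}"
proof (rule ANE_I)
  fix W A :: "(nat \<Rightarrow> real) set" and f :: "(nat \<Rightarrow> real) \<Rightarrow> nat \<Rightarrow> real"
  assume "f ` A \<subseteq> {a}"
  then show "\<exists>V g. open V \<and> A \<subseteq> V \<and> continuous_on (W \<inter> V) g \<and> g ` (W \<inter> V) \<subseteq> {a} \<and> (\<forall>x\<in>A. g x = f x)"
    by (intro exI[of _ UNIV] exI[of _ "\<lambda>x. a"]) auto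
qed

text \<open>Extend \<open>q\<close> after \<open>f\<close> with values in \<open>Z\<close>, then
  come back by \<open>p\<close>.\<close>

lemma ANE_retract:
  assumes Z: "ANE Z" and q: "continuous_on Z' q" "q ` Z' \<subseteq> Z" and p: "continuous_on Z p" "p ` Z \<subseteq> Z'"
    and id: "\<And>z. z \<in> Z' \<Longrightarrow> p (q z) = z"
  shows "ANE Z'"
proof (rule ANE_I)
  fix W A :: "(nat \<Rightarrow> real) set" and f :: "(nat \<Rightarrow> real) \<Rightarrow> nat \<Rightarrow> real"
  assume *: "closed W" "closed A" "A \<subseteq> W" "continuous_on A f" "f ` A \<subseteq> Z'"
  have "continuous_on A (\<lambda>x. q (f x))"
    by (rule continuous_on_compose2[OF q(1) *(4,5)])
  moreover have "(\<lambda>x. q (f x)) ` A \<subseteq> Z" using q *(5) by auto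
  ultimately obtain V g where g: "open V" "A \<subseteq> V" "continuous_on (W \<inter> V) g" "g ` (W \<inter> V) \<subseteq> Z"
    "\<And>x. x \<in> A \<Longrightarrow> g x = q (f x)"
    using ANE_D[OF Z *(1,2,3)] by blast
  show "\<exists>V g. open V \<and> A \<subseteq> V \<and> continuous_on (W \<inter> V) g \<and> g ` (W \<inter> V) \<subseteq> Z' \<and> (\<forall>x\<in>A. g x = f x)"
  proof (intro exI conjI ballI)
    show "continuous_on (W \<inter> V) (\<lambda>x. p (g x))"
      by (rule continuous_on_compose2[OF p(1) g(3,4)])
    show "(\<lambda>x. p (g x)) ` (W \<inter> V) \<subseteq> Z'" using g(4) p(2) by blast
    show "p (g x) = f x" if "x \<in> A" for x using g(5)[OF that] id *(5) that by auto
  qed (use g in auto)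
qed

lemma closed_shrink:
  fixes A V :: "'a::metric_space set"
  assumes "closed A" "open V" "A \<subseteq> V"
  obtains V' where "open V'" "A \<subseteq> V'" "closure V' \<subseteq> V"
proof (cases "A = {} \<or> V = UNIV")
  case True
  then show ?thesis using that[of "{}"] that[of UNIV] by auto
next
  case False
  let ?V = "{x. infdist x A < infdist x (- V)}"
  have ne: "A \<noteq> {}" "- V \<noteq> {}" using False by auto
  show ?thesis
  proof (rule that)
    show "open ?V" by (intro open_Collect_less continuous_intros)
    show "A \<subseteq> ?V"
    proof
      fix x assume "x \<in> A"
      moreover have "infdist x (- V) \<noteq> 0"
        using in_closed_iff_infdist_zero[of "- V" x] ne assms \<open>x \<in> A\<close> by auto
      then have "infdist x (- V) > 0" by (metis infdist_nonneg order_less_le)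
      ultimately show "x \<in> ?V" by simp
    qed
    have "closure ?V \<subseteq> {x. infdist x A \<le> infdist x (- V)}"
      by (rule closure_minimal) (auto intro!: closed_Collect_le continuous_intros)
    also have "\<dots> \<subseteq> V"
    proof
      fix x assume x: "x \<in> {x. infdist x A \<le> infdist x (- V)}"
      show "x \<in> V"
      proof (rule ccontr)
        assume "x \<notin> V"
        then have "infdist x A = 0" using x infdist_nonneg[of x A] by auto
        then have "x \<in> A" using in_closed_iff_infdist_zero[OF assms(1) ne(1)] by blast
        then show False using assms \<open>x \<notin> V\<close> by blast
      qed
    qed
    finally show "closure ?V \<subseteq> V" .
  qed
qed

text \<open>Borsuk's gluing: the points nearer to the part mapped to \<open>A\<close> and those nearer to the part
  mapped to \<open>B\<close> are treated separately, after an extension over the points equally near to both.\<close>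

lemma ANE_Un:
  assumes A: "ANE A" "closed A" and B: "ANE B" "closed B" and AB: "ANE (A \<inter> B)"
  shows "ANE (A \<union> B)"
proof (rule ANE_I)
  fix W S :: "(nat \<Rightarrow> real) set" and f :: "(nat \<Rightarrow> real) \<Rightarrow> nat \<Rightarrow> real"
  assume W: "closed W" and S: "closed S" "S \<subseteq> W" and f: "continuous_on S f" "f ` S \<subseteq> A \<union> B"
  define SA SB where "SA = {x\<in>S. f x \<in> A}" and "SB = {x\<in>S. f x \<in> B}"
  have un: "S = SA \<union> SB" using f(2) by (auto simp: SA_def SB_def)
  have "closed (S \<inter> f -` A)" "closed (S \<inter> f -` B)"
    using A(2) B(2) S(1) f(1) by (auto intro: continuous_closed_preimage)
  moreover have "SA = S \<inter> f -` A" "SB = S \<inter> f -` B" by (auto simp: SA_def SB_def)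
  ultimately have cl: "closed SA" "closed SB" by simp_all
  have fc: "continuous_on SA f" "continuous_on SB f"
    using continuous_on_subset[OF f(1)] un by blast+
  show "\<exists>V g. open V \<and> S \<subseteq> V \<and> continuous_on (W \<inter> V) g \<and> g ` (W \<inter> V) \<subseteq> A \<union> B \<and> (\<forall>x\<in>S. g x = f x)"
  \<comment> \<open>\<open>infdist\<close> to the empty set is 0, so comparing distances makes sense
    only when both parts are nonempty.\<close>
  proof (cases "SA = {} \<or> SB = {}")
    case True
    then consider "S = SB" | "S = SA" using un by blast
    then show ?thesis
    proof cases
      case 1
      have "f ` S \<subseteq> B" using 1 by (auto simp: SB_def)
      then obtain V g where "open V" "S \<subseteq> V" "continuous_on (W \<inter> V) g" "g ` (W \<inter> V) \<subseteq> B" "\<And>x. x \<in> S \<Longrightarrow> g x = f x"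
        using ANE_D[OF B(1) W S f(1)] by blast
      then show ?thesis by (intro exI[of _ V] exI[of _ g]) blast
    next
      case 2
      have "f ` S \<subseteq> A" using 2 by (auto simp: SA_def)
      then obtain V g where "open V" "S \<subseteq> V" "continuous_on (W \<inter> V) g" "g ` (W \<inter> V) \<subseteq> A" "\<And>x. x \<in> S \<Longrightarrow> g x = f x"
        using ANE_D[OF A(1) W S f(1)] by blast
      then show ?thesis by (intro exI[of _ V] exI[of _ g]) blast
    qed
  next
    case False
    then have ne: "SA \<noteq> {}" "SB \<noteq> {}" by auto
    define WA WB where "WA = W \<inter> {x. infdist x SA \<le> infdist x SB}"
      and "WB = W \<inter> {x. infdist x SB \<le> infdist x SA}"
    have clW: "closed WA" "closed WB"
      unfolding WA_def WB_def by (intro closed_Int W closed_Collect_le continuous_intros)+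
    have Wun: "W = WA \<union> WB" by (auto simp: WA_def WB_def)
    have zero: "infdist x SA = 0 \<longleftrightarrow> x \<in> SA" "infdist x SB = 0 \<longleftrightarrow> x \<in> SB" for x
      using in_closed_iff_infdist_zero cl ne by blast+
    have SA_WA: "SA \<subseteq> WA"
    proof
      fix x assume "x \<in> SA"
      then show "x \<in> WA" using zero(1)[of x] infdist_nonneg[of x SB] un S(2) by (auto simp: WA_def)
    qed
    have SB_WB: "SB \<subseteq> WB"
    proof
      fix x assume "x \<in> SB"
      then show "x \<in> WB" using zero(2)[of x] infdist_nonneg[of x SA] un S(2) by (auto simp: WB_def)
    qed
    have WA_SA: "x \<in> SA" if "x \<in> S" "x \<in> WA" for x
    proof (cases "x \<in> SB")
      case True
      then have "infdist x SA \<le> 0" using that zero(2)[of x] by (simp add: WA_def)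
      then show ?thesis using zero infdist_nonneg[of x SA] by simp
    qed (use that un in auto)
    have WB_SB: "x \<in> SB" if "x \<in> S" "x \<in> WB" for x
    proof (cases "x \<in> SA")
      case True
      then have "infdist x SB \<le> 0" using that zero(1)[of x] by (simp add: WB_def)
      then show ?thesis using zero infdist_nonneg[of x SB] by simp
    qed (use that un in auto)
    \<comment> \<open>\<open>C\<close> is the seam of equally near points, and \<open>T\<close> is
      what it contains of the domain of \<open>f\<close>. On \<open>T\<close> the values lie in both
      sets, which is where the assumption on the intersection enters.\<close>
    define C T where "C = WA \<inter> WB" and "T = SA \<inter> SB"
    have clC: "closed C" "closed T" unfolding C_def T_def using clW cl by auto
    have T_C: "T \<subseteq> C" using SA_WA SB_WB by (auto simp: C_def T_def)
    have "continuous_on T f" "f ` T \<subseteq> A \<inter> B"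
      using continuous_on_subset[OF fc(1)] by (auto simp: T_def SA_def SB_def)
    then obtain V0 g0 where g0: "open V0" "T \<subseteq> V0" "continuous_on (C \<inter> V0) g0" "g0 ` (C \<inter> V0) \<subseteq> A \<inter> B"
      "\<And>x. x \<in> T \<Longrightarrow> g0 x = f x"
      using ANE_D[OF AB clC T_C] by blast
    obtain V0' where V0': "open V0'" "T \<subseteq> V0'" "closure V0' \<subseteq> V0"
      using closed_shrink[OF clC(2) g0(1,2)] by blast
    \<comment> \<open>A closed piece of the seam: together with \<open>SA\<close> or
      \<open>SB\<close> it is the closed domain of the next extension problem, so both sides receive
      the same prescribed values on the seam.\<close>
    define N where "N = C \<inter> closure V0'"
    have N: "closed N" "N \<subseteq> C \<inter> V0" using clC V0' by (auto simp: N_def)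
    have cN: "continuous_on N g0" using continuous_on_subset[OF g0(3) N(2)] .
    have agreeA: "f x = g0 x" if "x \<in> SA" "x \<in> N" for x
      using that N(2) WB_SB[of x] un g0(5) by (auto simp: C_def T_def)
    have agreeB: "f x = g0 x" if "x \<in> SB" "x \<in> N" for x
      using that N(2) WA_SA[of x] un g0(5) by (auto simp: C_def T_def)
    have *: "\<exists>V g. open V \<and> SX \<union> N \<subseteq> V \<and> continuous_on (WX \<inter> V) g \<and> g ` (WX \<inter> V) \<subseteq> X \<and>
        (\<forall>x\<in>SX. g x = f x) \<and> (\<forall>x\<in>N. g x = g0 x)"
      if X: "ANE X" "closed SX" "closed WX" "SX \<subseteq> WX" "N \<subseteq> WX" "continuous_on SX f" "f ` SX \<subseteq> X" "g0 ` N \<subseteq> X"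
        "\<And>x. x \<in> SX \<Longrightarrow> x \<in> N \<Longrightarrow> f x = g0 x" for X SX WX
    proof -
      define h where "h = (\<lambda>x. if x \<in> SX then f x else g0 x)"
      have "continuous_on (SX \<union> N) h"
        unfolding h_def
        by (rule continuous_on_cases_local)
          (use X(2,6,9) N(1) cN in \<open>auto intro: closed_subset\<close>)
      moreover have "h ` (SX \<union> N) \<subseteq> X" using X(7,8) by (auto simp: h_def)
      ultimately obtain V g where g: "open V" "SX \<union> N \<subseteq> V" "continuous_on (WX \<inter> V) g" "g ` (WX \<inter> V) \<subseteq> X"
        "\<And>x. x \<in> SX \<union> N \<Longrightarrow> g x = h x"
        using ANE_D[OF X(1,3), of "SX \<union> N" h] X N by (metis closed_Un le_sup_iff)
      have "\<forall>x\<in>SX. g x = f x" using g(5) by (auto simp: h_def)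
      moreover have "\<forall>x\<in>N. g x = g0 x" using g(5) X(9) by (auto simp: h_def)
      ultimately show ?thesis using g by blast
    qed
    have "\<exists>V g. open V \<and> SA \<union> N \<subseteq> V \<and> continuous_on (WA \<inter> V) g \<and> g ` (WA \<inter> V) \<subseteq> A \<and>
        (\<forall>x\<in>SA. g x = f x) \<and> (\<forall>x\<in>N. g x = g0 x)"
    proof (rule *[OF A(1) cl(1) clW(1) SA_WA _ fc(1)])
      show "N \<subseteq> WA" using N(2) by (auto simp: C_def)
      show "f ` SA \<subseteq> A" by (auto simp: SA_def)
      show "g0 ` N \<subseteq> A" using N(2) g0(4) by blast
    qed (rule agreeA)
    then obtain V1 gA where gA: "open V1" "SA \<union> N \<subseteq> V1" "continuous_on (WA \<inter> V1) gA" "gA ` (WA \<inter> V1) \<subseteq> A"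
        "\<And>x. x \<in> SA \<Longrightarrow> gA x = f x" "\<And>x. x \<in> N \<Longrightarrow> gA x = g0 x" by blast
    have "\<exists>V g. open V \<and> SB \<union> N \<subseteq> V \<and> continuous_on (WB \<inter> V) g \<and> g ` (WB \<inter> V) \<subseteq> B \<and>
        (\<forall>x\<in>SB. g x = f x) \<and> (\<forall>x\<in>N. g x = g0 x)"
    proof (rule *[OF B(1) cl(2) clW(2) SB_WB _ fc(2)])
      show "N \<subseteq> WB" using N(2) by (auto simp: C_def)
      show "f ` SB \<subseteq> B" by (auto simp: SB_def)
      show "g0 ` N \<subseteq> B" using N(2) g0(4) by blast
    qed (rule agreeB)
    then obtain V2 gB where gB: "open V2" "SB \<union> N \<subseteq> V2" "continuous_on (WB \<inter> V2) gB" "gB ` (WB \<inter> V2) \<subseteq> B"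
        "\<And>x. x \<in> SB \<Longrightarrow> gB x = f x" "\<And>x. x \<in> N \<Longrightarrow> gB x = g0 x" by blast
    \<comment> \<open>Each condition binds only on the closed set whose complement is added, so
      \<open>V\<close> is open. The last one forces seam points into \<open>N\<close>, where the two
      extensions agree.\<close>
    define V where "V = (V1 \<union> - WA) \<inter> (V2 \<union> - WB) \<inter> (V0' \<union> - C)"
    have VN: "x \<in> N" if "x \<in> WA" "x \<in> WB" "x \<in> V" for x
      using that closure_subset by (auto simp: V_def N_def C_def)
    have eq: "W \<inter> V = (WA \<inter> V) \<union> (WB \<inter> V)" using Wun by blast
    show ?thesis
    proof (intro exI conjI ballI)
      show "open V" unfolding V_def using gA(1) gB(1) V0'(1) clW clC by (intro open_Int open_Un) auto
      show "S \<subseteq> V"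
      proof
        fix x assume x: "x \<in> S"
        then have "x \<in> WA \<Longrightarrow> x \<in> V1" "x \<in> WB \<Longrightarrow> x \<in> V2" using WA_SA WB_SB gA(2) gB(2) by blast+
        moreover have "x \<in> C \<Longrightarrow> x \<in> V0'" using WA_SA WB_SB x V0'(2) by (auto simp: C_def T_def)
        ultimately show "x \<in> V" by (auto simp: V_def)
      qed
      show "continuous_on (W \<inter> V) (\<lambda>x. if x \<in> WA then gA x else gB x)"
        unfolding eq
      proof (rule continuous_on_cases_local)
        show "closedin (top_of_set (WA \<inter> V \<union> WB \<inter> V)) (WA \<inter> V)" "closedin (top_of_set (WA \<inter> V \<union> WB \<inter> V)) (WB \<inter> V)"
          unfolding closedin_closed using clW by blast+
        show "continuous_on (WA \<inter> V) gA" by (rule continuous_on_subset[OF gA(3)]) (auto simp: V_def)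
        show "continuous_on (WB \<inter> V) gB" by (rule continuous_on_subset[OF gB(3)]) (auto simp: V_def)
        show "gA x = gB x" if "x \<in> WA \<inter> V \<and> x \<notin> WA \<or> x \<in> WB \<inter> V \<and> x \<in> WA" for x
          using VN gA(6) gB(6) that by auto
      qed
      show "(\<lambda>x. if x \<in> WA then gA x else gB x) ` (W \<inter> V) \<subseteq> A \<union> B"
        using gA(4) gB(4) Wun by (auto simp: V_def)
      show "(if x \<in> WA then gA x else gB x) = f x" if "x \<in> S" for x
        using that WA_SA gA(5) gB(5) un SA_WA by auto
    qed
  qed
qed

text \<open>Splitting off one set \<open>S\<close> requires the intersection of \<open>S\<close>
  with the union of the others to be an \<open>ANE\<close>. By distributivity it is a union of fewer
  members of the class, hence the closure under intersections and the induction on the number of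
  sets.\<close>

lemma ANE_finite_Union:
  assumes Q: "\<And>S. Q S \<Longrightarrow> closed S" "\<And>S. Q S \<Longrightarrow> ANE S" and int: "\<And>S T. Q S \<Longrightarrow> Q T \<Longrightarrow> Q (S \<inter> T)"
  shows "finite F \<Longrightarrow> (\<And>S. S \<in> F \<Longrightarrow> Q S) \<Longrightarrow> ANE (\<Union>F)"
proof (induction "card F" arbitrary: F rule: less_induct)
  case less
  show ?case
  proof (cases "F = {}")
    case True then show ?thesis using ANE_empty by simp
  next
    case False
    then obtain S where S: "S \<in> F" by blast
    let ?G = "F - {S}"
    have G: "finite ?G" "card ?G < card F" using less.prems(1) S by (simp, metis card_Diff1_less)
    have Qs: "Q S" "\<And>T. T \<in> ?G \<Longrightarrow> Q T" using less.prems(2) S by blast+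
    have "ANE (\<Union>((\<inter>) S ` ?G))"
    proof (rule less.hyps)
      show "card ((\<inter>) S ` ?G) < card F" using card_image_le[OF G(1)] G(2) by (rule le_less_trans)
      show "finite ((\<inter>) S ` ?G)" using G(1) by (rule finite_imageI)
      show "Q T" if "T \<in> (\<inter>) S ` ?G" for T using that Qs int by blast
    qed
    then have "ANE (S \<inter> \<Union>?G)" by (simp only: Int_Union)
    moreover have "ANE (\<Union>?G)" by (rule less.hyps[OF G(2,1)]) (rule Qs)
    moreover have "closed (\<Union>?G)" by (rule closed_Union[OF G(1)]) (use Q(1) Qs(2) in blast)
    ultimately have "ANE (S \<union> \<Union>?G)" using Q Qs(1) by (intro ANE_Un)
    moreover have "S \<union> \<Union>?G = \<Union>F" using S by blast
    ultimately show ?thesis by simp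
  qed
qed

section \<open>Pieces between two graphs\<close>

lemma continuous_on_coord:
  "continuous_on S f \<Longrightarrow> continuous_on S (\<lambda>x. f x i)" for f :: "'a::topological_space \<Rightarrow> nat \<Rightarrow> real"
  by (rule continuous_on_product_then_coordinatewise)

lemma continuous_on_fun_upd:
  fixes f :: "'a::topological_space \<Rightarrow> nat \<Rightarrow> real"
  assumes "continuous_on S f" "continuous_on S h"
  shows "continuous_on S (\<lambda>x. (f x)(k := h x))"
proof (rule continuous_on_coordinatewise_then_product)
  show "continuous_on S (\<lambda>x. ((f x)(k := h x)) i)" for i
    using assms(2) continuous_on_product_then_coordinatewise[OF assms(1)] by (cases "i = k") auto
qed

text \<open>Coordinate \<open>k\<close> is the fibre coordinate and is 0 on the base, so
  \<open>z(k := 0)\<close> is the projection and the base lies in the same space as the total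
  set.\<close>

definition piece :: "nat \<Rightarrow> (nat \<Rightarrow> real) set \<Rightarrow> ((nat \<Rightarrow> real) \<Rightarrow> real) \<Rightarrow> ((nat \<Rightarrow> real) \<Rightarrow> real) \<Rightarrow> (nat \<Rightarrow> real) set" where
  "piece k E \<alpha> \<beta> = {z. z(k := 0) \<in> E \<and> \<alpha> (z(k := 0)) \<le> z k \<and> z k \<le> \<beta> (z(k := 0))}"

lemma closed_piece:
  assumes "closed E" "continuous_on UNIV \<alpha>" "continuous_on UNIV \<beta>"
  shows "closed (piece k E \<alpha> \<beta>)"
proof -
  have c: "continuous_on UNIV (\<lambda>z::nat\<Rightarrow>real. z(k := 0))"
    by (intro continuous_on_fun_upd continuous_on_id continuous_on_const)
  have p: "continuous_on UNIV (\<lambda>z::nat\<Rightarrow>real. z k)" by (intro continuous_on_coord continuous_on_id)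
  have "piece k E \<alpha> \<beta> = (\<lambda>z. z(k := 0)) -` E \<inter> {z. \<alpha> (z(k := 0)) \<le> z k} \<inter> {z. z k \<le> \<beta> (z(k := 0))}"
    by (auto simp: piece_def)
  moreover have "closed ((\<lambda>z::nat\<Rightarrow>real. z(k := 0)) -` E)"
    using c assms(1) by (simp add: continuous_on_closed_vimage)
  ultimately show ?thesis
    using closed_Collect_le[OF continuous_on_compose2[OF assms(2) c subset_UNIV] p]
      closed_Collect_le[OF p continuous_on_compose2[OF assms(3) c subset_UNIV]] by auto
qed

text \<open>The base point is extended by the property of \<open>E\<close>, the fibre coordinate by
  Tietze's theorem, and the latter is then truncated to the interval over the extended base
  point.\<close>

lemma ANE_piece:
  assumes E: "ANE E" "\<And>y. y \<in> E \<Longrightarrow> y k = 0 \<and> \<alpha> y \<le> \<beta> y"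
    and \<alpha>: "continuous_on E \<alpha>" and \<beta>: "continuous_on E \<beta>"
  shows "ANE (piece k E \<alpha> \<beta>)"
proof (rule ANE_I)
  fix W A :: "(nat \<Rightarrow> real) set" and f :: "(nat \<Rightarrow> real) \<Rightarrow> nat \<Rightarrow> real"
  assume W: "closed W" and A: "closed A" "A \<subseteq> W" and f: "continuous_on A f" "f ` A \<subseteq> piece k E \<alpha> \<beta>"
  have "continuous_on A (\<lambda>x. (f x)(k := 0))" by (intro continuous_on_fun_upd continuous_on_const f)
  moreover have "(\<lambda>x. (f x)(k := 0)) ` A \<subseteq> E" using f(2) by (auto simp: piece_def)
  ultimately obtain V g where g: "open V" "A \<subseteq> V" "continuous_on (W \<inter> V) g" "g ` (W \<inter> V) \<subseteq> E"
    "\<And>x. x \<in> A \<Longrightarrow> g x = (f x)(k := 0)" using ANE_D[OF E(1) W A] by blast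
  obtain t where t: "continuous_on (UNIV :: (nat \<Rightarrow> real) set) t" "\<And>x. x \<in> A \<Longrightarrow> t x = f x k"
    using Tietze_unbounded[of A "\<lambda>x. f x k" UNIV] A(1) continuous_on_coord[OF f(1)] by auto
  define h where "h x = (g x)(k := max (\<alpha> (g x)) (min (\<beta> (g x)) (t x)))" for x
  show "\<exists>V g. open V \<and> A \<subseteq> V \<and> continuous_on (W \<inter> V) g \<and> g ` (W \<inter> V) \<subseteq> piece k E \<alpha> \<beta> \<and> (\<forall>x\<in>A. g x = f x)"
  proof (intro exI conjI ballI)
    show "continuous_on (W \<inter> V) h"
      unfolding h_def
      by (intro continuous_on_fun_upd continuous_on_max continuous_on_min g(3) continuous_on_subset[OF t(1)]
        continuous_on_compose2[OF \<alpha> g(3,4)] continuous_on_compose2[OF \<beta> g(3,4)] subset_UNIV)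
    show "h ` (W \<inter> V) \<subseteq> piece k E \<alpha> \<beta>"
    proof
      fix z assume "z \<in> h ` (W \<inter> V)"
      then obtain x where x: "x \<in> W \<inter> V" "z = h x" by blast
      then have "g x \<in> E" using g(4) by blast
      moreover have "z(k := 0) = g x" using E(2)[OF calculation] by (auto simp: x h_def)
      ultimately show "z \<in> piece k E \<alpha> \<beta>" using E(2)[of "g x"] by (simp add: piece_def x h_def)
    qed
    show "h x = f x" if "x \<in> A" for x
    proof -
      have "f x \<in> piece k E \<alpha> \<beta>" using f(2) that by blast
      then show ?thesis using g(5)[OF that] t(2)[OF that] by (auto simp: piece_def h_def)
    qed
  qed (use g in auto)
qed

section \<open>Compact semialgebraic sets\<close>

text \<open>\<open>T\<close> is the homogeneous part of degree \<open>n\<close> of a polynomial of degree at most \<open>n\<close>; it may vanish.\<close>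

inductive top_form :: "((nat \<Rightarrow> real) \<Rightarrow> real) \<Rightarrow> nat \<Rightarrow> ((nat \<Rightarrow> real) \<Rightarrow> real) \<Rightarrow> bool" where
  coord: "top_form (\<lambda>x. x i) 1 (\<lambda>x. x i)"
| const: "top_form (\<lambda>x. c) 0 (\<lambda>x. c)"
| add: "top_form f n T \<Longrightarrow> top_form g n U \<Longrightarrow> top_form (\<lambda>x. f x + g x) n (\<lambda>x. T x + U x)"
| mult: "top_form f n T \<Longrightarrow> top_form g m U \<Longrightarrow> top_form (\<lambda>x. f x * g x) (n + m) (\<lambda>x. T x * U x)"
| raise: "top_form f n T \<Longrightarrow> top_form f (Suc n) (\<lambda>x. 0)"

lemma top_form_raise: "top_form f n T \<Longrightarrow> n < m \<Longrightarrow> top_form f m (\<lambda>x. 0)"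
proof (induction m)
  case (Suc m)
  then show ?case by (cases "n = m") (auto intro: top_form.raise)
qed simp

lemma top_form_zero: "\<exists>U. top_form (\<lambda>x. 0) n U"
  by (cases n) (use top_form.const[of 0] top_form_raise[OF top_form.const[of 0]] in blast)+

lemma top_form_exists: "f \<in> polyfun I \<Longrightarrow> \<exists>n T. top_form f n T"
proof (induction rule: polyfun.induct)
  case (coord i)
  show ?case using top_form.coord[of i] by (intro exI)
next
  case (const c)
  show ?case using top_form.const[of c] by (intro exI)
next
  case (add f g)
  then obtain n T m U where *: "top_form f n T" "top_form g m U" by blast
  \<comment> \<open>Raising both past the larger degree gives a common degree at the price of a
    vanishing top form; \<open>top_form_nonzero\<close> repairs this later.\<close>
  have "top_form f (Suc (max n m)) (\<lambda>x. 0)" "top_form g (Suc (max n m)) (\<lambda>x. 0)"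
    by (rule top_form_raise[OF *(1)], simp, rule top_form_raise[OF *(2)], simp)
  from top_form.add[OF this] show ?case by (intro exI)
next
  case (mult f g)
  then obtain n T m U where *: "top_form f n T" "top_form g m U" by blast
  from top_form.mult[OF this] show ?case by (intro exI)
qed

lemma top_form_polyfun:
  assumes "top_form f n T"
  shows "f \<in> polyfun UNIV" "T \<in> polyfun UNIV"
proof -
  have "f \<in> polyfun UNIV \<and> T \<in> polyfun UNIV"
    using assms by (induction rule: top_form.induct) (auto intro: polyfun.intros)
  then show "f \<in> polyfun UNIV" "T \<in> polyfun UNIV" by auto
qed

lemma coeff_mult_top:
  fixes p q :: "real poly"
  assumes "degree p \<le> n" "degree q \<le> m"
  shows "coeff (p * q) (n + m) = coeff p n * coeff q m"
proof -
  have "coeff (p * q) (n + m) = (\<Sum>i\<le>n+m. coeff p i * coeff q (n + m - i))"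
    by (simp add: coeff_mult)
  also have "\<dots> = (\<Sum>i\<in>{n}. coeff p i * coeff q (n + m - i))"
  proof (rule sum.mono_neutral_right)
    show "\<forall>i\<in>{..n + m} - {n}. coeff p i * coeff q (n + m - i) = 0"
    proof
      fix i assume "i \<in> {..n + m} - {n}"
      then have "n < i \<or> m < n + m - i" by auto
      then show "coeff p i * coeff q (n + m - i) = 0"
        using assms by (auto intro!: coeff_eq_0)
    qed
  qed auto
  finally show ?thesis by simp
qed

definition line :: "(nat \<Rightarrow> real) \<Rightarrow> (nat \<Rightarrow> real) \<Rightarrow> real \<Rightarrow> nat \<Rightarrow> real" where
  "line y v t = (\<lambda>i. y i + t * v i)"

text \<open>Along a line in direction \<open>v\<close>, only the top form contributes to the highest
  power of the line parameter, and its contribution does not involve the base point.\<close>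

lemma top_form_line:
  assumes "top_form f n T"
  shows "\<exists>q. polycoeffs UNIV n q \<and> (\<forall>y t. f (line y v t) = poly (q y) t) \<and> (\<forall>y. coeff (q y) n = T v)"
  using assms
proof (induction rule: top_form.induct)
  case (coord i)
  have "polycoeffs UNIV 1 (\<lambda>y. [:y i, v i:])"
    unfolding polycoeffs_def
  proof (intro conjI allI)
    fix j
    have "(\<lambda>y. coeff [:y i, v i:] j) = (if j = 0 then (\<lambda>y. y i) else if j = 1 then (\<lambda>y. v i) else (\<lambda>y. 0))"
      by (auto simp: coeff_pCons fun_eq_iff split: nat.splits)
    then show "(\<lambda>y. coeff [:y i, v i:] j) \<in> polyfun UNIV"
      by (simp add: polyfun.coord polyfun.const)
  qed (simp add: degree_pCons_eq_if)
  then show ?case by (intro exI[of _ "\<lambda>y. [:y i, v i:]"]) (auto simp: line_def)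
next
  case (const c)
  show ?case
    by (intro exI[of _ "\<lambda>y. [:c:]"]) (auto intro: polycoeffs_const polyfun.const)
next
  case (add f n T g U)
  obtain q where q: "polycoeffs UNIV n q" "\<And>y t. f (line y v t) = poly (q y) t" "\<And>y. coeff (q y) n = T v"
    using add.IH(1) by blast
  obtain r where r: "polycoeffs UNIV n r" "\<And>y t. g (line y v t) = poly (r y) t" "\<And>y. coeff (r y) n = U v"
    using add.IH(2) by blast
  show ?case
    by (intro exI[of _ "\<lambda>y. q y + r y"] conjI allI) (simp_all add: q r polycoeffs_add)
next
  case (mult f n T g m U)
  obtain q where q: "polycoeffs UNIV n q" "\<And>y t. f (line y v t) = poly (q y) t" "\<And>y. coeff (q y) n = T v"
    using mult.IH(1) by blast
  obtain r where r: "polycoeffs UNIV m r" "\<And>y t. g (line y v t) = poly (r y) t" "\<And>y. coeff (r y) m = U v"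
    using mult.IH(2) by blast
  have "coeff (q y * r y) (n + m) = T v * U v" for y
    using coeff_mult_top[of "q y" n "r y" m] q(1,3) r(1,3) by (simp add: polycoeffs_def)
  then show ?case
    by (intro exI[of _ "\<lambda>y. q y * r y"] conjI allI) (simp_all add: q r polycoeffs_mult)
next
  case (raise f n T)
  obtain q where q: "polycoeffs UNIV n q" "\<And>y t. f (line y v t) = poly (q y) t"
    using raise.IH by blast
  have "degree (q y) < Suc n" for y using q(1) by (simp add: polycoeffs_def less_Suc_eq_le)
  then have "coeff (q y) (Suc n) = 0" for y by (rule coeff_eq_0)
  then show ?case
    by (intro exI[of _ q] conjI allI) (simp_all add: q polycoeffs_mono[OF q(1)])
qed

text \<open>Splits off the top form and leaves something of smaller degree. This is the descent step
  for removing a top form that vanishes where it matters.\<close>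

lemma top_form_lower:
  assumes "top_form f n T"
  shows "top_form T n T \<and> (if n = 0 then \<forall>x. f x = T x else \<exists>U. top_form (\<lambda>x. f x - T x) (n - 1) U)"
  using assms
proof (induction rule: top_form.induct)
  case (coord i)
  show ?case using top_form.coord top_form.const[of 0] by auto
next
  case (const c)
  show ?case using top_form.const by auto
next
  case (add f n T g U)
  show ?case
  proof (cases "n = 0")
    case False
    then obtain V W where "top_form (\<lambda>x. f x - T x) (n - 1) V" "top_form (\<lambda>x. g x - U x) (n - 1) W"
      using add by auto
    from top_form.add[OF this] have "\<exists>V. top_form (\<lambda>x. f x + g x - (T x + U x)) (n - 1) V"
      by (auto simp: algebra_simps)
    then show ?thesis using add False top_form.add by auto
  qed (use add top_form.add in auto)
next
  case (mult f n T g m U)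
  have T: "top_form T n T" "top_form U m U" using mult by auto
  have TU: "top_form (\<lambda>x. T x * U x) (n + m) (\<lambda>x. T x * U x)" using top_form.mult[OF T] .
  show ?case
  proof (cases "n + m = 0")
    case True then show ?thesis using TU mult by simp
  next
    case False
    have 1: "\<exists>V. top_form (\<lambda>x. (f x - T x) * g x) (n + m - 1) V"
    proof (cases "n = 0")
      case True
      then have "(\<lambda>x. (f x - T x) * g x) = (\<lambda>x. 0)" using mult by simp
      then show ?thesis using top_form_zero by simp
    next
      case F: False
      then obtain V where "top_form (\<lambda>x. f x - T x) (n - 1) V" using mult by auto
      from top_form.mult[OF this mult.hyps(2)] show ?thesis using F by auto
    qed
    have 2: "\<exists>V. top_form (\<lambda>x. T x * (g x - U x)) (n + m - 1) V"
    proof (cases "m = 0")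
      case True
      then have "(\<lambda>x. T x * (g x - U x)) = (\<lambda>x. 0)" using mult by simp
      then show ?thesis using top_form_zero by simp
    next
      case F: False
      then obtain V where "top_form (\<lambda>x. g x - U x) (m - 1) V" using mult by auto
      from top_form.mult[OF T(1) this] show ?thesis using F by auto
    qed
    obtain V W where "top_form (\<lambda>x. (f x - T x) * g x) (n + m - 1) V" "top_form (\<lambda>x. T x * (g x - U x)) (n + m - 1) W"
      using 1 2 by blast
    from top_form.add[OF this] have "\<exists>V. top_form (\<lambda>x. f x * g x - T x * U x) (n + m - 1) V"
      by (auto simp: algebra_simps)
    then show ?thesis using TU False by auto
  qed
next
  case (raise f n T)
  then show ?case
    using top_form_raise[OF top_form.const[of 0], of "Suc n"] by auto
qed

text \<open>The copy of \<real>^I inside the sequence space.\<close>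

definition coord_space :: "nat set \<Rightarrow> (nat \<Rightarrow> real) set" where
  "coord_space I = {x. \<forall>i. i \<notin> I \<longrightarrow> x i = 0}"

lemma line_coord_space: "y \<in> coord_space I \<Longrightarrow> v \<in> coord_space I \<Longrightarrow> line y v t \<in> coord_space I"
  by (simp add: coord_space_def line_def)

lemma closed_coord_space: "closed (coord_space I)"
proof -
  have "coord_space I = (\<Inter>i\<in>-I. {x. x i = 0})" by (auto simp: coord_space_def)
  moreover have "closed {x::nat\<Rightarrow>real. x i = 0}" for i
    by (rule closed_Collect_eq) (auto intro: continuous_on_coord continuous_on_id)
  ultimately show ?thesis by auto
qed

text \<open>Take a function that agrees with \<open>f\<close> on \<open>X\<close> and has the least
  possible degree bound. If its top form vanished on \<open>X\<close>, subtracting it would keep the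
  values and lower the bound.\<close>

lemma top_form_nonzero:
  assumes f: "f \<in> polyfun UNIV" and nz: "\<exists>x\<in>X. f x \<noteq> 0"
  shows "\<exists>g n T. top_form g n T \<and> (\<forall>x\<in>X. g x = f x) \<and> (\<exists>x\<in>X. T x \<noteq> 0)"
proof -
  define Q where "Q n \<longleftrightarrow> (\<exists>g T. top_form g n T \<and> (\<forall>x\<in>X. g x = f x))" for n
  have "\<exists>n. Q n" using top_form_exists[OF f] by (auto simp: Q_def)
  then have "Q (LEAST n. Q n)" by (rule LeastI_ex)
  then obtain n where n: "Q n" "\<And>m. m < n \<Longrightarrow> \<not> Q m" using not_less_Least by blast
  then obtain g T where g: "top_form g n T" "\<forall>x\<in>X. g x = f x" by (auto simp: Q_def)
  have "\<exists>x\<in>X. T x \<noteq> 0"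
  proof (rule ccontr)
    assume "\<not> ?thesis"
    then have T: "\<forall>x\<in>X. T x = 0" by blast
    show False
    proof (cases "n = 0")
      case True then show False using top_form_lower[OF g(1)] T g(2) nz by auto
    next
      case False
      then obtain U where "top_form (\<lambda>x. g x - T x) (n - 1) U" using top_form_lower[OF g(1)] by auto
      then have "Q (n - 1)" using T g(2) by (auto simp: Q_def intro!: exI)
      then show False using n(2)[of "n - 1"] False by simp
    qed
  qed
  then show ?thesis using g by blast
qed

text \<open>On the line through \<open>a\<close> and \<open>b\<close> both functions become nonzero
  polynomials in one variable, so their product has only finitely many roots there.\<close>

lemma polyfun_mult_nonzero:
  assumes f: "f \<in> polyfun UNIV" and g: "g \<in> polyfun UNIV"
    and a: "a \<in> coord_space I" "f a \<noteq> 0" and b: "b \<in> coord_space I" "g b \<noteq> 0"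
  shows "\<exists>c\<in>coord_space I. f c * g c \<noteq> 0"
proof -
  define v where "v i = b i - a i" for i
  have ends: "line a v 0 = a" "line a v 1 = b" by (auto simp: line_def v_def)
  have v: "v \<in> coord_space I" using a b by (auto simp: coord_space_def v_def)
  obtain n T m U where "top_form f n T" "top_form g m U" using top_form_exists f g by meson
  then obtain p q where pq: "\<And>t. f (line a v t) = poly (p a) t" "\<And>t. g (line a v t) = poly (q a) t"
    using top_form_line by meson
  have "poly (p a) 0 \<noteq> 0" "poly (q a) 1 \<noteq> 0" using pq a b ends by metis+
  then have "p a * q a \<noteq> 0" by auto
  then have "finite {t. poly (p a * q a) t = 0}" by (rule poly_roots_finite)
  then obtain t where "poly (p a * q a) t \<noteq> 0"
    using ex_new_if_finite[OF infinite_UNIV_char_0[where 'a = real]] by blast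
  then show ?thesis using pq line_coord_space[OF a(1) v, of t] by (intro bexI[of _ "line a v t"]) auto
qed

lemma polyfun_common_nonzero:
  assumes "finite F" "F \<subseteq> polyfun UNIV" "\<And>f. f \<in> F \<Longrightarrow> \<exists>x\<in>coord_space I. f x \<noteq> 0"
  shows "\<exists>x\<in>coord_space I. \<forall>f\<in>F. f x \<noteq> 0"
proof -
  have "\<exists>x\<in>coord_space I. (\<Prod>f\<in>F. f x) \<noteq> 0"
    using assms
  proof (induction F rule: finite_induct)
    case empty
    have "(\<lambda>_. 0) \<in> coord_space I" by (simp add: coord_space_def)
    then show ?case by auto
  next
    case (insert f F)
    have "\<exists>x\<in>coord_space I. f x \<noteq> 0" using insert.prems(2) by simp
    then obtain a where a: "a \<in> coord_space I" "f a \<noteq> 0" by blast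
    have "\<exists>x\<in>coord_space I. (\<Prod>f\<in>F. f x) \<noteq> 0" using insert.IH insert.prems by simp
    then obtain b where b: "b \<in> coord_space I" "(\<Prod>f\<in>F. f b) \<noteq> 0" by blast
    have "\<exists>c\<in>coord_space I. f c * (\<Prod>f\<in>F. f c) \<noteq> 0"
    proof (rule polyfun_mult_nonzero[where f = f and g = "\<lambda>x. \<Prod>f\<in>F. f x", OF _ _ a b])
      show "f \<in> polyfun UNIV" using insert.prems(1) by simp
      show "(\<lambda>x. \<Prod>f\<in>F. f x) \<in> polyfun UNIV" by (rule polyfun_prod) (use insert.prems(1) in auto)
    qed
    then show ?case using insert.hyps by simp
  qed
  then show ?thesis using assms(1) by (auto simp: prod_zero_iff)
qed

text \<open>Semialgebraic subsets of \<real>^I without a syntax of formulas: membership depends only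
  on the signs of finitely many polynomials.\<close>

definition definable :: "nat set \<Rightarrow> (nat \<Rightarrow> real) set \<Rightarrow> bool" where
  "definable I S \<longleftrightarrow> S \<subseteq> coord_space I \<and> (\<exists>P. finite P \<and> P \<subseteq> polyfun UNIV \<and>
     (\<forall>x\<in>coord_space I. \<forall>x'\<in>coord_space I. same_signs P x x' \<longrightarrow> (x \<in> S \<longleftrightarrow> x' \<in> S)))"

lemma definable_I:
  assumes "S \<subseteq> coord_space I" "finite P" "P \<subseteq> polyfun UNIV"
    and "\<And>x x'. x \<in> coord_space I \<Longrightarrow> x' \<in> coord_space I \<Longrightarrow> same_signs P x x' \<Longrightarrow> x \<in> S \<longleftrightarrow> x' \<in> S"
  shows "definable I S"
  unfolding definable_def using assms by (intro conjI exI[of _ P] ballI impI)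

lemma definable_Int:
  assumes "definable I S" "definable I T"
  shows "definable I (S \<inter> T)"
proof -
  obtain P where P: "finite P" "P \<subseteq> polyfun UNIV"
    "\<And>x x'. x \<in> coord_space I \<Longrightarrow> x' \<in> coord_space I \<Longrightarrow> same_signs P x x' \<Longrightarrow> x \<in> S \<longleftrightarrow> x' \<in> S"
    using assms(1) by (auto simp: definable_def)
  obtain R where R: "finite R" "R \<subseteq> polyfun UNIV"
    "\<And>x x'. x \<in> coord_space I \<Longrightarrow> x' \<in> coord_space I \<Longrightarrow> same_signs R x x' \<Longrightarrow> x \<in> T \<longleftrightarrow> x' \<in> T"
    using assms(2) by (auto simp: definable_def)
  show ?thesis
  proof (rule definable_I[of _ _ "P \<union> R"])
    show "S \<inter> T \<subseteq> coord_space I" using assms(1) by (auto simp: definable_def)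
    show "x \<in> S \<inter> T \<longleftrightarrow> x' \<in> S \<inter> T"
      if "x \<in> coord_space I" "x' \<in> coord_space I" "same_signs (P \<union> R) x x'" for x x'
      using P(3)[OF that(1,2)] R(3)[OF that(1,2)] same_signs_mono[OF that(3)] by simp
  qed (use P R in auto)
qed

lemma polycoeffs_prod:
  assumes "finite A" "\<And>a. a \<in> A \<Longrightarrow> polycoeffs I (n a) (q a)"
  shows "polycoeffs I (\<Sum>a\<in>A. n a) (\<lambda>y. \<Prod>a\<in>A. q a y) \<and>
    (\<forall>y. coeff (\<Prod>a\<in>A. q a y) (\<Sum>a\<in>A. n a) = (\<Prod>a\<in>A. coeff (q a y) (n a)))"
  using assms
proof (induction A rule: finite_induct)
  case empty
  have "polycoeffs I 0 (\<lambda>y. [:1:])" by (intro polycoeffs_const polyfun.const)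
  then show ?case by (simp add: one_pCons)
next
  case (insert a A)
  then have *: "polycoeffs I (n a) (q a)" "polycoeffs I (\<Sum>a\<in>A. n a) (\<lambda>y. \<Prod>a\<in>A. q a y)" by simp_all
  have "polycoeffs I (n a + (\<Sum>a\<in>A. n a)) (\<lambda>y. q a y * (\<Prod>a\<in>A. q a y))"
    by (rule polycoeffs_mult[OF *])
  moreover have "coeff (q a y * (\<Prod>a\<in>A. q a y)) (n a + (\<Sum>a\<in>A. n a)) =
      coeff (q a y) (n a) * coeff (\<Prod>a\<in>A. q a y) (\<Sum>a\<in>A. n a)" for y
    by (rule coeff_mult_top) (use * in \<open>simp_all add: polycoeffs_def\<close>)
  ultimately show ?case using insert by simp
qed

lemma polycoeffs_derivs: "polycoeffs I d q \<Longrightarrow> polycoeffs I d (\<lambda>y. derivs (q y) j)"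
proof (induction j)
  case 0 then show ?case by (simp add: derivs_0)
next
  case (Suc j)
  have "derivs p (Suc j) = pderiv (derivs p j)" for p by (simp add: derivs_def)
  then show ?case using polycoeffs_mono[OF polycoeffs_pderiv[OF Suc.IH[OF Suc.prems]], of d] by simp
qed

lemma line_line: "line (line y v s) v t = line y v (s + t)"
  by (simp add: line_def algebra_simps)

lemma line_0: "line y v 0 = y"
  by (simp add: line_def)

lemma continuous_on_line:
  fixes f :: "'a::topological_space \<Rightarrow> nat \<Rightarrow> real"
  assumes "continuous_on A f" "continuous_on A h"
  shows "continuous_on A (\<lambda>x. line (f x) v (h x))"
  unfolding line_def
  by (rule continuous_on_coordinatewise_then_product)
    (intro continuous_on_add continuous_on_mult continuous_on_const continuous_on_coord assms)

lemma continuous_on_proj: "continuous_on A (\<lambda>x::nat \<Rightarrow> real. x i)"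
  by (rule continuous_on_coord[OF continuous_on_id])

text \<open>Lines in the direction \<open>v\<close> are used as fibres, where \<open>v\<close> is no zero of the top forms, so that the
  polynomials restricted to the lines have constant leading coefficients.\<close>

lemma ANE_definable_step:
  assumes k: "k \<in> I" and IH: "\<And>E. compact E \<Longrightarrow> definable (I - {k}) E \<Longrightarrow> ANE E"
    and S: "compact S" "definable I S"
  shows "ANE S"
proof -
  let ?X = "coord_space I" and ?B = "coord_space (I - {k})"
  obtain P0 where P0: "finite P0" "P0 \<subseteq> polyfun UNIV"
    "\<And>x x'. x \<in> ?X \<Longrightarrow> x' \<in> ?X \<Longrightarrow> same_signs P0 x x' \<Longrightarrow> x \<in> S \<longleftrightarrow> x' \<in> S"
    using S(2) by (auto simp: definable_def)
  have SX: "S \<subseteq> ?X" using S(2) by (simp add: definable_def)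
  \<comment> \<open>Polynomials vanishing on all of \<open>?X\<close> have sign 0 everywhere and are
    dropped: they admit no top form that is nonzero on \<open>?X\<close>.\<close>
  define P where "P = {p \<in> P0. \<exists>x\<in>?X. p x \<noteq> 0}"
  have finP: "finite P" using P0 by (simp add: P_def)
  have Psgn: "x \<in> S \<longleftrightarrow> x' \<in> S" if x: "x \<in> ?X" "x' \<in> ?X" and ss: "\<And>p. p \<in> P \<Longrightarrow> sgn (p x) = sgn (p x')" for x x'
  proof (rule P0(3)[OF x])
    show "same_signs P0 x x'"
      unfolding same_signs_def
    proof
      fix p assume "p \<in> P0"
      then show "sgn (p x) = sgn (p x')" using ss[of p] x by (cases "p \<in> P") (auto simp: P_def)
    qed
  qed
  have "\<forall>p\<in>P. \<exists>g n T. top_form g n T \<and> (\<forall>x\<in>?X. g x = p x) \<and> (\<exists>x\<in>?X. T x \<noteq> 0)"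
  proof
    fix p assume "p \<in> P"
    then show "\<exists>g n T. top_form g n T \<and> (\<forall>x\<in>?X. g x = p x) \<and> (\<exists>x\<in>?X. T x \<noteq> 0)"
      using P0(2) by (intro top_form_nonzero) (auto simp: P_def)
  qed
  then obtain G N T where "\<forall>p\<in>P. top_form (G p) (N p) (T p) \<and> (\<forall>x\<in>?X. G p x = p x) \<and> (\<exists>x\<in>?X. T p x \<noteq> 0)"
    unfolding bchoice_iff by (elim exE)
  then have GNT: "top_form (G p) (N p) (T p)" "\<And>x. x \<in> ?X \<Longrightarrow> G p x = p x" "\<exists>x\<in>?X. T p x \<noteq> 0"
    if "p \<in> P" for p using that by simp_all
  \<comment> \<open>The coordinate \<open>x k\<close> joins the top forms, so the direction found is
    also transversal to the base \<open>?B\<close>: every line meets it exactly once.\<close>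
  have "\<exists>x\<in>?X. \<forall>f\<in>insert (\<lambda>x. x k) (T ` P). f x \<noteq> 0"
  proof (rule polyfun_common_nonzero)
    show "insert (\<lambda>x. x k) (T ` P) \<subseteq> polyfun UNIV"
      using top_form_polyfun(2)[OF GNT(1)] polyfun.coord[of k UNIV] by auto
    fix f assume "f \<in> insert (\<lambda>x. x k) (T ` P)"
    then consider "f = (\<lambda>x. x k)" | p where "p \<in> P" "f = T p" by blast
    then show "\<exists>x\<in>?X. f x \<noteq> 0"
    proof cases
      case 1
      then show ?thesis using k by (intro bexI[of _ "\<lambda>i. if i = k then 1 else 0"]) (auto simp: coord_space_def)
    qed (use GNT(3) in simp)
  qed (use finP in simp)
  then obtain v where v: "v \<in> ?X" "v k \<noteq> 0" "\<And>p. p \<in> P \<Longrightarrow> T p v \<noteq> 0" by auto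
  have "\<forall>p\<in>P. \<exists>q. polycoeffs UNIV (N p) q \<and> (\<forall>y t. G p (line y v t) = poly (q y) t) \<and> (\<forall>y. coeff (q y) (N p) = T p v)"
    by (intro ballI top_form_line GNT(1))
  then obtain q where "\<forall>p\<in>P. polycoeffs UNIV (N p) (q p) \<and> (\<forall>y t. G p (line y v t) = poly (q p y) t) \<and>
      (\<forall>y. coeff (q p y) (N p) = T p v)"
    unfolding bchoice_iff by (elim exE)
  then have q: "polycoeffs UNIV (N p) (q p)" "G p (line y v t) = poly (q p y) t" "coeff (q p y) (N p) = T p v"
    if "p \<in> P" for p y t using that by simp_all
  define d where "d = (\<Sum>p\<in>P. N p)"
  \<comment> \<open>The roots of the product include those of every \<open>q p y\<close>, and its
    degree is \<open>d\<close> for all \<open>y\<close>. Hence the functions \<open>rho\<close> of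
    this single polynomial are continuous in \<open>y\<close> and cut every line at all sign
    changes.\<close>
  define Q where "Q y = (\<Prod>p\<in>P. q p y)" for y
  have Q_eq: "Q = (\<lambda>y. \<Prod>p\<in>P. q p y)" by (simp add: Q_def fun_eq_iff)
  have Q: "polycoeffs UNIV d Q" "coeff (Q y) d \<noteq> 0" for y
  proof -
    note prod = polycoeffs_prod[of P UNIV N q, OF finP q(1)]
    show "polycoeffs UNIV d Q" unfolding d_def Q_eq using prod by (rule conjunct1)
    have "coeff (Q y) d = (\<Prod>p\<in>P. coeff (q p y) (N p))"
      unfolding d_def Q_eq using prod by blast
    also have "\<dots> = (\<Prod>p\<in>P. T p v)" by (rule prod.cong) (simp_all add: q(3))
    finally show "coeff (Q y) d \<noteq> 0" using v(3) finP by (simp add: prod_zero_iff)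
  qed
  have degQ: "degree (Q y) = d" for y
    using Q(1) le_degree[OF Q(2)[of y]] by (simp add: polycoeffs_def antisym)
  have lineX: "line y v t \<in> ?X" if "y \<in> ?B" for y t
    by (rule line_coord_space) (use that v(1) in \<open>auto simp: coord_space_def\<close>)
  have pline: "p (line y v t) = poly (q p y) t" if "p \<in> P" "y \<in> ?B" for p y t
    using GNT(2)[OF that(1) lineX[OF that(2)]] q(2)[OF that(1)] by simp
  have "compact ((\<lambda>x. x k) ` S)"
    by (rule compact_continuous_image) (intro continuous_on_proj continuous_on_id S)+
  then obtain B where B: "\<And>x. x \<in> S \<Longrightarrow> \<bar>x k\<bar> \<le> B"
    using compact_imp_bounded[of "(\<lambda>x. x k) ` S"] unfolding bounded_iff by auto
  \<comment> \<open>The summand 1 makes the bound on the line parameter of points of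
    \<open>S\<close> strict, so that no such point sits at an end of the interval.\<close>
  define M where "M = \<bar>B\<bar> / \<bar>v k\<bar> + 1"
  have M: "M > 0" unfolding M_def by (intro add_nonneg_pos) auto
  have tM: "\<bar>x k / v k\<bar> < M" if "x \<in> S" for x
  proof -
    have "\<bar>x k\<bar> / \<bar>v k\<bar> \<le> \<bar>B\<bar> / \<bar>v k\<bar>" using B[OF that] by (intro divide_right_mono) auto
    then show ?thesis by (simp add: M_def)
  qed
  define fams where "fams = q ` P \<union> (\<lambda>j y. derivs (Q y) j) ` {..d}"
  have "sign_determined M UNIV fams"
  proof (rule sign_determined_polycoeffs[OF M])
    show "finite fams" using finP by (simp add: fams_def)
    fix f assume "f \<in> fams"
    then consider p where "p \<in> P" "f = q p" | j where "f = (\<lambda>y. derivs (Q y) j)"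
      by (auto simp: fams_def)
    then show "polycoeffs UNIV d f"
    proof cases
      case 1
      then have "N p \<le> d" unfolding d_def using finP by (intro member_le_sum) auto
      then show ?thesis using polycoeffs_mono[OF q(1)[OF 1(1)]] 1(2) by simp
    qed (use polycoeffs_derivs[OF Q(1)] in simp)
  qed
  then obtain P' where P': "finite P'" "P' \<subseteq> polyfun UNIV"
    "\<And>y y'. same_signs P' y y' \<Longrightarrow> \<exists>\<phi>. matches M \<phi> (fam fams y y')"
    unfolding sign_determined_def by blast
  define r where "r i y = rho M d (Q y) i" for i y
  have cont_r: "continuous_on A (r i)" for A i
    unfolding r_def
    by (rule continuous_on_rho[OF M])
      (auto intro!: degQ continuous_on_polyfun[of _ UNIV] polycoeffs_eval[OF polycoeffs_derivs[OF Q(1)]] polyfun.const)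
  have r_bounds: "r i y \<in> {-M..M}" for i y unfolding r_def by (rule rho_bounds[OF M degQ])
  have r_mono: "i \<le> j \<Longrightarrow> r i y \<le> r j y" for i j y
    using lift_Suc_mono_le[of "\<lambda>i. r i y" i j] rho_mono_no_root(1)[OF M degQ] by (simp add: r_def)
  have transport: "\<exists>\<phi>. matches M \<phi> (fam fams y y') \<and> (\<forall>i. \<phi> (r i y) = r i y') \<and>
      (\<forall>t\<in>{-M..M}. line y v t \<in> S \<longleftrightarrow> line y' v (\<phi> t) \<in> S)"
    if y: "y \<in> ?B" "y' \<in> ?B" and ss: "same_signs P' y y'" for y y'
  proof -
    obtain \<phi> where \<phi>: "matches M \<phi> (fam fams y y')" using P'(3)[OF ss] by blast
    have "\<phi> (r i y) = r i y'" for i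
      unfolding r_def
      by (rule rho_matches[OF M degQ degQ matches_subset[OF \<phi>]]) (auto simp: fam_def fams_def)
    moreover have "line y v t \<in> S \<longleftrightarrow> line y' v (\<phi> t) \<in> S" if t: "t \<in> {-M..M}" for t
    proof (rule Psgn[OF lineX[OF y(1)] lineX[OF y(2)]])
      fix p assume p: "p \<in> P"
      then have "(q p y, q p y') \<in> fam fams y y'" by (auto simp: fam_def fams_def)
      then have "sgn (poly (q p y) t) = sgn (poly (q p y') (\<phi> t))"
        using \<phi> t by (auto simp: matches_def)
      then show "sgn (p (line y v t)) = sgn (p (line y' v (\<phi> t)))" using pline p y by simp
    qed
    ultimately show ?thesis using \<phi> by blast
  qed
  \<comment> \<open>The base points over which the whole closed segment between two cut points lies
    in \<open>S\<close>. Parametrizing the segments by a fixed interval displays the set as an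
    intersection of closed preimages.\<close>
  define E where "E i j = {y \<in> ?B. \<forall>s\<in>{0..1}. line y v ((1 - s) * r i y + s * r j y) \<in> S}" for i j
  have E_iff: "y \<in> E i j \<longleftrightarrow> (\<forall>t\<in>{r i y..r j y}. line y v t \<in> S)" if "y \<in> ?B" "i \<le> j" for y i j
  proof -
    have "{r i y..r j y} = (\<lambda>s. (1 - s) * r i y + s * r j y) ` {0..1}"
    proof -
      have "{r i y..r j y} = {(1 - s) * r i y + s * r j y |s. 0 \<le> s \<and> s \<le> 1}"
        using r_mono[OF that(2), of y] closed_segment_eq_real_ivl[of "r i y" "r j y"]
        by (simp add: closed_segment_def)
      then show ?thesis by (simp only:) auto
    qed
    then show ?thesis using that(1) unfolding E_def by (simp only: mem_Collect_eq ball_simps simp_thms)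
  qed
  have E_compact: "compact (E i j)" for i j
  proof -
    have "E i j = ?B \<inter> (\<Inter>s\<in>{0..1}. (\<lambda>y. line y v ((1 - s) * r i y + s * r j y)) -` S)"
      by (auto simp: E_def)
    moreover have "closed ((\<lambda>y. line y v ((1 - s) * r i y + s * r j y)) -` S)" for s
    proof -
      have "continuous_on UNIV (\<lambda>y. line y v ((1 - s) * r i y + s * r j y))"
        by (intro continuous_on_line continuous_on_add continuous_on_mult continuous_on_const continuous_on_id cont_r)
      then show ?thesis using compact_imp_closed[OF S(1)] by (simp add: continuous_on_closed_vimage)
    qed
    ultimately have cl: "closed (E i j)" using closed_coord_space by (auto intro!: closed_Int closed_INT)
    \<comment> \<open>Compactness of the base set: it lies in the image of \<open>S\<close> under
      the projection along \<open>v\<close>.\<close>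
    have sub: "E i j \<subseteq> (\<lambda>x. line x v (- x k / v k)) ` S"
    proof
      fix y assume y: "y \<in> E i j"
      then have "line y v ((1 - 0) * r i y + 0 * r j y) \<in> S" unfolding E_def by fastforce
      then have x: "line y v (r i y) \<in> S" by simp
      have "y k = 0" using y by (simp add: E_def coord_space_def)
      then have "line (line y v (r i y)) v (- (line y v (r i y)) k / v k) = y"
        using v(2) by (simp add: line_line) (simp add: line_def)
      then show "y \<in> (\<lambda>x. line x v (- x k / v k)) ` S" using x by (rule image_eqI[OF sym])
    qed
    have "compact ((\<lambda>x. line x v (- x k / v k)) ` S)"
      by (rule compact_continuous_image)
        (intro continuous_on_line continuous_on_divide continuous_on_minus continuous_on_proj continuous_on_id
          continuous_on_const S ballI v)+
    from compact_Int_closed[OF this cl] show ?thesis using sub by (simp only: Int_absorb1)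
  qed
  have E_def': "definable (I - {k}) (E i j)" if ij: "i \<le> j" for i j
  proof (rule definable_I[OF _ P'(1,2)])
    show "E i j \<subseteq> ?B" by (auto simp: E_def)
    fix y y' assume y: "y \<in> ?B" "y' \<in> ?B" and "same_signs P' y y'"
    then obtain \<phi> where \<phi>: "matches M \<phi> (fam fams y y')" "\<And>i. \<phi> (r i y) = r i y'"
      "\<And>t. t \<in> {-M..M} \<Longrightarrow> line y v t \<in> S \<longleftrightarrow> line y' v (\<phi> t) \<in> S"
      using transport by blast
    have img: "\<phi> ` {-M..M} = {-M..M}" using \<phi>(1) by (simp add: matches_def)
    note le = matches_less_iff(2)[OF \<phi>(1)]
    have "(\<forall>t\<in>{r i y..r j y}. line y v t \<in> S) \<longleftrightarrow> (\<forall>t\<in>{r i y'..r j y'}. line y' v t \<in> S)"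
    proof
      assume L: "\<forall>t\<in>{r i y..r j y}. line y v t \<in> S"
      show "\<forall>t\<in>{r i y'..r j y'}. line y' v t \<in> S"
      proof
        fix t' assume t': "t' \<in> {r i y'..r j y'}"
        then have "t' \<in> \<phi> ` {-M..M}" unfolding img using r_bounds[of i y'] r_bounds[of j y'] by auto
        then obtain t where t: "t \<in> {-M..M}" "t' = \<phi> t" by blast
        then have "t \<in> {r i y..r j y}" using t' \<phi>(2)[symmetric] le[OF r_bounds t(1)] le[OF t(1) r_bounds] by auto
        then show "line y' v t' \<in> S" using L \<phi>(3) t by blast
      qed
    next
      assume L: "\<forall>t\<in>{r i y'..r j y'}. line y' v t \<in> S"
      show "\<forall>t\<in>{r i y..r j y}. line y v t \<in> S"
      proof
        fix t assume t: "t \<in> {r i y..r j y}"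
        then have tM: "t \<in> {-M..M}" using r_bounds[of i y] r_bounds[of j y] by auto
        then have "\<phi> t \<in> {r i y'..r j y'}" using t \<phi>(2)[symmetric] le[OF r_bounds tM] le[OF tM r_bounds] by auto
        then show "line y v t \<in> S" using L \<phi>(3) tM by blast
      qed
    qed
    then show "y \<in> E i j \<longleftrightarrow> y' \<in> E i j" using E_iff ij y by simp
  qed
  have le_def: "definable (I - {k}) {y \<in> ?B. r i y \<le> r j y}" for i j
  proof (rule definable_I[OF _ P'(1,2)])
    fix y y' assume y: "y \<in> ?B" "y' \<in> ?B" and "same_signs P' y y'"
    then obtain \<phi> where \<phi>: "matches M \<phi> (fam fams y y')" "\<And>i. \<phi> (r i y) = r i y'"
      using transport by blast
    show "y \<in> {y \<in> ?B. r i y \<le> r j y} \<longleftrightarrow> y' \<in> {y \<in> ?B. r i y \<le> r j y}"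
      using matches_less_iff(2)[OF \<phi>(1) r_bounds r_bounds, of i y j y] y unfolding \<phi>(2) by simp
  qed auto
  \<comment> \<open>The class for \<open>ANE_finite_Union\<close>. Arbitrary compact definable bases
    are allowed so that intersections stay inside: the cut points are ordered by their index, so the
    larger lower bound and the smaller upper bound are again among them.\<close>
  define R where "R Z \<longleftrightarrow> (\<exists>D i j. Z = piece k D (r i) (r j) \<and> compact D \<and> definable (I - {k}) D \<and>
      (\<forall>y\<in>D. r i y \<le> r j y))" for Z
  have RI: "R (piece k D (r i) (r j))" if "compact D" "definable (I - {k}) D" "\<And>y. y \<in> D \<Longrightarrow> r i y \<le> r j y" for D i j
    using that by (auto simp: R_def)
  have R1: "closed Z" if "R Z" for Z
  proof -
    obtain D i j where "Z = piece k D (r i) (r j)" "compact D" using \<open>R Z\<close> by (auto simp: R_def)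
    then show ?thesis using closed_piece[OF compact_imp_closed cont_r cont_r] by simp
  qed
  have R2: "ANE Z" if "R Z" for Z
  proof -
    obtain D i j where D: "Z = piece k D (r i) (r j)" "compact D" "definable (I - {k}) D" "\<forall>y\<in>D. r i y \<le> r j y"
      using \<open>R Z\<close> by (auto simp: R_def)
    have "y k = 0 \<and> r i y \<le> r j y" if "y \<in> D" for y
      using D that by (auto simp: definable_def coord_space_def)
    then show ?thesis unfolding D(1) by (intro ANE_piece IH[OF D(2,3)] cont_r)
  qed
  have R3: "R (Y \<inter> Z)" if "R Y" "R Z" for Y Z
  proof -
    obtain D i j where D: "Y = piece k D (r i) (r j)" "compact D" "definable (I - {k}) D"
      using \<open>R Y\<close> by (auto simp: R_def)
    obtain D' i' j' where D': "Z = piece k D' (r i') (r j')" "compact D'" "definable (I - {k}) D'"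
      using \<open>R Z\<close> by (auto simp: R_def)
    define D2 where "D2 = D \<inter> D' \<inter> {y \<in> ?B. r (max i i') y \<le> r (min j j') y}"
    have mx: "r (max i i') y = max (r i y) (r i' y)" and mn: "r (min j j') y = min (r j y) (r j' y)" for y
      using r_mono[of i i' y] r_mono[of i' i y] r_mono[of j j' y] r_mono[of j' j y]
      by (auto simp: max_def min_def)
    have sub: "D \<subseteq> ?B" using D(3) by (simp add: definable_def)
    have "Y \<inter> Z = piece k D2 (r (max i i')) (r (min j j'))"
    proof (rule Set.set_eqI)
      fix z
      have "z(k := 0) \<in> D \<Longrightarrow> z(k := 0) \<in> ?B" using sub by blast
      then show "z \<in> Y \<inter> Z \<longleftrightarrow> z \<in> piece k D2 (r (max i i')) (r (min j j'))"
        unfolding D(1) D'(1) D2_def piece_def mx mn by auto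
    qed
    moreover have "compact D2"
    proof -
      have "closed {y. r (max i i') y \<le> r (min j j') y}"
        using closed_Collect_le[OF cont_r cont_r] .
      from compact_Int_closed[OF compact_Int[OF D(2) D'(2)] this]
      have "compact (D \<inter> D' \<inter> {y. r (max i i') y \<le> r (min j j') y})" .
      moreover have "D \<inter> D' \<inter> {y. r (max i i') y \<le> r (min j j') y} = D2" using sub by (auto simp: D2_def)
      ultimately show ?thesis by simp
    qed
    moreover have "definable (I - {k}) D2"
      unfolding D2_def by (rule definable_Int[OF definable_Int[OF D(3) D'(3)] le_def])
    moreover have "\<And>y. y \<in> D2 \<Longrightarrow> r (max i i') y \<le> r (min j j') y" by (simp add: D2_def)
    ultimately show ?thesis using RI[of D2 "max i i'" "min j j'"] by simp
  qed
  \<comment> \<open>Graphs of the cut points and closed bands between consecutive ones. Graphs are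
    listed separately because a point of \<open>S\<close> on a cut need not belong to a band
    contained in \<open>S\<close>.\<close>
  define F where "F = (\<lambda>i. piece k (E i i) (r i) (r i)) ` {..Suc d} \<union>
    (\<lambda>i. piece k (E i (Suc i)) (r i) (r (Suc i))) ` {..d}"
  have ANE_F: "ANE (\<Union>F)"
  proof (rule ANE_finite_Union[of R])
    show "R Z" if "Z \<in> F" for Z
      using that E_compact E_def' r_mono by (auto simp: F_def intro!: RI)
  qed (use R1 R2 R3 in \<open>auto simp: F_def\<close>)
  \<comment> \<open>The coordinate change between a point and the pair of its base point and line
    parameter; the parameter is stored in coordinate \<open>k\<close>, which is free on the
    base.\<close>
  define p where "p z = line (z(k := 0)) v (z k)" for z
  define q' where "q' x = (line x v (- x k / v k))(k := x k / v k)" for x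
  show ?thesis
  proof (rule ANE_retract[OF ANE_F])
    show "continuous_on S q'"
      unfolding q'_def
      by (intro continuous_on_fun_upd continuous_on_line continuous_on_divide continuous_on_minus continuous_on_proj
        continuous_on_id continuous_on_const ballI v)
    show "continuous_on (\<Union>F) p"
      unfolding p_def
      by (intro continuous_on_fun_upd continuous_on_line continuous_on_proj continuous_on_id continuous_on_const)
    show "p ` \<Union>F \<subseteq> S"
    proof
      fix x assume "x \<in> p ` \<Union>F"
      then obtain z i j where z: "x = p z" "z \<in> piece k (E i j) (r i) (r j)" "i \<le> j" by (auto simp: F_def)
      then have "z(k := 0) \<in> E i j" "z(k := 0) \<in> ?B" by (auto simp: piece_def E_def)
      then show "x \<in> S" using E_iff[of "z(k := 0)" i j] z by (auto simp: piece_def p_def)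
    qed
    have q'0: "(q' x)(k := 0) = line x v (- x k / v k)" for x
      using v(2) by (auto simp: q'_def line_def)
    show "p (q' x) = x" for x
      unfolding p_def q'0 line_line by (simp add: q'_def line_0)
    show "q' ` S \<subseteq> \<Union>F"
    proof
      fix z assume "z \<in> q' ` S"
      then obtain x where x: "x \<in> S" "z = q' x" by blast
      define y t where "y = line x v (- x k / v k)" and "t = x k / v k"
      have z0: "z(k := 0) = y" "z k = t" using q'0 x by (simp_all add: y_def t_def q'_def)
      have "y k = 0" using v(2) by (simp add: y_def line_def)
      moreover have "y \<in> ?X" unfolding y_def by (rule line_coord_space) (use x SX v in auto)
      ultimately have yB: "y \<in> ?B" by (auto simp: coord_space_def)
      have lt: "line y v t = x" by (simp add: y_def t_def line_line line_0)
      have t: "-M < t" "t < M" using tM[OF x(1)] unfolding t_def by linarith+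
      show "z \<in> \<Union>F"
      proof (cases "\<exists>i\<le>Suc d. t = r i y")
        case True
        then obtain i where i: "i \<le> Suc d" "t = r i y" by blast
        then have "y \<in> E i i" using E_iff[OF yB, of i i] lt x(1) by simp
        then have "z \<in> piece k (E i i) (r i) (r i)" using z0 i by (simp add: piece_def)
        then show ?thesis using i by (auto simp: F_def)
      next
        case False
        define i where "i = Max {i. i \<le> Suc d \<and> r i y < t}"
        have r0: "r 0 y = -M" and rd: "r (Suc d) y = M" by (simp_all add: r_def rho_0 rho_gt)
        have "i \<in> {i. i \<le> Suc d \<and> r i y < t}"
          unfolding i_def by (rule Max_in) (use r0 t in auto)
        then have i: "i \<le> Suc d" "r i y < t" by auto
        have id: "i \<le> d" using i rd t by (cases "i = Suc d") auto
        have "\<not> r (Suc i) y < t"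
        proof
          assume "r (Suc i) y < t"
          then have "Suc i \<le> i" unfolding i_def using id by (intro Max_ge) (auto simp: i_def)
          then show False by simp
        qed
        moreover have "t \<noteq> r (Suc i) y" using False id by auto
        ultimately have ti: "t < r (Suc i) y" by simp
        have Q0: "Q y \<noteq> 0" using Q(2)[of y] by auto
        \<comment> \<open>No factor of \<open>Q\<close> vanishes strictly between the two cut
          points, so all signs are constant there and membership in \<open>S\<close> spreads from
          \<open>x\<close> to the whole open segment.\<close>
        have inner: "line y v u \<in> S" if u: "r i y < u" "u < r (Suc i) y" for u
        proof -
          have "x \<in> S \<longleftrightarrow> line y v u \<in> S"
          proof (rule Psgn)
            show "x \<in> ?X" "line y v u \<in> ?X" using x SX lineX[OF yB] by auto
            fix p assume p: "p \<in> P"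
            have "poly (q p y) w \<noteq> 0" if "r i y < w" "w < r (Suc i) y" for w
            proof -
              have "poly (Q y) w \<noteq> 0"
                using rho_mono_no_root(2)[OF M degQ _ _ Q0] that by (simp add: r_def)
              then show ?thesis using p finP by (simp add: Q_def poly_prod)
            qed
            then have "sgn (poly (q p y) t) = sgn (poly (q p y) u)"
              using poly_sgn_const[of "r i y" "r (Suc i) y"] i(2) ti u by blast
            then show "sgn (p x) = sgn (p (line y v u))" using pline[OF p yB] lt by metis
          qed
          then show ?thesis using x by simp
        qed
        \<comment> \<open>\<open>S\<close> is closed, so the ends of the segment follow; they are
          part of the closed band.\<close>
        have "line y v u \<in> S" if u: "u \<in> {r i y..r (Suc i) y}" for u
        proof -
          have "continuous_on UNIV (\<lambda>u. line y v u)"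
            by (intro continuous_on_line continuous_on_const continuous_on_id)
          then have cl: "closed ((\<lambda>u. line y v u) -` S)"
            using compact_imp_closed[OF S(1)] by (simp add: continuous_on_closed_vimage)
          have "closure {r i y<..<r (Suc i) y} \<subseteq> (\<lambda>u. line y v u) -` S"
            by (rule closure_minimal[OF _ cl]) (use inner in auto)
          then show ?thesis using u i ti by (auto simp: closure_greaterThanLessThan)
        qed
        then have "y \<in> E i (Suc i)" using E_iff[OF yB, of i "Suc i"] by simp
        then have "z \<in> piece k (E i (Suc i)) (r i) (r (Suc i))" using z0 i ti by (simp add: piece_def)
        then show ?thesis using id by (auto simp: F_def)
      qed
    qed
  qed
qed

theorem ANE_definable:
  assumes "finite I" "compact S" "definable I S"
  shows "ANE S"
  using assms
proof (induction I arbitrary: S rule: finite_induct)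
  case empty
  have "coord_space {} = {\<lambda>i. 0}" by (auto simp: coord_space_def)
  then have "S = {} \<or> S = {\<lambda>i. 0}" using empty by (auto simp: definable_def)
  then show ?case using ANE_empty ANE_singleton by auto
next
  case (insert k I)
  show ?case
  proof (rule ANE_definable_step[of k "insert k I"])
    show "ANE E" if "compact E" "definable (insert k I - {k}) E" for E
      using insert.IH[OF that(1)] that(2) insert.hyps(2) by simp
  qed (use insert.prems in auto)
qed

section \<open>Real algebraic sets\<close>

text \<open>The ideal generated by \<open>F\<close> in the ring of polynomial functions, built up as
  finite combinations.\<close>

inductive_set gideal :: "nat set \<Rightarrow> ((nat \<Rightarrow> real) \<Rightarrow> real) set \<Rightarrow> ((nat \<Rightarrow> real) \<Rightarrow> real) set"
  for I :: "nat set" and F :: "((nat \<Rightarrow> real) \<Rightarrow> real) set" where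
  zero: "(\<lambda>x. 0) \<in> gideal I F"
| step: "g \<in> gideal I F \<Longrightarrow> f \<in> F \<Longrightarrow> c \<in> polyfun I \<Longrightarrow> (\<lambda>x. c x * f x + g x) \<in> gideal I F"

lemma gideal_add:
  assumes "f \<in> gideal I F" "g \<in> gideal I F"
  shows "(\<lambda>x. f x + g x) \<in> gideal I F"
  using assms(1)
proof (induction rule: gideal.induct)
  case zero then show ?case using assms(2) by simp
next
  case (step h f c)
  from gideal.step[OF step.IH step.hyps(2,3)] show ?case by (simp add: add.assoc)
qed

lemma gideal_cmult:
  assumes "f \<in> gideal I F" "a \<in> polyfun I"
  shows "(\<lambda>x. a x * f x) \<in> gideal I F"
  using assms(1)
proof (induction rule: gideal.induct)
  case zero then show ?case using gideal.zero by simp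
next
  case (step h f c)
  from gideal.step[OF step.IH step.hyps(2) polyfun.mult[OF assms(2) step.hyps(3)]]
  show ?case by (simp add: algebra_simps)
qed

lemma gideal_superset: "f \<in> F \<Longrightarrow> f \<in> gideal I F"
  using gideal.step[OF gideal.zero _ polyfun.const[of 1], of f F I] by simp

lemma gideal_mono: "f \<in> gideal I F \<Longrightarrow> F \<subseteq> G \<Longrightarrow> f \<in> gideal I G"
  by (induction rule: gideal.induct) (auto intro: gideal.intros)

lemma gideal_trans: "f \<in> gideal I F \<Longrightarrow> (\<And>g. g \<in> F \<Longrightarrow> g \<in> gideal I G) \<Longrightarrow> f \<in> gideal I G"
proof (induction rule: gideal.induct)
  case zero show ?case by (rule gideal.zero)
next
  case (step h f c)
  show ?case by (rule gideal_add[OF gideal_cmult[OF step.prems[OF step.hyps(2)] step.hyps(3)] step.IH[OF step.prems]])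
qed

lemma gideal_finite: "f \<in> gideal I F \<Longrightarrow> \<exists>A. finite A \<and> A \<subseteq> F \<and> f \<in> gideal I A"
proof (induction rule: gideal.induct)
  case zero then show ?case using gideal.zero by (intro exI[of _ "{}"]) auto
next
  case (step h f c)
  then obtain A where A: "finite A" "A \<subseteq> F" "h \<in> gideal I A" by blast
  have "(\<lambda>x. c x * f x + h x) \<in> gideal I (insert f A)"
    by (rule gideal.step) (use gideal_mono[OF A(3), of "insert f A"] step.hyps in auto)
  then show ?case using A step.hyps(2) by (intro exI[of _ "insert f A"]) auto
qed

lemma gideal_finite_subset:
  assumes "finite A" "A \<subseteq> gideal I F"
  shows "\<exists>B. finite B \<and> B \<subseteq> F \<and> A \<subseteq> gideal I B"
  using assms
proof (induction A rule: finite_induct)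
  case (insert a A)
  then obtain B where B: "finite B" "B \<subseteq> F" "A \<subseteq> gideal I B" by auto
  obtain C where C: "finite C" "C \<subseteq> F" "a \<in> gideal I C" using gideal_finite[of a I F] insert.prems by auto
  have "insert a A \<subseteq> gideal I (B \<union> C)"
    using B(3) gideal_mono[OF C(3), of "B \<union> C"] gideal_mono[of _ I B "B \<union> C"] by auto
  then show ?case using B C by (intro exI[of _ "B \<union> C"]) auto
qed auto

lemma gideal_vanish: "f \<in> gideal I F \<Longrightarrow> (\<And>g. g \<in> F \<Longrightarrow> g x = 0) \<Longrightarrow> f x = 0"
  by (induction rule: gideal.induct) auto

definition noetherian :: "nat set \<Rightarrow> bool" where
  "noetherian I \<longleftrightarrow> (\<forall>F \<subseteq> polyfun I. \<exists>A. finite A \<and> A \<subseteq> F \<and> F \<subseteq> gideal I A)"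

text \<open>Dependent choice in which each new element may depend on the set of all earlier ones;
  this set is the state of the recursion.\<close>

lemma sequence_choice:
  assumes "\<And>A. finite A \<Longrightarrow> A \<subseteq> T \<Longrightarrow> \<exists>q\<in>T. P A q"
  shows "\<exists>f :: nat \<Rightarrow> 'a. \<forall>n. f n \<in> T \<and> P (f ` {..<n}) (f n)"
proof -
  have "\<exists>pick. \<forall>A. finite A \<and> A \<subseteq> T \<longrightarrow> pick A \<in> T \<and> P A (pick A)"
    by (rule choice) (use assms in blast)
  then obtain pick where pick: "\<And>A. finite A \<Longrightarrow> A \<subseteq> T \<Longrightarrow> pick A \<in> T \<and> P A (pick A)" by auto
  define L where "L = rec_nat {} (\<lambda>_ A. insert (pick A) A)"
  define f where "f n = pick (L n)" for n
  have L: "L 0 = {}" "L (Suc n) = insert (f n) (L n)" for n by (simp_all add: L_def f_def)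
  have LT: "finite (L n) \<and> L n \<subseteq> T" for n
    by (induction n) (use L pick in \<open>auto simp: f_def\<close>)
  have Lf: "L n = f ` {..<n}" for n
    by (induction n) (auto simp: L lessThan_Suc)
  have "f n \<in> T \<and> P (L n) (f n)" for n
    using pick[of "L n"] LT[of n] by (simp add: f_def)
  then show ?thesis unfolding Lf by (intro exI[of _ f] allI)
qed

lemma noetherian_sequence:
  fixes a :: "nat \<Rightarrow> (nat \<Rightarrow> real) \<Rightarrow> real"
  assumes "noetherian I" "\<And>n. a n \<in> polyfun I"
  shows "\<exists>m. a m \<in> gideal I (a ` {..<m})"
proof -
  have "range a \<subseteq> polyfun I" using assms(2) by auto
  then obtain A where A: "finite A" "A \<subseteq> range a" "range a \<subseteq> gideal I A"
    using assms(1) unfolding noetherian_def by meson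
  obtain C where C: "finite C" "A = a ` C" using finite_subset_image[OF A(1,2)] by auto
  obtain m where m: "C \<subseteq> {..<m}" using C(1) finite_nat_bounded by blast
  have "a m \<in> gideal I A" using A(3) by auto
  then have "a m \<in> gideal I (a ` {..<m})" by (rule gideal_mono) (use C(2) m in auto)
  then show ?thesis ..
qed

definition poly_in :: "nat set \<Rightarrow> nat \<Rightarrow> nat \<Rightarrow> ((nat \<Rightarrow> real) \<Rightarrow> real poly) \<Rightarrow> ((nat \<Rightarrow> real) \<Rightarrow> real) \<Rightarrow> bool" where
  "poly_in I k d q g \<longleftrightarrow> polycoeffs I d q \<and> (\<forall>x. g x = poly (q x) (x k))"

lemma poly_in_add: "poly_in I k d p f \<Longrightarrow> poly_in I k d q g \<Longrightarrow> poly_in I k d (\<lambda>x. p x + q x) (\<lambda>x. f x + g x)"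
  by (simp add: poly_in_def polycoeffs_add)

lemma poly_in_mult:
  "poly_in I k d p f \<Longrightarrow> poly_in I k e q g \<Longrightarrow> poly_in I k (d + e) (\<lambda>x. p x * q x) (\<lambda>x. f x * g x)"
  by (simp add: poly_in_def polycoeffs_mult)

lemma poly_in_mono: "poly_in I k d p f \<Longrightarrow> d \<le> e \<Longrightarrow> poly_in I k e p f"
  by (auto simp: poly_in_def intro: polycoeffs_mono)

lemma poly_in_monom:
  assumes "c \<in> polyfun I"
  shows "poly_in I k e (\<lambda>x. monom (c x) e) (\<lambda>x. c x * x k ^ e)"
  unfolding poly_in_def polycoeffs_def
proof (intro conjI allI)
  fix i show "(\<lambda>y. coeff (monom (c y) e) i) \<in> polyfun I"
    using assms polyfun.const by (cases "e = i") simp_all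
qed (simp_all add: degree_monom_le poly_monom)

lemma poly_in_exists: "g \<in> polyfun (insert k I) \<Longrightarrow> \<exists>d q. poly_in I k d q g"
proof (induction rule: polyfun.induct)
  case (coord i)
  show ?case
  proof (cases "i = k")
    case True
    then show ?thesis using poly_in_monom[OF polyfun.const[of 1 I], of k 1] by auto
  next
    case False
    then show ?thesis using poly_in_monom[OF polyfun.coord[of i I], of k 0] coord by auto
  qed
next
  case (const c)
  show ?case using poly_in_monom[OF polyfun.const[of c I], of k 0] by auto
next
  case (add f g)
  then obtain d p e q where "poly_in I k d p f" "poly_in I k e q g" by blast
  then have "poly_in I k (max d e) p f" "poly_in I k (max d e) q g" by (simp_all add: poly_in_mono)
  from poly_in_add[OF this] show ?case by (intro exI)
next
  case (mult f g)
  then obtain d p e q where "poly_in I k d p f" "poly_in I k e q g" by blast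
  from poly_in_mult[OF this] show ?case by (intro exI)
qed

lemma polyfun_mono: "f \<in> polyfun I \<Longrightarrow> I \<subseteq> J \<Longrightarrow> f \<in> polyfun J"
  by (induction rule: polyfun.induct) (auto intro: polyfun.intros)

text \<open>Hilbert's basis theorem: among the elements of an ideal not generated by the previous ones,
  choose each time one of minimal degree in the new variable. A relation between the leading
  coefficients lowers this degree.\<close>

lemma noetherian_insert:
  assumes I: "noetherian I"
  shows "noetherian (insert k I)"
proof (rule ccontr)
  let ?I = "insert k I"
  assume "\<not> noetherian ?I"
  then obtain F where "F \<subseteq> polyfun ?I" "\<not> (\<exists>A. finite A \<and> A \<subseteq> F \<and> F \<subseteq> gideal ?I A)"
    unfolding noetherian_def not_all not_imp by (elim exE conjE)
  then have F: "F \<subseteq> polyfun ?I" "\<And>A. finite A \<Longrightarrow> A \<subseteq> F \<Longrightarrow> \<not> F \<subseteq> gideal ?I A"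
    by simp_all
  define J where "J = gideal ?I F"
  have JR: "J \<subseteq> polyfun ?I"
  proof
    fix f assume "f \<in> J"
    then show "f \<in> polyfun ?I" unfolding J_def
    proof (induction rule: gideal.induct)
      case zero show ?case by (rule polyfun.const)
    next
      case (step h f c)
      show ?case
        by (rule polyfun.add[OF polyfun.mult[OF step.hyps(3) subsetD[OF F(1) step.hyps(2)]] step.IH])
    qed
  qed
  \<comment> \<open>The least bound over all representations as a polynomial in \<open>x k\<close>,
    so that the degree belongs to the function alone.\<close>
  define dg where "dg g = (LEAST d. \<exists>q. poly_in I k d q g)" for g
  have dg: "\<exists>q. poly_in I k (dg g) q g" if "g \<in> J" for g
    unfolding dg_def by (rule LeastI_ex) (rule poly_in_exists[OF subsetD[OF JR that]])
  have dg_le: "dg g \<le> d" if "poly_in I k d q g" for g d q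
    unfolding dg_def by (rule Least_le) (rule exI[of _ q], rule that)
  have ex: "\<exists>g\<in>J. g \<notin> gideal ?I A \<and> (\<forall>h\<in>J. h \<notin> gideal ?I A \<longrightarrow> dg g \<le> dg h)" if A: "finite A" "A \<subseteq> J" for A
  proof -
    obtain B where B: "finite B" "B \<subseteq> F" "A \<subseteq> gideal ?I B"
      using gideal_finite_subset[OF A[unfolded J_def]] by (elim exE conjE)
    obtain f where f: "f \<in> F" "f \<notin> gideal ?I B" using F(2)[OF B(1,2)] unfolding subset_iff not_all not_imp
      by (elim exE conjE)
    have "f \<in> J" unfolding J_def by (rule gideal_superset[OF f(1)])
    moreover have "f \<notin> gideal ?I A" using gideal_trans[of f ?I A B] f(2) subsetD[OF B(3)] by blast
    ultimately have "\<exists>g. g \<in> J \<and> g \<notin> gideal ?I A" by (intro exI conjI)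
    then obtain g0 where g0: "g0 \<in> J \<and> g0 \<notin> gideal ?I A" by (elim exE)
    obtain g where "(g \<in> J \<and> g \<notin> gideal ?I A) \<and>
        (\<forall>h. h \<in> J \<and> h \<notin> gideal ?I A \<longrightarrow> dg g \<le> dg h)"
      using ex_has_least_nat[of "\<lambda>g. g \<in> J \<and> g \<notin> gideal ?I A" g0 dg] g0 by simp (elim bexE exE, simp)
    then show ?thesis by (intro bexI[of _ g]) simp_all
  qed
  have "\<exists>g. \<forall>n::nat. g n \<in> J \<and> (g n \<notin> gideal ?I (g ` {..<n}) \<and>
      (\<forall>h\<in>J. h \<notin> gideal ?I (g ` {..<n}) \<longrightarrow> dg (g n) \<le> dg h))"
    by (rule sequence_choice[of J "\<lambda>A g. g \<notin> gideal ?I A \<and> (\<forall>h\<in>J. h \<notin> gideal ?I A \<longrightarrow> dg g \<le> dg h)"])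
      (rule ex)
  then obtain g where "\<forall>n::nat. g n \<in> J \<and> (g n \<notin> gideal ?I (g ` {..<n}) \<and>
      (\<forall>h\<in>J. h \<notin> gideal ?I (g ` {..<n}) \<longrightarrow> dg (g n) \<le> dg h))" by (elim exE)
  then have g: "g n \<in> J" "g n \<notin> gideal ?I (g ` {..<n})"
    "\<And>h. h \<in> J \<Longrightarrow> h \<notin> gideal ?I (g ` {..<n}) \<Longrightarrow> dg (g n) \<le> dg h" for n by simp_all
  have "\<forall>n. \<exists>q. poly_in I k (dg (g n)) q (g n)" using dg g(1) by simp
  then obtain q where "\<forall>n. poly_in I k (dg (g n)) (q n) (g n)" unfolding choice_iff by (elim exE)
  then have q: "poly_in I k (dg (g n)) (q n) (g n)" for n by (rule spec)
  define a where "a n x = coeff (q n x) (dg (g n))" for n x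
  have "a n \<in> polyfun I" for n
    using q[of n] polycoeffs_coeff[of I "dg (g n)" "q n" "dg (g n)"] unfolding a_def[abs_def] poly_in_def by simp
  then obtain m where m: "a m \<in> gideal I (a ` {..<m})" using noetherian_sequence[OF I] by blast
  define D where "D = dg (g m)"
  have dle: "dg (g i) \<le> D" if "i < m" for i
  proof -
    have "g m \<notin> gideal ?I (g ` {..<i})"
    proof
      assume "g m \<in> gideal ?I (g ` {..<i})"
      then have "g m \<in> gideal ?I (g ` {..<m})" by (rule gideal_mono) (use that in auto)
      then show False using g(2)[of m] by simp
    qed
    then show ?thesis unfolding D_def by (rule g(3)[OF g(1)])
  qed
  \<comment> \<open>A relation between leading coefficients lifts to the ideal: multiplying
    \<open>g i\<close> by the missing power of \<open>x k\<close> brings every term to the common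
    degree \<open>D\<close>.\<close>
  have comb: "\<exists>s p. s \<in> gideal ?I (g ` {..<m}) \<and> poly_in I k D p s \<and> (\<forall>x. coeff (p x) D = b x)"
    if "b \<in> gideal I (a ` {..<m})" for b
    using that
  proof (induction rule: gideal.induct)
    case zero
    show ?case
      by (intro exI[of _ "\<lambda>x. 0"] conjI gideal.zero)
        (auto simp: poly_in_def polycoeffs_def intro: polyfun.const)
  next
    case (step b f c)
    then obtain s p where s: "s \<in> gideal ?I (g ` {..<m})" "poly_in I k D p s" "\<And>x. coeff (p x) D = b x" by blast
    obtain i where i: "i < m" "f = a i" using step.hyps by blast
    define e where "e = D - dg (g i)"
    have e: "e + dg (g i) = D" using dle[OF i(1)] by (simp add: e_def)
    have mon: "poly_in I k e (\<lambda>x. monom (c x) e) (\<lambda>x. c x * x k ^ e)" by (rule poly_in_monom[OF step.hyps(3)])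
    have "(\<lambda>x. (c x * x k ^ e) * g i x + s x) \<in> gideal ?I (g ` {..<m})"
    proof (rule gideal.step[OF s(1)])
      show "(\<lambda>x. c x * x k ^ e) \<in> polyfun ?I"
        by (intro polyfun.mult polyfun_power polyfun.coord polyfun_mono[OF step.hyps(3)]) auto
    qed (use i in auto)
    moreover have "poly_in I k D (\<lambda>x. monom (c x) e * q i x + p x) (\<lambda>x. (c x * x k ^ e) * g i x + s x)"
      using poly_in_add[OF poly_in_mult[OF mon q[of i]]] s(2) unfolding e by blast
    moreover have "coeff (monom (c x) e * q i x + p x) D = c x * f x + b x" for x
    proof -
      have "coeff (monom (c x) e * q i x) (e + dg (g i)) = coeff (monom (c x) e) e * coeff (q i x) (dg (g i))"
        by (rule coeff_mult_top) (use q[of i] in \<open>auto simp: poly_in_def polycoeffs_def degree_monom_le\<close>)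
      then show ?thesis unfolding e by (simp add: s(3) i(2) a_def)
    qed
    ultimately show ?case by blast
  qed
  obtain s p where s: "s \<in> gideal ?I (g ` {..<m})" "poly_in I k D p s" "\<And>x. coeff (p x) D = a m x"
    using comb[OF m] by blast
  define h where "h x = g m x - s x" for x
  have h_eq: "h = (\<lambda>x. g m x + (-1) * s x)" by (simp add: h_def fun_eq_iff)
  have gm: "g m = (\<lambda>x. h x + s x)" by (simp add: h_def fun_eq_iff)
  have h_notin: "h \<notin> gideal ?I (g ` {..<m})"
    using g(2)[of m] gideal_add[OF _ s(1), of h] gm by auto
  have "s \<in> J" using gideal_trans[OF s(1), of F] g(1) by (auto simp: J_def)
  then have "h \<in> J" unfolding h_eq J_def
    using g(1)[of m] by (intro gideal_add gideal_cmult polyfun.const) (auto simp: J_def)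
  then have Dh: "D \<le> dg h" using g(3) h_notin by (simp add: D_def)
  define ph where "ph x = q m x - p x" for x
  have cf: "coeff (ph x) D = 0" for x by (simp add: ph_def s(3)) (simp add: a_def D_def)
  have deg: "degree (ph x) \<le> D" for x
    unfolding ph_def using q[of m] s(2) by (intro degree_diff_le) (auto simp: poly_in_def polycoeffs_def D_def)
  have hp: "h x = poly (ph x) (x k)" for x
    using q[of m] s(2) by (simp add: h_def ph_def poly_in_def)
  show False
  \<comment> \<open>For \<open>D = 0\<close> subtraction in the naturals gives no smaller degree;
    there the difference \<open>h\<close> is 0 outright and lies in the ideal.\<close>
  proof (cases "D = 0")
    case True
    have "ph x = 0" for x
    proof -
      have "degree (ph x) = 0" using deg[of x] True by simp
      then obtain c where "ph x = [:c:]" by (rule degree_eq_zeroE)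
      then show ?thesis using cf[of x] True by simp
    qed
    then have "h = (\<lambda>x. 0)" using hp by (simp add: fun_eq_iff)
    then show False using h_notin gideal.zero by simp
  next
    case False
    have "(\<lambda>x. coeff (ph x) i) \<in> polyfun I" for i
      unfolding ph_def coeff_diff using q[of m] s(2)
      by (intro polyfun_diff) (auto simp: poly_in_def polycoeffs_def)
    moreover have "degree (ph x) \<le> D - 1" for x
    proof (rule degree_le, intro allI impI)
      fix i assume "D - 1 < i"
      then have "i = D \<or> degree (ph x) < i" using deg[of x] False by auto
      then show "coeff (ph x) i = 0" using cf coeff_eq_0 by blast
    qed
    ultimately have "poly_in I k (D - 1) ph h" using hp by (simp add: poly_in_def polycoeffs_def)
    then have "dg h \<le> D - 1" by (rule dg_le)
    then show False using Dh False by simp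
  qed
qed

lemma noetherian_empty: "noetherian {}"
  unfolding noetherian_def
proof (intro allI impI)
  fix F assume F: "F \<subseteq> polyfun {}"
  have const: "\<exists>c. f = (\<lambda>x. c)" if "f \<in> polyfun {}" for f
    using that by (induction rule: polyfun.induct) (auto simp: fun_eq_iff)
  show "\<exists>A. finite A \<and> A \<subseteq> F \<and> F \<subseteq> gideal {} A"
  proof (cases "F \<subseteq> {\<lambda>x. 0}")
    case True
    then show ?thesis using gideal.zero by (intro exI[of _ "{}"]) auto
  next
    case False
    then obtain f where f: "f \<in> F" "f \<noteq> (\<lambda>x. 0)" by blast
    then obtain c where c: "f = (\<lambda>x. c)" "c \<noteq> 0" using const F by blast
    have "g \<in> gideal {} {f}" if g: "g \<in> F" for g
    proof -
      obtain b where b: "g = (\<lambda>x. b)" using const F g by blast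
      have "(\<lambda>x. (b / c) * f x) \<in> gideal {} {f}"
        by (intro gideal_cmult gideal_superset polyfun.const) simp
      then show ?thesis using b c by simp
    qed
    then show ?thesis using f by (intro exI[of _ "{f}"]) auto
  qed
qed

theorem Hilbert_basis: "finite I \<Longrightarrow> noetherian I"
  by (induction rule: finite_induct) (simp_all add: noetherian_empty noetherian_insert)

section \<open>Zero sets of arbitrary systems, and neighbourhood retractions\<close>

definition zero_set :: "nat set \<Rightarrow> ((nat \<Rightarrow> real) \<Rightarrow> real) set \<Rightarrow> (nat \<Rightarrow> real) set" where
  "zero_set I T = {x \<in> coord_space I. \<forall>q\<in>T. q x = 0}"

definition restr :: "nat set \<Rightarrow> (nat \<Rightarrow> real) \<Rightarrow> nat \<Rightarrow> real" where
  "restr I x = (\<lambda>i. if i \<in> I then x i else 0)"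

lemma polyfun_restr: "f \<in> polyfun UNIV \<Longrightarrow> (\<lambda>x. f (restr I x)) \<in> polyfun I"
proof (induction rule: polyfun.induct)
  case (coord i)
  show ?case by (cases "i \<in> I") (auto simp: restr_def intro: polyfun.coord polyfun.const)
qed (auto intro: polyfun.intros)

text \<open>In the application \<open>T\<close> is infinite, so finiteness has to come from
  Hilbert's basis theorem. Putting 0 for the variables outside \<open>I\<close> makes that theorem
  available in finitely many variables and changes nothing on \<open>coord_space I\<close>.\<close>

lemma definable_zero_set:
  assumes "finite I" "T \<subseteq> polyfun UNIV"
  shows "definable I (zero_set I T)"
proof -
  have restr: "restr I x = x" if "x \<in> coord_space I" for x
    using that by (auto simp: restr_def coord_space_def)
  define F where "F = (\<lambda>f x. f (restr I x)) ` T"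
  have "F \<subseteq> polyfun I" using assms(2) polyfun_restr by (auto simp: F_def)
  then obtain A where A: "finite A" "A \<subseteq> F" "F \<subseteq> gideal I A"
    using Hilbert_basis[OF assms(1)] unfolding noetherian_def by meson
  have iff: "x \<in> zero_set I T \<longleftrightarrow> (\<forall>f\<in>A. f x = 0)" if x: "x \<in> coord_space I" for x
  proof
    assume "x \<in> zero_set I T"
    then show "\<forall>f\<in>A. f x = 0" using A(2) restr[OF x] by (auto simp: zero_set_def F_def)
  next
    assume a: "\<forall>f\<in>A. f x = 0"
    have "q x = 0" if "q \<in> T" for q
    proof -
      have "(\<lambda>x. q (restr I x)) \<in> gideal I A" using A(3) that by (auto simp: F_def)
      from gideal_vanish[OF this, of x] show ?thesis using a restr[OF x] by simp
    qed
    then show "x \<in> zero_set I T" using x by (simp add: zero_set_def)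
  qed
  show ?thesis
  proof (rule definable_I[OF _ A(1)])
    show "zero_set I T \<subseteq> coord_space I" by (auto simp: zero_set_def)
    show "A \<subseteq> polyfun UNIV" using A(2) \<open>F \<subseteq> polyfun I\<close> polyfun_mono[of _ I UNIV] by auto
    fix x x' assume x: "x \<in> coord_space I" "x' \<in> coord_space I" "same_signs A x x'"
    then have "f x = 0 \<longleftrightarrow> f x' = 0" if "f \<in> A" for f
      using that by (metis same_signs_def sgn_eq_0_iff)
    then show "x \<in> zero_set I T \<longleftrightarrow> x' \<in> zero_set I T" using iff x by simp
  qed
qed

definition cube :: "nat set \<Rightarrow> real \<Rightarrow> (nat \<Rightarrow> real) set" where
  "cube I B = {x \<in> coord_space I. \<forall>i\<in>I. \<bar>x i\<bar> \<le> B}"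

lemma compact_cube: "compact (cube I B)"
proof -
  have eq: "cube I B = PiE UNIV (\<lambda>i. if i \<in> I then {-B..B} else {0})"
    by (auto simp: cube_def coord_space_def PiE_iff abs_le_iff split: if_splits) (metis minus_le_iff)+
  have "compactin (powertop_real UNIV) (cube I B)"
    unfolding eq compactin_PiE by auto
  then show ?thesis by (simp add: euclidean_product_topology)
qed

lemma definable_cube:
  assumes "finite I"
  shows "definable I (cube I B)"
proof (rule definable_I[of _ _ "(\<lambda>i x. x i - B) ` I \<union> (\<lambda>i x. x i - (-B)) ` I"])
  show "(\<lambda>i x. x i - B) ` I \<union> (\<lambda>i x. x i - (-B)) ` I \<subseteq> polyfun UNIV"
    by (auto intro!: polyfun_diff[of "\<lambda>x. x _" UNIV "\<lambda>x. B"] polyfun_diff[of "\<lambda>x. x _" UNIV "\<lambda>x. - B"] polyfun.coord polyfun.const simp del: diff_minus_eq_add)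
  fix x x' assume x: "x \<in> coord_space I" "x' \<in> coord_space I"
    and ss: "same_signs ((\<lambda>i x. x i - B) ` I \<union> (\<lambda>i x. x i - (-B)) ` I) x x'"
  have "\<bar>x i\<bar> \<le> B \<longleftrightarrow> \<bar>x' i\<bar> \<le> B" if "i \<in> I" for i
  proof -
    have "sgn (x i - B) = sgn (x' i - B)" "sgn (x i - (-B)) = sgn (x' i - (-B))"
      using bspec[OF ss[unfolded same_signs_def], of "\<lambda>x. x i - B"]
        bspec[OF ss[unfolded same_signs_def], of "\<lambda>x. x i - (-B)"] that by blast+
    then show ?thesis by (auto simp: sgn_if split: if_splits)
  qed
  then show "x \<in> cube I B \<longleftrightarrow> x' \<in> cube I B" using x by (auto simp: cube_def)
qed (use assms in \<open>auto simp: cube_def\<close>)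

lemma closed_zero_set: "T \<subseteq> polyfun UNIV \<Longrightarrow> closed (zero_set I T)"
proof -
  assume T: "T \<subseteq> polyfun UNIV"
  have "zero_set I T = coord_space I \<inter> (\<Inter>q\<in>T. {x. q x = 0})" by (auto simp: zero_set_def)
  moreover have "closed {x. q x = 0}" if "q \<in> T" for q
    by (rule closed_Collect_eq) (use T that continuous_on_polyfun in auto)
  ultimately show ?thesis using closed_coord_space by (auto intro!: closed_Int closed_INT)
qed

text \<open>Extends the identity of the compact cut-off zero set, taken relative to the union of
  this set with the cube of radius \<open>B'\<close>. Two radii are needed later because the
  segments leave the cube in which their ends lie.\<close>

lemma zero_set_retraction:
  assumes "finite I" "T \<subseteq> polyfun UNIV"
  obtains U r where "open U" "zero_set I T \<inter> cube I B \<subseteq> U" "continuous_on (cube I B' \<inter> U) r"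
    "r ` (cube I B' \<inter> U) \<subseteq> zero_set I T" "\<And>x. x \<in> zero_set I T \<inter> cube I B \<inter> cube I B' \<Longrightarrow> r x = x"
proof -
  let ?Z = "zero_set I T \<inter> cube I B"
  have cpt: "compact ?Z"
    using compact_Int_closed[OF compact_cube closed_zero_set[OF assms(2)]] by (simp add: Int_commute)
  have "ANE ?Z"
    by (rule ANE_definable[OF assms(1) cpt definable_Int]) (intro definable_zero_set definable_cube assms)+
  moreover have "closed ?Z" using cpt by (rule compact_imp_closed)
  moreover have "closed (cube I B' \<union> ?Z)" using compact_imp_closed[OF compact_cube] cpt compact_imp_closed by blast
  moreover have "(\<lambda>x. x) ` ?Z \<subseteq> ?Z" by simp
  ultimately obtain U r where U: "open U" "?Z \<subseteq> U" "continuous_on ((cube I B' \<union> ?Z) \<inter> U) r"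
    "r ` ((cube I B' \<union> ?Z) \<inter> U) \<subseteq> ?Z" "\<And>x. x \<in> ?Z \<Longrightarrow> r x = x"
    using ANE_D[of ?Z "cube I B' \<union> ?Z" ?Z "\<lambda>x. x", OF _ _ _ Un_upper2 continuous_on_id] by blast
  show ?thesis
  proof (rule that[OF U(1,2)])
    show "continuous_on (cube I B' \<inter> U) r" by (rule continuous_on_subset[OF U(3)]) auto
    show "r ` (cube I B' \<inter> U) \<subseteq> zero_set I T" using U(4) by blast
  qed (use U(5) in auto)
qed

section \<open>Compact polyhedra\<close>

definition geo :: "nat set set \<Rightarrow> (nat \<Rightarrow> real) set" where
  "geo K = {t. (\<forall>v. 0 \<le> t v) \<and> {v. t v \<noteq> 0} \<in> K \<and> (\<Sum>v | t v \<noteq> 0. t v) = 1}"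

lemma realization_eq: "realization K = top_of_set (geo K)"
  by (simp add: realization_def geo_def euclidean_product_topology)

lemma complex_bounded:
  assumes "finite_simplicial_complex K"
  shows "\<exists>n. \<Union>K \<subseteq> {..<n}"
proof -
  have "finite (\<Union>K)" using assms by (auto simp: finite_simplicial_complex_def)
  then show ?thesis by (rule finite_nat_bounded)
qed

lemma geo_iff:
  assumes "\<Union>K \<subseteq> {..<n}"
  shows "t \<in> geo K \<longleftrightarrow> (\<forall>v. 0 \<le> t v) \<and> {v. t v \<noteq> 0} \<in> K \<and> (\<Sum>v<n. t v) = 1"
proof -
  have "(\<Sum>v | t v \<noteq> 0. t v) = (\<Sum>v<n. t v)" if "{v. t v \<noteq> 0} \<in> K"
  proof (rule sum.mono_neutral_left)
    show "{v. t v \<noteq> 0} \<subseteq> {..<n}" using Union_upper[OF that] assms by (rule order_trans)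
  qed auto
  then show ?thesis unfolding geo_def mem_Collect_eq by metis
qed

lemma geoD:
  assumes "\<Union>K \<subseteq> {..<n}" "t \<in> geo K"
  shows "0 \<le> t v" "{v. t v \<noteq> 0} \<in> K" "(\<Sum>v<n. t v) = 1" "n \<le> v \<Longrightarrow> t v = 0"
proof -
  have *: "(\<forall>v. 0 \<le> t v) \<and> {v. t v \<noteq> 0} \<in> K \<and> (\<Sum>v<n. t v) = 1"
    using assms(2) unfolding geo_iff[OF assms(1)] .
  show "0 \<le> t v" "{v. t v \<noteq> 0} \<in> K" "(\<Sum>v<n. t v) = 1"
    using spec[OF conjunct1[OF *]] conjunct1[OF conjunct2[OF *]] conjunct2[OF conjunct2[OF *]] .
  have "{v. t v \<noteq> 0} \<subseteq> {..<n}"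
    using order_trans[OF Union_upper[OF conjunct1[OF conjunct2[OF *]]] assms(1)] .
  then show "t v = 0" if "n \<le> v"
    using that by (auto simp: subset_iff not_le[symmetric])
qed

lemma geoI:
  assumes "\<Union>K \<subseteq> {..<n}" "\<And>v. 0 \<le> t v" "{v. t v \<noteq> 0} \<in> K" "(\<Sum>v<n. t v) = 1"
  shows "t \<in> geo K"
  unfolding geo_iff[OF assms(1)] by (intro conjI allI assms(2-4))

lemma complex_face:
  assumes "finite_simplicial_complex K" "S \<in> K" "T \<subseteq> S" "T \<noteq> {}"
  shows "T \<in> K"
proof -
  have "\<forall>S\<in>K. \<forall>T. T \<noteq> {} \<and> T \<subseteq> S \<longrightarrow> T \<in> K"
    using assms(1) unfolding finite_simplicial_complex_def by (elim conjE)
  from bspec[OF this assms(2)] have "T \<noteq> {} \<and> T \<subseteq> S \<longrightarrow> T \<in> K" by (rule spec)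
  then show ?thesis using assms(3,4) by (elim mp) (intro conjI)
qed

lemma compact_geo:
  assumes K: "finite_simplicial_complex K"
  shows "compact (geo K)"
proof -
  obtain n where n: "\<Union>K \<subseteq> {..<n}" using complex_bounded[OF K] by (elim exE)
  define face where "face \<sigma> = cube \<sigma> 1 \<inter> ((\<Inter>v. {t. 0 \<le> t v}) \<inter> {t. (\<Sum>v<n. t v) = 1})" for \<sigma> :: "nat set"
  have "geo K = (\<Union>\<sigma>\<in>K. face \<sigma>)"
  proof (rule equalityI; rule subsetI)
    fix t assume t: "t \<in> geo K"
    note * = geoD[OF n t]
    have "t v \<le> 1" for v
    proof (cases "v < n")
      case True then show ?thesis using member_le_sum[of v "{..<n}" t] * by auto
    next
      case False
      then have "t v = 0" using *(4) by simp
      then show ?thesis by simp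
    qed
    then have "t \<in> face {v. t v \<noteq> 0}" using * by (auto simp: face_def cube_def coord_space_def)
    then show "t \<in> (\<Union>\<sigma>\<in>K. face \<sigma>)" using *(2) by blast
  next
    fix t assume "t \<in> (\<Union>\<sigma>\<in>K. face \<sigma>)"
    then obtain \<sigma> where \<sigma>: "\<sigma> \<in> K" "t \<in> face \<sigma>" by blast
    then have t: "\<And>v. 0 \<le> t v" "{v. t v \<noteq> 0} \<subseteq> \<sigma>" "(\<Sum>v<n. t v) = 1"
      by (auto simp: face_def cube_def coord_space_def)
    have "{v. t v \<noteq> 0} \<noteq> {}"
    proof
      assume "{v. t v \<noteq> 0} = {}"
      then have "t v = 0" for v by auto
      then show False using t(3) by simp
    qed
    then have "{v. t v \<noteq> 0} \<in> K" by (rule complex_face[OF K \<sigma>(1) t(2)])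
    from geoI[OF n t(1) this t(3)] show "t \<in> geo K" .
  qed
  moreover have "compact (face \<sigma>)" for \<sigma>
  proof -
    have "closed ((\<Inter>v. {t :: nat \<Rightarrow> real. 0 \<le> t v}) \<inter> {t. (\<Sum>v<n. t v) = 1})"
      by (intro closed_Int closed_INT ballI closed_Collect_le closed_Collect_eq continuous_on_const
        continuous_on_sum continuous_on_proj)
    from compact_Int_closed[OF compact_cube this] show ?thesis by (simp add: face_def)
  qed
  moreover have "finite K" using K by (simp add: finite_simplicial_complex_def)
  ultimately show ?thesis by (simp add: compact_UN)
qed

text \<open>The prism over \<open>K\<close>: the vertices \<open>2v\<close> and \<open>2v + 1\<close> are the copies of \<open>v\<close> at the bottom and
  at the top, and in a simplex no bottom vertex lies above a top vertex.\<close>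

definition prism :: "nat set set \<Rightarrow> nat set set" where
  "prism K = {\<tau>. \<tau> \<noteq> {} \<and> finite \<tau> \<and> {v. 2 * v \<in> \<tau> \<or> 2 * v + 1 \<in> \<tau>} \<in> K \<and>
     (\<forall>a b. 2 * a \<in> \<tau> \<longrightarrow> 2 * b + 1 \<in> \<tau> \<longrightarrow> a \<le> b)}"

lemma prism_bounded:
  assumes "\<Union>K \<subseteq> {..<n}"
  shows "\<Union>(prism K) \<subseteq> {..<2 * n}"
proof
  fix w assume "w \<in> \<Union>(prism K)"
  then obtain \<tau> where \<tau>: "w \<in> \<tau>" "{v. 2 * v \<in> \<tau> \<or> 2 * v + 1 \<in> \<tau>} \<in> K" by (auto simp: prism_def)
  have "2 * (w div 2) \<in> \<tau> \<or> 2 * (w div 2) + 1 \<in> \<tau>"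
    using \<tau>(1) by (cases "even w") (auto elim!: evenE oddE)
  then have "w div 2 \<in> \<Union>K" using \<tau>(2) by blast
  then have "w div 2 < n" using assms by blast
  then show "w \<in> {..<2 * n}" by simp
qed

lemma finite_simplicial_complex_prism:
  assumes K: "finite_simplicial_complex K"
  shows "finite_simplicial_complex (prism K)"
  unfolding finite_simplicial_complex_def
proof (intro conjI ballI allI impI; (elim conjE)?)
  obtain n where n: "\<Union>K \<subseteq> {..<n}" using complex_bounded[OF K] by (elim exE)
  have "prism K \<subseteq> Pow {..<2 * n}" using prism_bounded[OF n] by (simp add: subset_Pow_Union order_trans Union_subsetI Sup_le_iff) blast
  then show "finite (prism K)" by (rule finite_subset) simp
  fix S assume S: "S \<in> prism K"
  then show "finite S" "S \<noteq> {}" by (auto simp: prism_def)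
  fix T assume T: "T \<noteq> {}" "T \<subseteq> S"
  obtain w where w: "w \<in> T" using T by blast
  have "2 * (w div 2) \<in> T \<or> 2 * (w div 2) + 1 \<in> T"
    using w by (cases "even w") (auto elim!: evenE oddE)
  then have "{v. 2 * v \<in> T \<or> 2 * v + 1 \<in> T} \<noteq> {}" by blast
  moreover have "{v. 2 * v \<in> T \<or> 2 * v + 1 \<in> T} \<subseteq> {v. 2 * v \<in> S \<or> 2 * v + 1 \<in> S}" using T by blast
  moreover have "{v. 2 * v \<in> S \<or> 2 * v + 1 \<in> S} \<in> K" using S by (simp add: prism_def)
  ultimately have "{v. 2 * v \<in> T \<or> 2 * v + 1 \<in> T} \<in> K" using complex_face[OF K] by simp
  then show "T \<in> prism K" using S T finite_subset[of T S] by (auto simp: prism_def)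
qed

lemma sum_double: "(\<Sum>v<2 * n. t v) = (\<Sum>v<n. t (2 * v) + t (2 * v + 1))" for t :: "nat \<Rightarrow> real"
  by (induction n) (auto simp: algebra_simps)

text \<open>A point \<open>(c, s)\<close> of the product determines the coordinates of the top vertices: they are filled
  with the total weight \<open>s\<close> starting from the largest vertex.\<close>

lemma homeomorphic_prism:
  assumes K: "finite_simplicial_complex K"
  shows "prod_topology (realization K) (top_of_set {0..1::real}) homeomorphic_space realization (prism K)"
proof -
  obtain n where n: "\<Union>K \<subseteq> {..<n}" using complex_bounded[OF K] by (elim exE)
  note n2 = prism_bounded[OF n]
  \<comment> \<open>\<open>T c v\<close> is the total weight from vertex \<open>v\<close> upwards.
    The capped tail weights telescope, and \<open>b c s v\<close> is the share of \<open>v\<close>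
    when weight \<open>s\<close> is filled in from the top.\<close>
  define T where "T c v = (\<Sum>w=v..<n. c w)" for c :: "nat \<Rightarrow> real" and v
  define b where "b c s v = min s (T c v) - min s (T c (Suc v))" for c s v
  define f where "f t = ((\<lambda>v. t (2 * v) + t (2 * v + 1)), (\<Sum>v<n. t (2 * v + 1)))" for t :: "nat \<Rightarrow> real"
  define g where "g = (\<lambda>(c, s) w. if even w then c (w div 2) - b c s (w div 2) else b c s (w div 2))"
  have g: "g (c, s) (2 * v) = c v - b c s v" "g (c, s) (2 * v + 1) = b c s v" for c s v
    by (simp_all add: g_def)
  have T_Suc: "T c v = c v + T c (Suc v)" if "v < n" for c v
    using that by (simp add: T_def sum.atLeast_Suc_lessThan)
  have supp: "{v. 2 * v \<in> {w. t w \<noteq> 0} \<or> 2 * v + 1 \<in> {w. t w \<noteq> 0}} = {v. t (2 * v) + t (2 * v + 1) \<noteq> 0}"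
    if "\<And>v. 0 \<le> t v" for t :: "nat \<Rightarrow> real"
    using that by (auto simp: add_nonneg_eq_0_iff)
  have f_mem: "f t \<in> geo K \<times> {0..1}" if t: "t \<in> geo (prism K)" for t
  proof -
    note * = geoD[OF n2 t]
    have sum1: "(\<Sum>v<n. t (2 * v) + t (2 * v + 1)) = 1" using *(3) sum_double by simp
    have "{v. t (2 * v) + t (2 * v + 1) \<noteq> 0} \<in> K"
      using *(2) supp[of t, OF *(1)] by (simp add: prism_def)
    then have "(\<lambda>v. t (2 * v) + t (2 * v + 1)) \<in> geo K"
      by (intro geoI[OF n]) (use *(1) sum1 in auto)
    moreover have "(\<Sum>v<n. t (2 * v + 1)) \<le> (\<Sum>v<n. t (2 * v) + t (2 * v + 1))"
      by (rule sum_mono) (use *(1) in simp)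
    moreover have "0 \<le> (\<Sum>v<n. t (2 * v + 1))" by (rule sum_nonneg) (use *(1) in simp)
    ultimately show ?thesis using sum1 by (simp add: f_def)
  qed
  have props: "0 \<le> b c s v" "b c s v \<le> c v" "(\<Sum>v<n. b c s v) = s"
    "u < v \<Longrightarrow> b c s v < c v \<Longrightarrow> b c s u = 0"
    if c: "c \<in> geo K" and s: "s \<in> {0..1}" for c s u v
  proof -
    note * = geoD[OF n c]
    have c0: "c v = 0" if "n \<le> v" for v using *(4) that by simp
    have TS: "T c v = c v + T c (Suc v)" for v
    proof (cases "v < n")
      case False then show ?thesis using c0 by (simp add: T_def)
    qed (rule T_Suc)
    have anti: "T c v \<le> T c u" if "u \<le> v" for u v
      unfolding T_def by (rule sum_mono2) (use that *(1) in auto)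
    show "0 \<le> b c s v" "b c s v \<le> c v" using TS[of v] *(1)[of v] by (auto simp: b_def)
    have "(\<Sum>v<n. b c s v) = min s (T c 0) - min s (T c n)"
      unfolding b_def by (rule sum_lessThan_telescope')
    also have "\<dots> = s" using *(3) s by (simp add: T_def lessThan_atLeast0)
    finally show "(\<Sum>v<n. b c s v) = s" .
    show "b c s u = 0" if "u < v" "b c s v < c v"
    proof -
      have "s < T c v" using that(2) TS[of v] by (auto simp: b_def min_def split: if_splits)
      then have "s < T c (Suc u)" "s < T c u" using anti[of "Suc u" v] anti[of u v] that(1) by auto
      then show ?thesis by (simp add: b_def)
    qed
  qed
  have g_mem: "g (c, s) \<in> geo (prism K)" if c: "c \<in> geo K" and s: "s \<in> {0..1}" for c s
  proof -
    note * = geoD[OF n c]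
    have nonneg: "0 \<le> g (c, s) w" for w
      using props(1,2)[OF c s, of "w div 2"] by (simp add: g_def)
    have "{v. g (c, s) (2 * v) + g (c, s) (2 * v + 1) \<noteq> 0} \<in> K" unfolding g using *(2) by simp
    then have inK: "{v. 2 * v \<in> {w. g (c, s) w \<noteq> 0} \<or> 2 * v + 1 \<in> {w. g (c, s) w \<noteq> 0}} \<in> K"
      using supp[of "g (c, s)", OF nonneg] by simp
    have "{w. g (c, s) w \<noteq> 0} \<in> prism K"
      unfolding prism_def
    proof (intro CollectI conjI allI impI inK)
      have "{v. 2 * v \<in> {w. g (c, s) w \<noteq> 0} \<or> 2 * v + 1 \<in> {w. g (c, s) w \<noteq> 0}} \<noteq> {}"
        using inK K unfolding finite_simplicial_complex_def by (metis (no_types))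
      then show "{w. g (c, s) w \<noteq> 0} \<noteq> {}" by blast
      have "w < 2 * n" if "g (c, s) w \<noteq> 0" for w
      proof (rule ccontr)
        assume "\<not> w < 2 * n"
        then have "c (w div 2) = 0" using *(4) by simp
        then show False using that props(1,2)[OF c s, of "w div 2"] by (auto simp: g_def split: if_splits)
      qed
      then show "finite {w. g (c, s) w \<noteq> 0}" by (auto intro: finite_subset[of _ "{..<2 * n}"])
      fix u v assume "2 * u \<in> {w. g (c, s) w \<noteq> 0}" "2 * v + 1 \<in> {w. g (c, s) w \<noteq> 0}"
      then have "b c s u < c u" "b c s v \<noteq> 0" using g props(2)[OF c s, of u] by (auto simp: less_le)
      then show "u \<le> v" using props(4)[OF c s, of v u] by force
    qed
    moreover have "(\<Sum>w<2 * n. g (c, s) w) = 1"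
      unfolding sum_double g using *(3) by simp
    ultimately show ?thesis by (rule geoI[OF n2 nonneg])
  qed
  have fg: "f (g (c, s)) = (c, s)" if "c \<in> geo K" "s \<in> {0..1}" for c s
    unfolding f_def g using props(3)[OF that] by simp
  have gf: "g (f t) = t" if t: "t \<in> geo (prism K)" for t
  proof -
    note * = geoD[OF n2 t]
    define c s where "c v = t (2 * v) + t (2 * v + 1)" and "s = (\<Sum>v<n. t (2 * v + 1))" for v
    \<comment> \<open>The ordering in \<open>prism\<close> at work: if a bottom vertex from
      \<open>v\<close> on carries weight, all top weight sits at or above it, so the tail of the top
      weights is \<open>s\<close>. Otherwise the whole tail weight is on top.\<close>
    have H: "min s (T c v) = (\<Sum>w=v..<n. t (2 * w + 1))" for v
    proof (cases "\<exists>a\<in>{v..<n}. t (2 * a) \<noteq> 0")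
      case True
      then obtain a where a: "a \<in> {v..<n}" "t (2 * a) \<noteq> 0" by blast
      have z: "t (2 * w + 1) = 0" if "w < v" for w
      proof (rule ccontr)
        assume "t (2 * w + 1) \<noteq> 0"
        then have "a \<le> w" using *(2) a(2) by (auto simp: prism_def)
        then show False using that a(1) by simp
      qed
      have "(\<Sum>w=v..<n. t (2 * w + 1)) = s"
        unfolding s_def by (rule sum.mono_neutral_left) (use z in auto)
      moreover have "(\<Sum>w=v..<n. t (2 * w + 1)) \<le> T c v"
        unfolding T_def c_def by (rule sum_mono) (use *(1) in simp)
      ultimately show ?thesis by simp
    next
      case False
      then have "T c v = (\<Sum>w=v..<n. t (2 * w + 1))"
        unfolding T_def c_def by (intro sum.cong) auto
      moreover have "(\<Sum>w=v..<n. t (2 * w + 1)) \<le> s"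
        unfolding s_def by (rule sum_mono2) (use *(1) in auto)
      ultimately show ?thesis by simp
    qed
    have b: "b c s v = t (2 * v + 1)" for v
    proof (cases "v < n")
      case True then show ?thesis unfolding b_def H by (simp add: sum.atLeast_Suc_lessThan)
    next
      case False
      then have "t (2 * v + 1) = 0" using *(4) by simp
      then show ?thesis unfolding b_def H using False by simp
    qed
    have "g (c, s) w = t w" for w
      by (cases "even w") (auto elim!: evenE oddE simp: g_def b c_def)
    moreover have "f t = (c, s)" by (auto simp: f_def c_def s_def)
    ultimately show ?thesis by auto
  qed
  have cf: "continuous_on A f" for A
    unfolding f_def
    by (intro continuous_on_Pair continuous_on_coordinatewise_then_product continuous_on_add continuous_on_sum continuous_on_proj)
  have cg: "continuous_on A g" for A
  proof (rule continuous_on_coordinatewise_then_product)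
    fix w
    have p: "continuous_on A (\<lambda>x :: (nat \<Rightarrow> real) \<times> real. fst x v)" for v
      using continuous_on_compose2[OF continuous_on_proj[of UNIV v] continuous_on_fst[OF continuous_on_id]] by simp
    have bc: "continuous_on A (\<lambda>x. b (fst x) (snd x) v)" for v
      unfolding b_def T_def
      by (intro continuous_on_diff continuous_on_min continuous_on_sum p continuous_on_snd continuous_on_id)
    show "continuous_on A (\<lambda>x. g x w)"
    proof (cases "even w")
      case True
      then have "(\<lambda>x. g x w) = (\<lambda>x. fst x (w div 2) - b (fst x) (snd x) (w div 2))"
        by (simp add: g_def fun_eq_iff split_beta)
      then show ?thesis using continuous_on_diff[OF p[of "w div 2"] bc[of "w div 2"]] by (simp only:)
    next
      case False
      then have "(\<lambda>x. g x w) = (\<lambda>x. b (fst x) (snd x) (w div 2))"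
        by (simp add: g_def fun_eq_iff split_beta)
      then show ?thesis using bc[of "w div 2"] by (simp only:)
    qed
  qed
  have "homeomorphic_maps (top_of_set (geo K \<times> {0..1})) (top_of_set (geo (prism K))) g f"
    unfolding homeomorphic_maps_def
  proof (intro conjI ballI)
    show "continuous_map (top_of_set (geo K \<times> {0..1})) (top_of_set (geo (prism K))) g"
      using cg g_mem by (auto simp: image_subset_iff)
    show "continuous_map (top_of_set (geo (prism K))) (top_of_set (geo K \<times> {0..1})) f"
      using cf f_mem by (simp add: image_subset_iff Pi_iff)
    show "f (g x) = x" if "x \<in> topspace (top_of_set (geo K \<times> {0..1}))" for x
      using fg that by auto
    show "g (f t) = t" if "t \<in> topspace (top_of_set (geo (prism K)))" for t
      using gf that by simp
  qed
  then show ?thesis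
    unfolding realization_eq prod_topology_subtopology_eu homeomorphic_space_def by (intro exI)
qed

text \<open>The assumption on polyhedra speaks about a cylinder only once the cylinder itself is
  known to be an object of that category.\<close>

lemma is_polyhedron_cylinder:
  assumes "is_polyhedron D" and Y: "homeomorphic_map (prod_topology D (top_of_set {0..1::real})) Y \<theta>"
  shows "is_polyhedron Y"
proof -
  obtain K where K: "finite_simplicial_complex K" "D homeomorphic_space realization K"
    using assms(1) by (auto simp: is_polyhedron_def)
  have 1: "Y homeomorphic_space prod_topology D (top_of_set {0..1::real})"
    using homeomorphic_map_imp_homeomorphic_space[OF Y] homeomorphic_space_sym by blast
  have 2: "prod_topology D (top_of_set {0..1::real}) homeomorphic_space
      prod_topology (realization K) (top_of_set {0..1::real})"
    by (rule homeomorphic_space_prod_topology[OF K(2) homeomorphic_space_refl])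
  show ?thesis
    unfolding is_polyhedron_def
    using homeomorphic_space_trans[OF homeomorphic_space_trans[OF 1 2] homeomorphic_prism[OF K(1)]]
      finite_simplicial_complex_prism[OF K(1)] by (intro exI conjI)
qed

section \<open>Exact factorization of a compact set through a polyhedron\<close>

text \<open>The coordinatewise distance from \<open>Z\<close> to the part of a larger cube outside
  \<open>U\<close> attains a positive minimum. Only the coordinates in \<open>I\<close> enter, which
  is the form needed for a grid.\<close>

lemma uniform_neighbourhood:
  assumes I: "finite I" and Z: "compact Z" "Z \<subseteq> cube I B" and U: "open U" "Z \<subseteq> U"
  shows "\<exists>\<epsilon>>0. \<forall>z\<in>Z. \<forall>x\<in>coord_space I. (\<forall>i\<in>I. \<bar>x i - z i\<bar> \<le> \<epsilon>) \<longrightarrow> x \<in> U"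
proof -
  define C where "C = cube I (B + 1) - U"
  define m where "m p = (\<Sum>i\<in>I. \<bar>snd p i - fst p i\<bar>)" for p :: "(nat \<Rightarrow> real) \<times> (nat \<Rightarrow> real)"
  have cube: "x \<in> cube I (B + 1)" if "z \<in> Z" "x \<in> coord_space I" "\<And>i. i \<in> I \<Longrightarrow> \<bar>x i - z i\<bar> \<le> 1" for x z
  proof -
    have "\<bar>x i\<bar> \<le> B + 1" if "i \<in> I" for i
    proof -
      have "\<bar>z i\<bar> \<le> B" using \<open>z \<in> Z\<close> Z(2) that by (auto simp: cube_def)
      moreover have "\<bar>x i - z i\<bar> \<le> 1" using \<open>\<And>i. i \<in> I \<Longrightarrow> \<bar>x i - z i\<bar> \<le> 1\<close> that .
      ultimately show ?thesis by linarith
    qed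
    then show ?thesis using that(2) by (simp add: cube_def)
  qed
  show ?thesis
  proof (cases "Z = {} \<or> C = {}")
    case True
    have "x \<in> U" if "z \<in> Z" "x \<in> coord_space I" "\<forall>i\<in>I. \<bar>x i - z i\<bar> \<le> 1" for x z
      using cube[OF that(1,2)] that(1,3) True by (auto simp: C_def)
    then show ?thesis by (intro exI[of _ 1]) auto
  next
    case False
    have "compact C"
    proof -
      have "C = cube I (B + 1) \<inter> (- U)" by (auto simp: C_def)
      then show ?thesis using compact_Int_closed[OF compact_cube, of "- U" I "B + 1"] U(1) by (simp add: closed_Compl)
    qed
    then have cpt: "compact (Z \<times> C)" using Z(1) by (intro compact_Times)
    have pf: "continuous_on (Z \<times> C) (\<lambda>p. fst p i)" for i
      using continuous_on_compose2[OF continuous_on_proj[of UNIV i] continuous_on_fst[OF continuous_on_id], of "Z \<times> C"] by simp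
    have ps: "continuous_on (Z \<times> C) (\<lambda>p. snd p i)" for i
      using continuous_on_compose2[OF continuous_on_proj[of UNIV i] continuous_on_snd[OF continuous_on_id], of "Z \<times> C"] by simp
    have "continuous_on (Z \<times> C) m"
      unfolding m_def by (intro continuous_on_sum continuous_on_rabs continuous_on_diff pf ps)
    moreover have "Z \<times> C \<noteq> {}" using False by auto
    ultimately obtain p where p: "p \<in> Z \<times> C" "\<And>q. q \<in> Z \<times> C \<Longrightarrow> m p \<le> m q"
      using continuous_attains_inf[OF cpt] by blast
    have "m p > 0"
    proof (rule ccontr)
      assume "\<not> m p > 0"
      moreover have "m p \<ge> 0" unfolding m_def by (intro sum_nonneg) simp
      ultimately have "m p = 0" by simp
      then have eq: "snd p i = fst p i" if "i \<in> I" for i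
        using that I by (simp add: m_def sum_nonneg_eq_0_iff)
      have "snd p \<in> coord_space I" "fst p \<in> coord_space I" using p(1) Z(2) by (auto simp: C_def cube_def)
      then have "snd p = fst p" using eq by (fastforce simp: coord_space_def fun_eq_iff)
      then show False using p(1) U(2) by (auto simp: C_def)
    qed
    \<comment> \<open>At most 1, so that near points stay in the larger cube. Summed over
      \<open>I\<close> it remains below \<open>m p\<close>; adding 1 to the cardinality covers empty
      \<open>I\<close>.\<close>
    define \<epsilon> where "\<epsilon> = min 1 (m p / (2 * (real (card I) + 1)))"
    have e: "\<epsilon> > 0" "\<epsilon> \<le> 1" using \<open>m p > 0\<close> by (auto simp: \<epsilon>_def)
    have "x \<in> U" if z: "z \<in> Z" and x: "x \<in> coord_space I" "\<forall>i\<in>I. \<bar>x i - z i\<bar> \<le> \<epsilon>" for x z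
    proof (rule ccontr)
      assume "x \<notin> U"
      then have "x \<in> C" unfolding C_def using cube[OF z x(1)] x(2) e(2) by force
      then have "m p \<le> m (z, x)" using p(2)[of "(z, x)"] z by simp
      also have "\<dots> \<le> (\<Sum>i\<in>I. \<epsilon>)" unfolding m_def by (rule sum_mono) (use x(2) in simp)
      also have "\<dots> \<le> (real (card I) + 1) * (m p / (2 * (real (card I) + 1)))"
      proof -
        have "real (card I) * \<epsilon> \<le> (real (card I) + 1) * (m p / (2 * (real (card I) + 1)))"
          by (rule mult_mono) (use e(1) in \<open>auto simp: \<epsilon>_def\<close>)
        then show ?thesis by simp
      qed
      also have "\<dots> < m p" using \<open>m p > 0\<close> by (simp add: field_simps add_pos_nonneg)
      finally show False by simp
    qed
    then show ?thesis using e by blast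
  qed
qed

definition hat :: "real \<Rightarrow> real" where
  "hat a = max 0 (1 - \<bar>a\<bar>)"

text \<open>Linear interpolation at the integers: only the floor of \<open>y\<close> and its
  successor contribute. The successor is the reason for the upper limit \<open>L+1\<close>.\<close>

lemma hat_sum:
  fixes y :: real and L :: int
  assumes "\<bar>y\<bar> \<le> of_int L"
  shows "(\<Sum>k\<in>{-L..L+1}. hat (y - of_int k)) = 1"
    and "(\<Sum>k\<in>{-L..L+1}. hat (y - of_int k) * of_int k) = y"
proof -
  define f where "f = \<lfloor>y\<rfloor>"
  have f: "of_int f \<le> y" "y < of_int f + 1" by (auto simp: f_def)
  have sub: "{f, f + 1} \<subseteq> {-L..L+1}"
  proof -
    have "- L \<le> f" unfolding f_def using assms by (simp add: le_floor_iff)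
    moreover have "f \<le> L" unfolding f_def using assms by (simp add: floor_le_iff)
    ultimately show ?thesis by auto
  qed
  have zero: "hat (y - of_int k) = 0" if "k \<notin> {f, f + 1}" for k
  proof -
    have "k \<le> f - 1 \<or> k \<ge> f + 2" using that by auto
    then have "of_int k \<le> (of_int f :: real) - 1 \<or> (of_int k :: real) \<ge> of_int f + 2"
      by (metis of_int_1 of_int_add of_int_diff of_int_le_iff of_int_numeral)
    then show ?thesis using f by (auto simp: hat_def)
  qed
  have vals: "hat (y - of_int f) = 1 - (y - of_int f)" "hat (y - of_int (f + 1)) = y - of_int f"
    using f by (auto simp: hat_def)
  have red: "(\<Sum>k\<in>{-L..L+1}. hat (y - of_int k) * c k) =
      hat (y - of_int f) * c f + hat (y - of_int (f + 1)) * c (f + 1)" for c :: "int \<Rightarrow> real"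
  proof -
    have "(\<Sum>k\<in>{-L..L+1}. hat (y - of_int k) * c k) = (\<Sum>k\<in>{f, f + 1}. hat (y - of_int k) * c k)"
      by (rule sum.mono_neutral_right) (use sub zero in auto)
    then show ?thesis by simp
  qed
  show "(\<Sum>k\<in>{-L..L+1}. hat (y - of_int k)) = 1"
    using red[of "\<lambda>k. 1"] unfolding vals by simp
  show "(\<Sum>k\<in>{-L..L+1}. hat (y - of_int k) * of_int k) = y"
    using red[of of_int] unfolding vals by (simp add: algebra_simps)
qed

definition hats :: "nat set \<Rightarrow> (nat \<Rightarrow> int) \<Rightarrow> (nat \<Rightarrow> real) \<Rightarrow> real" where
  "hats I v y = (\<Prod>i\<in>I. hat (y i - of_int (v i)))"

text \<open>Products of the identities in one variable, multiplied out over the grid by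
  \<open>prod_sum_PiE\<close>.\<close>

lemma hats_sum:
  assumes I: "finite I" and y: "\<And>i. i \<in> I \<Longrightarrow> \<bar>y i\<bar> \<le> of_int L"
  shows "(\<Sum>v\<in>PiE I (\<lambda>_. {-L..L+1}). hats I v y) = 1"
    and "j \<in> I \<Longrightarrow> (\<Sum>v\<in>PiE I (\<lambda>_. {-L..L+1}). hats I v y * of_int (v j)) = y j"
proof -
  have "(\<Sum>v\<in>PiE I (\<lambda>_. {-L..L+1}). hats I v y) = (\<Prod>i\<in>I. \<Sum>k\<in>{-L..L+1}. hat (y i - of_int k))"
    unfolding hats_def by (rule prod_sum_PiE[symmetric]) (use I in auto)
  also have "\<dots> = 1" using hat_sum(1)[OF y] by simp
  finally show "(\<Sum>v\<in>PiE I (\<lambda>_. {-L..L+1}). hats I v y) = 1" .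
  assume j: "j \<in> I"
  \<comment> \<open>Moving the weight into the factor with index \<open>j\<close> leaves a pure
    product, which can be multiplied out as before.\<close>
  have "hats I v y * of_int (v j) = (\<Prod>i\<in>I. hat (y i - of_int (v i)) * (if i = j then of_int (v i) else 1))" for v
    unfolding hats_def prod.distrib using I j by (simp add: prod.delta)
  then have "(\<Sum>v\<in>PiE I (\<lambda>_. {-L..L+1}). hats I v y * of_int (v j)) =
      (\<Sum>v\<in>PiE I (\<lambda>_. {-L..L+1}). \<Prod>i\<in>I. hat (y i - of_int (v i)) * (if i = j then of_int (v i) else 1))"
    by simp
  also have "\<dots> = (\<Prod>i\<in>I. \<Sum>k\<in>{-L..L+1}. hat (y i - of_int k) * (if i = j then of_int k else 1))"
    by (rule prod_sum_PiE[symmetric, where f = "\<lambda>i k. hat (y i - of_int k) * (if i = j then of_int k else 1)"])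
      (use I in auto)
  also have "\<dots> = (\<Prod>i\<in>I. if i = j then y i else 1)"
  proof (rule prod.cong[OF refl])
    fix i assume "i \<in> I"
    then show "(\<Sum>k\<in>{-L..L+1}. hat (y i - of_int k) * (if i = j then of_int k else 1)) = (if i = j then y i else 1)"
      using hat_sum[OF y[of i]] by (cases "i = j") simp_all
  qed
  also have "\<dots> = y j" using I j by (simp add: prod.delta)
  finally show "(\<Sum>v\<in>PiE I (\<lambda>_. {-L..L+1}). hats I v y * of_int (v j)) = y j" .
qed

text \<open>The products of hat functions on a grid form a partition of unity that reproduces the
  coordinates exactly, so that \<open>h \<circ> g\<close> is the identity and not just close to it.\<close>

theorem polyhedral_factorization:
  assumes I: "finite I" and Z: "compact Z" "Z \<subseteq> cube I B" and U: "open U" "Z \<subseteq> U"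
  obtains K g h where "finite_simplicial_complex K" "continuous_on Z g" "g ` Z \<subseteq> geo K"
    "continuous_on (geo K) h" "h ` geo K \<subseteq> U \<inter> coord_space I" "\<And>z. z \<in> Z \<Longrightarrow> h (g z) = z"
proof -
  obtain \<epsilon> where e: "\<epsilon> > 0" "\<And>z x. z \<in> Z \<Longrightarrow> x \<in> coord_space I \<Longrightarrow> (\<forall>i\<in>I. \<bar>x i - z i\<bar> \<le> \<epsilon>) \<Longrightarrow> x \<in> U"
    using uniform_neighbourhood[OF I Z U] by blast
  define L where "L = \<lceil>B / \<epsilon>\<rceil>"
  define V where "V = PiE I (\<lambda>_. {-L..L+1})"
  have finV: "finite V" unfolding V_def by (rule finite_PiE) (use I in auto)
  define n where "n = card V"
  \<comment> \<open>Simplicial complexes have vertices in the naturals, so the grid points are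
    numbered.\<close>
  obtain b where b: "bij_betw b {0..<n} V" using ex_bij_betw_nat_finite[OF finV] unfolding n_def by blast
  have bsum: "(\<Sum>a<n. f (b a)) = (\<Sum>v\<in>V. f v)" for f :: "(nat \<Rightarrow> int) \<Rightarrow> real"
    using sum.reindex_bij_betw[OF b, of f] by (simp add: lessThan_atLeast0)
  define w where "w a = (\<lambda>i. if i \<in> I then \<epsilon> * of_int (b a i) else 0)" for a
  define g where "g x a = (if a < n then hats I (b a) (\<lambda>i. x i / \<epsilon>) else 0)" for x a
  define h where "h t i = (\<Sum>a<n. t a * w a i)" for t i
  \<comment> \<open>A simplex is a set of grid points that are all close to one point of
    \<open>Z\<close>. Boxes are convex, so every convex combination of its vertices is equally close
    to that point and lies in \<open>U\<close>.\<close>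
  define K where "K = {\<sigma>. \<sigma> \<noteq> {} \<and> \<sigma> \<subseteq> {..<n} \<and> (\<exists>z\<in>Z. \<forall>a\<in>\<sigma>. \<forall>i\<in>I. \<bar>w a i - z i\<bar> \<le> \<epsilon>)}"
  have Kn: "\<Union>K \<subseteq> {..<n}" by (auto simp: K_def)
  have yL: "\<bar>z i / \<epsilon>\<bar> \<le> of_int L" if "z \<in> Z" "i \<in> I" for z i
  proof -
    have "\<bar>z i\<bar> \<le> B" using that Z(2) by (auto simp: cube_def)
    then have "\<bar>z i\<bar> / \<epsilon> \<le> B / \<epsilon>" using e(1) by (simp add: divide_right_mono)
    moreover have "B / \<epsilon> \<le> of_int L" unfolding L_def by simp
    ultimately show ?thesis using e(1) by simp
  qed
  show ?thesis
  proof (rule that[of K g h])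
    show "finite_simplicial_complex K"
      unfolding finite_simplicial_complex_def
    proof (intro conjI ballI allI impI; (elim conjE)?)
      have "K \<subseteq> Pow {..<n}" by (auto simp: K_def)
      then show "finite K" by (rule finite_subset) simp
      fix S assume S: "S \<in> K"
      then show "finite S" "S \<noteq> {}" by (auto simp: K_def intro: finite_subset)
      fix T assume T: "T \<noteq> {}" "T \<subseteq> S"
      obtain z where z: "z \<in> Z" "\<And>a. a \<in> S \<Longrightarrow> \<forall>i\<in>I. \<bar>w a i - z i\<bar> \<le> \<epsilon>" using S by (auto simp: K_def)
      show "T \<in> K" unfolding K_def
        using T z(1) z(2)[OF subsetD[OF T(2)]] S by (auto simp: K_def)
    qed
    show "continuous_on Z g"
    proof (rule continuous_on_coordinatewise_then_product)
      fix a
      have "continuous_on Z (\<lambda>x. hats I (b a) (\<lambda>i. x i / \<epsilon>))"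
        unfolding hats_def hat_def
        by (intro continuous_on_prod continuous_on_max continuous_on_diff continuous_on_rabs continuous_on_const
          continuous_on_divide continuous_on_proj ballI) (use e(1) in auto)
      then show "continuous_on Z (\<lambda>x. g x a)" by (cases "a < n") (simp_all add: g_def)
    qed
    show "g ` Z \<subseteq> geo K"
    proof
      fix t assume "t \<in> g ` Z"
      then obtain z where z: "z \<in> Z" "t = g z" by blast
      show "t \<in> geo K"
      proof (rule geoI[OF Kn])
        show "0 \<le> t a" for a by (simp add: z g_def hats_def hat_def prod_nonneg)
        have "(\<Sum>a<n. t a) = (\<Sum>v\<in>V. hats I v (\<lambda>i. z i / \<epsilon>))"
          using bsum[of "\<lambda>v. hats I v (\<lambda>i. z i / \<epsilon>)"] by (simp add: z g_def)
        also have "\<dots> = 1" unfolding V_def by (rule hats_sum(1)[OF I yL[OF z(1)]])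
        finally show sum1: "(\<Sum>a<n. t a) = 1" .
        show "{a. t a \<noteq> 0} \<in> K"
          unfolding K_def
        proof (intro CollectI conjI bexI[OF _ z(1)] ballI)
          show "{a. t a \<noteq> 0} \<noteq> {}"
          proof
            assume "{a. t a \<noteq> 0} = {}"
            then have "t a = 0" for a by auto
            then show False using sum1 by simp
          qed
          show "{a. t a \<noteq> 0} \<subseteq> {..<n}" by (auto simp: z g_def split: if_splits)
          fix a i assume a: "a \<in> {a. t a \<noteq> 0}" and i: "i \<in> I"
          then have "hats I (b a) (\<lambda>i. z i / \<epsilon>) \<noteq> 0" by (auto simp: z g_def split: if_splits)
          then have "hat (z i / \<epsilon> - of_int (b a i)) \<noteq> 0" using I i by (auto simp: hats_def)
          then have "\<bar>z i / \<epsilon> - of_int (b a i)\<bar> < 1" by (auto simp: hat_def max_def split: if_splits)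
          then have "\<epsilon> * \<bar>z i / \<epsilon> - of_int (b a i)\<bar> \<le> \<epsilon> * 1" using e(1) by (intro mult_left_mono) auto
          moreover have "\<epsilon> * \<bar>z i / \<epsilon> - of_int (b a i)\<bar> = \<bar>\<epsilon> * (z i / \<epsilon> - of_int (b a i))\<bar>"
            using e(1) by (simp add: abs_mult)
          moreover have "\<epsilon> * (z i / \<epsilon> - of_int (b a i)) = z i - w a i"
            using e(1) i by (simp add: w_def field_simps)
          ultimately show "\<bar>w a i - z i\<bar> \<le> \<epsilon>" by simp
        qed
      qed
    qed
    show "continuous_on (geo K) h"
      unfolding h_def
      by (intro continuous_on_coordinatewise_then_product continuous_on_sum continuous_on_mult
        continuous_on_proj continuous_on_const)
    show "h ` geo K \<subseteq> U \<inter> coord_space I"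
    proof
      fix x assume "x \<in> h ` geo K"
      then obtain t where t: "t \<in> geo K" "x = h t" by blast
      note * = geoD[OF Kn t(1)]
      obtain z where z: "z \<in> Z" "\<And>a i. t a \<noteq> 0 \<Longrightarrow> i \<in> I \<Longrightarrow> \<bar>w a i - z i\<bar> \<le> \<epsilon>"
        using *(2) by (auto simp: K_def)
      have xc: "x \<in> coord_space I" by (simp add: coord_space_def t(2) h_def w_def)
      have "\<bar>x i - z i\<bar> \<le> \<epsilon>" if i: "i \<in> I" for i
      proof -
        have "x i - z i = (\<Sum>a<n. t a * w a i) - (\<Sum>a<n. t a) * z i" using *(3) by (simp add: t(2) h_def)
        also have "\<dots> = (\<Sum>a<n. t a * (w a i - z i))"
          by (simp add: right_diff_distrib sum_subtractf sum_distrib_right)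
        finally have "\<bar>x i - z i\<bar> \<le> (\<Sum>a<n. \<bar>t a * (w a i - z i)\<bar>)" by (simp add: sum_abs)
        also have "\<dots> \<le> (\<Sum>a<n. t a * \<epsilon>)"
        proof (rule sum_mono)
          fix a
          show "\<bar>t a * (w a i - z i)\<bar> \<le> t a * \<epsilon>"
          proof (cases "t a = 0")
            case False
            then show ?thesis using z(2)[OF False i] *(1)[of a] by (simp add: abs_mult mult_left_mono)
          qed simp
        qed
        also have "\<dots> = \<epsilon>" using *(3) by (simp add: sum_distrib_right[symmetric])
        finally show ?thesis .
      qed
      then show "x \<in> U \<inter> coord_space I" using e(2)[OF z(1) xc] xc by blast
    qed
    show "h (g z) = z" if z: "z \<in> Z" for z
    proof
      fix i
      show "h (g z) i = z i"
      proof (cases "i \<in> I")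
        case True
        have "h (g z) i = (\<Sum>a<n. hats I (b a) (\<lambda>i. z i / \<epsilon>) * of_int (b a i) * \<epsilon>)"
          using True by (simp add: h_def g_def w_def mult_ac)
        also have "\<dots> = (\<Sum>v\<in>V. hats I v (\<lambda>i. z i / \<epsilon>) * of_int (v i) * \<epsilon>)" by (rule bsum)
        also have "\<dots> = (\<Sum>v\<in>V. hats I v (\<lambda>i. z i / \<epsilon>) * of_int (v i)) * \<epsilon>" by (simp add: sum_distrib_right)
        also have "\<dots> = z i / \<epsilon> * \<epsilon>" unfolding V_def by (subst hats_sum(2)[OF I yL[OF z] True]) auto
        finally show ?thesis using e(1) by simp
      next
        case False
        then show ?thesis using z Z(2) by (auto simp: h_def w_def cube_def coord_space_def)
      qed
    qed
  qed
qed

section \<open>Filtered colimits of algebras and groups\<close>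

lemma mor_ab: "h \<in> Mor abelian_groups G H \<longleftrightarrow> h \<in> extensional (carrier G) \<and> h \<in> hom G H"
  by (simp add: abelian_groups_def)

lemma obj_ab: "G \<in> Obj abelian_groups \<longleftrightarrow> comm_group G"
  by (simp add: abelian_groups_def)

lemma comp_ab: "Comp abelian_groups G H K g f = compose (carrier G) g f"
  by (simp add: abelian_groups_def)

lemma mor_alg: "h \<in> Mor comm_algebras A B \<longleftrightarrow> h \<in> extensional (carrier A) \<and> h \<in> ring_hom A B \<and>
    (\<forall>c. \<forall>a\<in>carrier A. h (c \<odot>\<^bsub>A\<^esub> a) = c \<odot>\<^bsub>B\<^esub> h a)"
  by (simp add: comm_algebras_def)

lemma obj_alg: "A \<in> Obj comm_algebras \<longleftrightarrow> algebra complex_ring A"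
  by (simp add: comm_algebras_def)

lemma comp_alg: "Comp comm_algebras A B C g f = compose (carrier A) g f"
  by (simp add: comm_algebras_def)

lemma colimitD:
  assumes "is_colimit J C D L \<iota>" "is_cocone J C D M \<kappa>"
  shows "\<exists>u. u \<in> Mor C L M \<and> (\<forall>j\<in>Obj J. Comp C (omap D j) L M u (\<iota> j) = \<kappa> j)"
    and "\<lbrakk>u \<in> Mor C L M; \<forall>j\<in>Obj J. Comp C (omap D j) L M u (\<iota> j) = \<kappa> j;
      v \<in> Mor C L M; \<forall>j\<in>Obj J. Comp C (omap D j) L M v (\<iota> j) = \<kappa> j\<rbrakk> \<Longrightarrow> u = v"
proof -
  have *: "\<exists>!u. u \<in> Mor C L M \<and> (\<forall>j\<in>Obj J. Comp C (omap D j) L M u (\<iota> j) = \<kappa> j)"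
    using assms unfolding is_colimit_def by simp
  show "\<exists>u. u \<in> Mor C L M \<and> (\<forall>j\<in>Obj J. Comp C (omap D j) L M u (\<iota> j) = \<kappa> j)"
    using * by (rule ex1_implies_ex)
  show "u = v" if "u \<in> Mor C L M" "\<forall>j\<in>Obj J. Comp C (omap D j) L M u (\<iota> j) = \<kappa> j"
      "v \<in> Mor C L M" "\<forall>j\<in>Obj J. Comp C (omap D j) L M v (\<iota> j) = \<kappa> j"
    using ex1E[OF *] that by metis
qed

text \<open>The union of the images of the structure maps is a subgroup because the index category is
  filtered; the colimit maps to it, and this map followed by the inclusion is the identity.\<close>

lemma filtered_colimit_surj:
  assumes J: "is_filtered J" and D: "is_functor J abelian_groups D"
    and L: "is_colimit J abelian_groups D L \<iota>" and x: "x \<in> carrier L"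
  shows "\<exists>j\<in>Obj J. \<exists>b\<in>carrier (omap D j). \<iota> j b = x"
proof -
  define H where "H = (\<Union>j\<in>Obj J. \<iota> j ` carrier (omap D j))"
  have co: "is_cocone J abelian_groups D L \<iota>" using L by (simp add: is_colimit_def)
  have LG: "comm_group L" using co by (simp add: is_cocone_def obj_ab)
  interpret L: comm_group L by fact
  have hom: "\<iota> j \<in> hom (omap D j) L" "\<iota> j \<in> extensional (carrier (omap D j))" if "j \<in> Obj J" for j
    using co that by (auto simp: is_cocone_def mor_ab)
  have grp: "comm_group (omap D j)" if "j \<in> Obj J" for j
    using D that by (simp add: is_functor_def obj_ab)
  have trans: "\<exists>b\<in>carrier (omap D k). \<iota> k b = \<iota> i a"
    if "i \<in> Obj J" "k \<in> Obj J" "m \<in> Mor J i k" "a \<in> carrier (omap D i)" for i k m a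
  proof
    have "mmap D i k m \<in> hom (omap D i) (omap D k)"
      using D that by (simp add: is_functor_def mor_ab)
    then show "mmap D i k m a \<in> carrier (omap D k)" using that(4) by (auto simp: hom_def)
    have "compose (carrier (omap D i)) (\<iota> k) (mmap D i k m) = \<iota> i"
      using co that by (simp add: is_cocone_def comp_ab)
    then show "\<iota> k (mmap D i k m a) = \<iota> i a" using that(4) by (metis compose_eq)
  qed
  have sub: "subgroup H L"
  proof (rule L.subgroupI)
    show "H \<subseteq> carrier L" using hom by (auto simp: H_def hom_def)
    obtain j where j: "j \<in> Obj J" using J by (auto simp: is_filtered_def)
    interpret Gj: comm_group "omap D j" by (rule grp[OF j])
    show "H \<noteq> {}" using j Gj.one_closed by (auto simp: H_def)
    fix a assume "a \<in> H"
    then obtain i a' where a: "i \<in> Obj J" "a' \<in> carrier (omap D i)" "a = \<iota> i a'" by (auto simp: H_def)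
    interpret Gi: comm_group "omap D i" by (rule grp[OF a(1)])
    interpret hm: group_hom "omap D i" L "\<iota> i"
      using hom(1)[OF a(1)] by (simp add: group_hom_def group_hom_axioms_def Gi.is_group L.is_group)
    have "inv\<^bsub>L\<^esub> a = \<iota> i (inv\<^bsub>omap D i\<^esub> a')" using a by simp
    moreover have "inv\<^bsub>omap D i\<^esub> a' \<in> carrier (omap D i)" using a by simp
    ultimately show "inv\<^bsub>L\<^esub> a \<in> H" using a(1) by (auto simp: H_def)
    fix b assume "b \<in> H"
    then obtain k b' where b: "k \<in> Obj J" "b' \<in> carrier (omap D k)" "b = \<iota> k b'" by (auto simp: H_def)
    obtain l m1 m2 where l: "l \<in> Obj J" "m1 \<in> Mor J i l" "m2 \<in> Mor J k l"
      using J a(1) b(1) unfolding is_filtered_def by blast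
    obtain a2 where a2: "a2 \<in> carrier (omap D l)" "\<iota> l a2 = a" using trans[OF a(1) l(1,2) a(2)] a(3) by auto
    obtain b2 where b2: "b2 \<in> carrier (omap D l)" "\<iota> l b2 = b" using trans[OF b(1) l(1,3) b(2)] b(3) by auto
    interpret Gl: comm_group "omap D l" by (rule grp[OF l(1)])
    have "\<iota> l (a2 \<otimes>\<^bsub>omap D l\<^esub> b2) = a \<otimes>\<^bsub>L\<^esub> b" using hom(1)[OF l(1)] a2 b2 by (auto simp: hom_def)
    moreover have "a2 \<otimes>\<^bsub>omap D l\<^esub> b2 \<in> carrier (omap D l)" using a2 b2 by simp
    ultimately show "a \<otimes>\<^bsub>L\<^esub> b \<in> H" using l(1) by (force simp: H_def)
  qed
  let ?L = "L\<lparr>carrier := H\<rparr>"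
  have "comm_group ?L"
    by (rule group.group_comm_groupI[OF L.subgroup_imp_group[OF sub]])
      (use subgroup.mem_carrier[OF sub] L.m_comm in simp)
  have co': "is_cocone J abelian_groups D ?L \<iota>"
    unfolding is_cocone_def
  proof (intro conjI ballI)
    show "?L \<in> Obj abelian_groups" using \<open>comm_group ?L\<close> by (simp add: obj_ab)
    show "\<iota> j \<in> Mor abelian_groups (omap D j) ?L" if "j \<in> Obj J" for j
      using hom[OF that] that by (auto simp: mor_ab hom_def H_def)
    show "Comp abelian_groups (omap D i) (omap D j) ?L (\<iota> j) (mmap D i j a) = \<iota> i"
      if "i \<in> Obj J" "j \<in> Obj J" "a \<in> Mor J i j" for i j a
      using co that by (simp add: is_cocone_def comp_ab)
  qed
  obtain u where u: "u \<in> Mor abelian_groups L ?L" "\<forall>j\<in>Obj J. Comp abelian_groups (omap D j) L ?L u (\<iota> j) = \<iota> j"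
    using colimitD(1)[OF L co'] by blast
  have uL: "u \<in> Mor abelian_groups L L"
    using u(1) sub by (auto simp: mor_ab hom_def subgroup_def)
  have idL: "restrict id (carrier L) \<in> Mor abelian_groups L L"
    by (auto simp: mor_ab hom_def)
  have "u = restrict id (carrier L)"
  proof (rule colimitD(2)[OF L co uL _ idL])
    show "\<forall>j\<in>Obj J. Comp abelian_groups (omap D j) L L u (\<iota> j) = \<iota> j"
      using u(2) by (simp add: comp_ab)
    show "\<forall>j\<in>Obj J. Comp abelian_groups (omap D j) L L (restrict id (carrier L)) (\<iota> j) = \<iota> j"
    proof
      fix j assume "j \<in> Obj J"
      then show "Comp abelian_groups (omap D j) L L (restrict id (carrier L)) (\<iota> j) = \<iota> j"
        using hom[of j] by (auto simp: comp_ab compose_def hom_def fun_eq_iff extensional_def Pi_iff)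
    qed
  qed
  then have "u x = x" using x by simp
  moreover have "u x \<in> H" using u(1) x by (auto simp: mor_ab hom_def)
  ultimately show ?thesis by (auto simp: H_def)
qed

text \<open>The single arrow \<open>undefined\<close> is a placeholder for the inclusion of \<open>B i\<close> in \<open>B j\<close>.\<close>

definition incl_cat :: "'u set \<Rightarrow> ('u \<Rightarrow> 'a set) \<Rightarrow> ('u, 'u) cat" where
  "incl_cat S B = \<lparr>Obj = S, Mor = (\<lambda>i j. if B i \<subseteq> B j then {undefined} else {}),
     Ident = (\<lambda>_. undefined), Comp = (\<lambda>_ _ _ _ _. undefined)\<rparr>"

definition incl_diagram :: "'u calg \<Rightarrow> ('u \<Rightarrow> 'u set) \<Rightarrow> ('u, 'u, 'u calg, 'u \<Rightarrow> 'u) fctr" where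
  "incl_diagram A B = \<lparr>omap = (\<lambda>j. A\<lparr>carrier := B j\<rparr>), mmap = (\<lambda>i j a. restrict id (B i))\<rparr>"

lemma is_filtered_incl_cat:
  assumes "S \<noteq> {}" "\<And>i j. i \<in> S \<Longrightarrow> j \<in> S \<Longrightarrow> \<exists>k\<in>S. B i \<subseteq> B k \<and> B j \<subseteq> B k"
  shows "is_filtered (incl_cat S B)"
proof -
  have "is_category (incl_cat S B)"
    unfolding is_category_def incl_cat_def by (auto split: if_splits)
  moreover have "\<exists>k\<in>Obj (incl_cat S B). Mor (incl_cat S B) i k \<noteq> {} \<and> Mor (incl_cat S B) j k \<noteq> {}"
    if "i \<in> S" "j \<in> S" for i j
    using assms(2)[OF that] by (auto simp: incl_cat_def)
  moreover have "\<exists>k\<in>S. \<exists>c\<in>Mor (incl_cat S B) j k. True" if "j \<in> S" for j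
    using that by (auto simp: incl_cat_def)
  ultimately show ?thesis
    using assms(1) unfolding is_filtered_def by (simp add: incl_cat_def)
qed

text \<open>Compatible homomorphisms on the \<open>B j\<close> agree on overlaps, as two members lie
  in a third, and so glue to a map on the union. The index set is a subset of \<open>'u\<close>
  because that is where small index categories live.\<close>

lemma directed_union_colimit:
  fixes A :: "'u calg" and S :: "'u set"
  assumes A: "algebra complex_ring A"
    and B: "\<And>j. j \<in> S \<Longrightarrow> algebra complex_ring (A\<lparr>carrier := B j\<rparr>)" "\<And>j. j \<in> S \<Longrightarrow> B j \<subseteq> carrier A"
    and dir: "S \<noteq> {}" "\<And>i j. i \<in> S \<Longrightarrow> j \<in> S \<Longrightarrow> \<exists>k\<in>S. B i \<subseteq> B k \<and> B j \<subseteq> B k"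
    and un: "\<And>a. a \<in> carrier A \<Longrightarrow> \<exists>j\<in>S. a \<in> B j"
  shows "is_functor (incl_cat S B) comm_algebras (incl_diagram A B)"
    and "is_colimit (incl_cat S B) comm_algebras (incl_diagram A B) A (\<lambda>j. restrict id (B j))"
proof -
  have one: "\<one>\<^bsub>A\<^esub> \<in> B j" and
    closed: "a \<in> B j \<Longrightarrow> b \<in> B j \<Longrightarrow> a \<oplus>\<^bsub>A\<^esub> b \<in> B j" "a \<in> B j \<Longrightarrow> b \<in> B j \<Longrightarrow> a \<otimes>\<^bsub>A\<^esub> b \<in> B j"
    "a \<in> B j \<Longrightarrow> c \<odot>\<^bsub>A\<^esub> a \<in> B j"
    if "j \<in> S" for j a b c
  proof -
    interpret Bj: algebra complex_ring "A\<lparr>carrier := B j\<rparr>" by (rule B(1)[OF that])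
    show "\<one>\<^bsub>A\<^esub> \<in> B j" using Bj.one_closed by simp
    show "a \<in> B j \<Longrightarrow> b \<in> B j \<Longrightarrow> a \<oplus>\<^bsub>A\<^esub> b \<in> B j" using Bj.add.m_closed[of a b] by simp
    show "a \<in> B j \<Longrightarrow> b \<in> B j \<Longrightarrow> a \<otimes>\<^bsub>A\<^esub> b \<in> B j" using Bj.m_closed[of a b] by simp
    show "a \<in> B j \<Longrightarrow> c \<odot>\<^bsub>A\<^esub> a \<in> B j" using Bj.smult_closed[of c a] by (simp add: complex_ring_def)
  qed
  have incl: "restrict id (B i) \<in> Mor comm_algebras (A\<lparr>carrier := B i\<rparr>) (A\<lparr>carrier := C\<rparr>)"
    if "i \<in> S" "B i \<subseteq> C" for i C
    using that closed[OF that(1)] one[OF that(1)] by (auto simp: mor_alg ring_hom_def)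
  show "is_functor (incl_cat S B) comm_algebras (incl_diagram A B)"
    unfolding is_functor_def
  proof (intro conjI ballI)
    fix X assume "X \<in> Obj (incl_cat S B)"
    then have X: "X \<in> S" by (simp add: incl_cat_def)
    show "omap (incl_diagram A B) X \<in> Obj comm_algebras" using B(1)[OF X] by (simp add: incl_diagram_def obj_alg)
    show "mmap (incl_diagram A B) X X (Ident (incl_cat S B) X) = Ident comm_algebras (omap (incl_diagram A B) X)"
      by (simp add: incl_diagram_def comm_algebras_def)
    fix Y f assume "Y \<in> Obj (incl_cat S B)" and f: "f \<in> Mor (incl_cat S B) X Y"
    then show "mmap (incl_diagram A B) X Y f \<in> Mor comm_algebras (omap (incl_diagram A B) X) (omap (incl_diagram A B) Y)"
      using incl[OF X] by (auto simp: incl_cat_def incl_diagram_def split: if_splits)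
    fix Z g assume "Z \<in> Obj (incl_cat S B)" and g: "g \<in> Mor (incl_cat S B) Y Z"
    have "B X \<subseteq> B Y" using f by (auto simp: incl_cat_def split: if_splits)
    then show "mmap (incl_diagram A B) X Z (Comp (incl_cat S B) X Y Z g f) =
        Comp comm_algebras (omap (incl_diagram A B) X) (omap (incl_diagram A B) Y) (omap (incl_diagram A B) Z)
          (mmap (incl_diagram A B) Y Z g) (mmap (incl_diagram A B) X Y f)"
      by (auto simp: incl_diagram_def comp_alg compose_def fun_eq_iff)
  qed
  let ?C = "is_cocone (incl_cat S B) comm_algebras (incl_diagram A B)"
  have "?C A (\<lambda>j. restrict id (B j))"
    unfolding is_cocone_def
  proof (intro conjI ballI)
    show "A \<in> Obj comm_algebras" using A by (simp add: obj_alg)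
    show "restrict id (B j) \<in> Mor comm_algebras (omap (incl_diagram A B) j) A" if "j \<in> Obj (incl_cat S B)" for j
      using incl[of j "carrier A"] B(2)[of j] that by (simp add: incl_cat_def incl_diagram_def)
    show "Comp comm_algebras (omap (incl_diagram A B) i) (omap (incl_diagram A B) j) A
        (restrict id (B j)) (mmap (incl_diagram A B) i j a) = restrict id (B i)"
      if "i \<in> Obj (incl_cat S B)" "j \<in> Obj (incl_cat S B)" "a \<in> Mor (incl_cat S B) i j" for i j a
      using that by (auto simp: incl_diagram_def comp_alg compose_def fun_eq_iff incl_cat_def split: if_splits)
  qed
  moreover have "\<exists>!u. u \<in> Mor comm_algebras A M \<and> (\<forall>j\<in>Obj (incl_cat S B).
      Comp comm_algebras (omap (incl_diagram A B) j) A M u (restrict id (B j)) = \<kappa> j)"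
    if co: "?C M \<kappa>" for M \<kappa>
  proof -
    have \<kappa>: "\<kappa> j \<in> Mor comm_algebras (A\<lparr>carrier := B j\<rparr>) M" if "j \<in> S" for j
      using co that by (simp add: is_cocone_def incl_cat_def incl_diagram_def)
    have mono: "\<kappa> j a = \<kappa> i a" if "i \<in> S" "j \<in> S" "B i \<subseteq> B j" "a \<in> B i" for i j a
    proof -
      have "i \<in> Obj (incl_cat S B)" "j \<in> Obj (incl_cat S B)" "undefined \<in> Mor (incl_cat S B) i j"
        using that by (simp_all add: incl_cat_def)
      then have "Comp comm_algebras (omap (incl_diagram A B) i) (omap (incl_diagram A B) j) M
          (\<kappa> j) (mmap (incl_diagram A B) i j undefined) = \<kappa> i"
        using co unfolding is_cocone_def by blast
      then have "compose (B i) (\<kappa> j) (restrict id (B i)) = \<kappa> i"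
        by (simp add: incl_diagram_def comp_alg)
      then show ?thesis using that(4) by (metis compose_eq id_apply restrict_apply')
    qed
    have eq: "\<kappa> j a = \<kappa> i a" if ij: "i \<in> S" "j \<in> S" and a: "a \<in> B i" "a \<in> B j" for i j a
    proof -
      obtain k where "k \<in> S" "B i \<subseteq> B k" "B j \<subseteq> B k" using dir(2)[OF ij] by blast
      then show ?thesis using mono[of i k a] mono[of j k a] ij a by simp
    qed
    define u where "u a = (if a \<in> carrier A then \<kappa> (SOME j. j \<in> S \<and> a \<in> B j) a else undefined)" for a
    have u: "u a = \<kappa> j a" if "j \<in> S" "a \<in> B j" for j a
    proof -
      have "(SOME j. j \<in> S \<and> a \<in> B j) \<in> S \<and> a \<in> B (SOME j. j \<in> S \<and> a \<in> B j)"
        by (rule someI_ex) (use that in blast)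
      then show ?thesis using eq[of "SOME j. j \<in> S \<and> a \<in> B j" j a] that B(2) by (auto simp: u_def)
    qed
    have pair: "\<exists>k\<in>S. a \<in> B k \<and> b \<in> B k" if "a \<in> carrier A" "b \<in> carrier A" for a b
      using un[OF that(1)] un[OF that(2)] dir(2) by blast
    have um: "u \<in> Mor comm_algebras A M"
      unfolding mor_alg
    proof (intro conjI allI ballI)
      show "u \<in> extensional (carrier A)" by (simp add: u_def extensional_def)
      show "u \<in> ring_hom A M"
      proof (rule ring_hom_memI)
        fix a b assume a: "a \<in> carrier A" and b: "b \<in> carrier A"
        obtain k where k: "k \<in> S" "a \<in> B k" "b \<in> B k" using pair[OF a b] by blast
        have h: "\<kappa> k \<in> ring_hom (A\<lparr>carrier := B k\<rparr>) M" using \<kappa>[OF k(1)] by (simp add: mor_alg)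
        show "u (a \<otimes>\<^bsub>A\<^esub> b) = u a \<otimes>\<^bsub>M\<^esub> u b"
          using ring_hom_mult[OF h, of a b] u[OF k(1)] closed(2)[OF k(1)] k by simp
        show "u (a \<oplus>\<^bsub>A\<^esub> b) = u a \<oplus>\<^bsub>M\<^esub> u b"
          using ring_hom_add[OF h, of a b] u[OF k(1)] closed(1)[OF k(1)] k by simp
        show "u a \<in> carrier M"
          using ring_hom_closed[OF h, of a] u[OF k(1)] k by simp
      next
        obtain j where j: "j \<in> S" using dir(1) by blast
        have h: "\<kappa> j \<in> ring_hom (A\<lparr>carrier := B j\<rparr>) M" using \<kappa>[OF j] by (simp add: mor_alg)
        show "u \<one>\<^bsub>A\<^esub> = \<one>\<^bsub>M\<^esub>" using ring_hom_one[OF h] u[OF j one[OF j]] by simp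
      qed
      fix c a assume a: "a \<in> carrier A"
      obtain k where k: "k \<in> S" "a \<in> B k" using un[OF a] by blast
      then show "u (c \<odot>\<^bsub>A\<^esub> a) = c \<odot>\<^bsub>M\<^esub> u a"
        using \<kappa>[OF k(1)] u[OF k(1)] closed(3)[OF k(1)] by (simp add: mor_alg)
    qed
    show ?thesis
    proof (rule ex1I[of _ u])
      show "u \<in> Mor comm_algebras A M \<and> (\<forall>j\<in>Obj (incl_cat S B).
          Comp comm_algebras (omap (incl_diagram A B) j) A M u (restrict id (B j)) = \<kappa> j)"
      proof (intro conjI um ballI)
        fix j assume "j \<in> Obj (incl_cat S B)"
        then have j: "j \<in> S" by (simp add: incl_cat_def)
        have "\<kappa> j \<in> extensional (B j)" using \<kappa>[OF j] by (simp add: mor_alg)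
        then show "Comp comm_algebras (omap (incl_diagram A B) j) A M u (restrict id (B j)) = \<kappa> j"
          using u[OF j] by (auto simp: incl_diagram_def comp_alg compose_def fun_eq_iff extensional_def)
      qed
      fix v assume v: "v \<in> Mor comm_algebras A M \<and> (\<forall>j\<in>Obj (incl_cat S B).
          Comp comm_algebras (omap (incl_diagram A B) j) A M v (restrict id (B j)) = \<kappa> j)"
      show "v = u"
      proof (rule extensionalityI[of _ "carrier A"])
        show "v \<in> extensional (carrier A)" "u \<in> extensional (carrier A)" using v um by (auto simp: mor_alg)
        fix a assume "a \<in> carrier A"
        then obtain j where j: "j \<in> S" "a \<in> B j" using un by blast
        have "compose (B j) v (restrict id (B j)) = \<kappa> j"
          using v j(1) by (simp add: incl_cat_def incl_diagram_def comp_alg)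
        then have "v a = \<kappa> j a" using j(2) by (metis compose_eq id_apply restrict_apply')
        then show "v a = u a" using u[OF j] by simp
      qed
    qed
  qed
  ultimately show "is_colimit (incl_cat S B) comm_algebras (incl_diagram A B) A (\<lambda>j. restrict id (B j))"
    unfolding is_colimit_def by blast
qed

section \<open>Finitely generated algebras of functions\<close>

text \<open>Complex polynomials in real coordinates. Recording real and imaginary parts turns every
  complex relation into two real ones, to which real algebraic geometry applies.\<close>

definition cpoly :: "((nat \<Rightarrow> real) \<Rightarrow> complex) set" where
  "cpoly = {Q. (\<lambda>x. Re (Q x)) \<in> polyfun UNIV \<and> (\<lambda>x. Im (Q x)) \<in> polyfun UNIV}"

lemma cpoly_const: "(\<lambda>x. c) \<in> cpoly"
  by (simp add: cpoly_def polyfun.const)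

lemma cpoly_add: "P \<in> cpoly \<Longrightarrow> Q \<in> cpoly \<Longrightarrow> (\<lambda>x. P x + Q x) \<in> cpoly"
  by (simp add: cpoly_def polyfun.add)

lemma cpoly_diff: "P \<in> cpoly \<Longrightarrow> Q \<in> cpoly \<Longrightarrow> (\<lambda>x. P x - Q x) \<in> cpoly"
  by (simp add: cpoly_def polyfun_diff)

lemma cpoly_mult: "P \<in> cpoly \<Longrightarrow> Q \<in> cpoly \<Longrightarrow> (\<lambda>x. P x * Q x) \<in> cpoly"
  by (simp add: cpoly_def polyfun_diff polyfun.add polyfun.mult)

lemma polyfun_reindex: "p \<in> polyfun UNIV \<Longrightarrow> (\<lambda>x. p (\<lambda>i. x (\<sigma> i))) \<in> polyfun UNIV"
proof (induction rule: polyfun.induct)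
  case (coord i) show ?case by (rule polyfun.coord) simp
next
  case (const c) show ?case by (rule polyfun.const)
next
  case (add f g) from polyfun.add[OF add.IH] show ?case .
next
  case (mult f g) from polyfun.mult[OF mult.IH] show ?case .
qed

lemma cpoly_reindex: "Q \<in> cpoly \<Longrightarrow> (\<lambda>x. Q (\<lambda>i. x (\<sigma> i))) \<in> cpoly"
  using polyfun_reindex[of "\<lambda>x. Re (Q x)" \<sigma>] polyfun_reindex[of "\<lambda>x. Im (Q x)" \<sigma>] by (simp add: cpoly_def)

lemma continuous_on_cpoly: "Q \<in> cpoly \<Longrightarrow> continuous_on A Q"
proof -
  assume Q: "Q \<in> cpoly"
  have "continuous_on A (\<lambda>x. complex_of_real (Re (Q x)) + \<i> * complex_of_real (Im (Q x)))"
    using Q by (intro continuous_on_add continuous_on_mult continuous_on_const continuous_on_of_real)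
      (auto simp: cpoly_def intro: continuous_on_polyfun)
  then show ?thesis by (simp add: complex_eq[symmetric])
qed

definition coord_map :: "'x topology \<Rightarrow> nat \<Rightarrow> ('x \<Rightarrow> nat \<Rightarrow> real) \<Rightarrow> bool" where
  "coord_map Y n f \<longleftrightarrow> continuous_map Y euclidean f \<and> f ` topspace Y \<subseteq> coord_space {..<n}"

text \<open>The complex algebra generated by the coordinates of \<open>f\<close>.\<close>

definition gen_alg :: "'x topology \<Rightarrow> ('x \<Rightarrow> nat \<Rightarrow> real) \<Rightarrow> ('x \<Rightarrow> complex) set" where
  "gen_alg Y f = (\<lambda>Q. \<lambda>y\<in>topspace Y. Q (f y)) ` cpoly"

definition sub_alg :: "'x topology \<Rightarrow> ('x \<Rightarrow> nat \<Rightarrow> real) \<Rightarrow> ('x \<Rightarrow> complex) calg" where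
  "sub_alg Y f = (cont_algebra Y)\<lparr>carrier := gen_alg Y f\<rparr>"

lemma cont_algebra_cpoly:
  assumes "continuous_map Y euclidean f" "Q \<in> cpoly"
  shows "(\<lambda>y\<in>topspace Y. Q (f y)) \<in> carrier (cont_algebra Y)"
proof -
  have "continuous_map euclidean euclidean Q" using continuous_on_cpoly[OF assms(2), of UNIV] by simp
  from continuous_map_compose[OF assms(1) this] have "continuous_map Y euclidean (\<lambda>y\<in>topspace Y. Q (f y))"
    by (rule continuous_map_eq) simp
  then show ?thesis by (simp add: cont_algebra_def)
qed

lemma algebra_subalgebra:
  fixes A :: "'u calg"
  assumes A: "algebra complex_ring A" and B: "B \<subseteq> carrier A" and one: "\<one>\<^bsub>A\<^esub> \<in> B"
    and closed: "\<And>a b. a \<in> B \<Longrightarrow> b \<in> B \<Longrightarrow> a \<oplus>\<^bsub>A\<^esub> b \<in> B" "\<And>a b. a \<in> B \<Longrightarrow> b \<in> B \<Longrightarrow> a \<otimes>\<^bsub>A\<^esub> b \<in> B"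
      "\<And>c a. a \<in> B \<Longrightarrow> c \<odot>\<^bsub>A\<^esub> a \<in> B"
  shows "algebra complex_ring (A\<lparr>carrier := B\<rparr>)"
proof -
  interpret A: algebra complex_ring A by (rule A)
  have sub: "a \<in> carrier A" if "a \<in> B" for a using B that by blast
  have sm: "c \<odot>\<^bsub>A\<^esub> a \<in> carrier A" if "a \<in> B" for c a using closed(3) sub that by blast
  have m1: "(-1) \<odot>\<^bsub>A\<^esub> a \<oplus>\<^bsub>A\<^esub> a = \<zero>\<^bsub>A\<^esub>" if "a \<in> B" for a
  proof -
    have "(-1) \<odot>\<^bsub>A\<^esub> a \<oplus>\<^bsub>A\<^esub> 1 \<odot>\<^bsub>A\<^esub> a = (- 1 + 1) \<odot>\<^bsub>A\<^esub> a"
      using A.smult_l_distr[of "-1" 1 a] sub[OF that] by (simp add: complex_ring_def)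
    moreover have "1 \<odot>\<^bsub>A\<^esub> a = a" using A.smult_one[of a] sub[OF that] by (simp add: complex_ring_def)
    moreover have "0 \<odot>\<^bsub>A\<^esub> a = \<zero>\<^bsub>A\<^esub>" using A.smult_l_null[of a] sub[OF that] by (simp add: complex_ring_def)
    ultimately show ?thesis by simp
  qed
  have zero: "\<zero>\<^bsub>A\<^esub> \<in> B" using m1[OF one] closed(1)[OF closed(3)[OF one] one] by metis
  show ?thesis
  proof (rule algebraI)
    show "cring complex_ring" by (rule cring_complex_ring)
    show "cring (A\<lparr>carrier := B\<rparr>)"
    proof (rule cringI)
      show "abelian_group (A\<lparr>carrier := B\<rparr>)"
      proof (rule abelian_groupI)
        show "\<exists>b\<in>carrier (A\<lparr>carrier := B\<rparr>). b \<oplus>\<^bsub>A\<lparr>carrier := B\<rparr>\<^esub> a = \<zero>\<^bsub>A\<lparr>carrier := B\<rparr>\<^esub>"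
          if "a \<in> carrier (A\<lparr>carrier := B\<rparr>)" for a
          using m1[of a] closed(3)[of a "-1"] that by auto
      qed (use closed zero sub in \<open>auto simp: A.a_assoc A.a_comm A.a_lcomm\<close>)
      show "comm_monoid (A\<lparr>carrier := B\<rparr>)"
        by (rule comm_monoidI) (use closed one sub in \<open>auto simp: A.m_assoc A.m_comm A.m_lcomm\<close>)
    qed (use sub in \<open>auto simp: A.l_distr\<close>)
  next
    fix a b c d
    assume "a \<in> carrier complex_ring" "b \<in> carrier complex_ring"
      and x: "c \<in> carrier (A\<lparr>carrier := B\<rparr>)"
    then show "(a \<oplus>\<^bsub>complex_ring\<^esub> b) \<odot>\<^bsub>A\<lparr>carrier := B\<rparr>\<^esub> c = a \<odot>\<^bsub>A\<lparr>carrier := B\<rparr>\<^esub> c \<oplus>\<^bsub>A\<lparr>carrier := B\<rparr>\<^esub> b \<odot>\<^bsub>A\<lparr>carrier := B\<rparr>\<^esub> c"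
      using A.smult_l_distr[of a b c] sub by simp
    show "(a \<otimes>\<^bsub>complex_ring\<^esub> b) \<odot>\<^bsub>A\<lparr>carrier := B\<rparr>\<^esub> c = a \<odot>\<^bsub>A\<lparr>carrier := B\<rparr>\<^esub> (b \<odot>\<^bsub>A\<lparr>carrier := B\<rparr>\<^esub> c)"
      using A.smult_assoc1[of a b c] sub x by (simp add: complex_ring_def)
  next
    fix a x y
    assume "a \<in> carrier complex_ring" "x \<in> carrier (A\<lparr>carrier := B\<rparr>)" "y \<in> carrier (A\<lparr>carrier := B\<rparr>)"
    then show "a \<odot>\<^bsub>A\<lparr>carrier := B\<rparr>\<^esub> (x \<oplus>\<^bsub>A\<lparr>carrier := B\<rparr>\<^esub> y) = a \<odot>\<^bsub>A\<lparr>carrier := B\<rparr>\<^esub> x \<oplus>\<^bsub>A\<lparr>carrier := B\<rparr>\<^esub> a \<odot>\<^bsub>A\<lparr>carrier := B\<rparr>\<^esub> y"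
      "(a \<odot>\<^bsub>A\<lparr>carrier := B\<rparr>\<^esub> x) \<otimes>\<^bsub>A\<lparr>carrier := B\<rparr>\<^esub> y = a \<odot>\<^bsub>A\<lparr>carrier := B\<rparr>\<^esub> (x \<otimes>\<^bsub>A\<lparr>carrier := B\<rparr>\<^esub> y)"
      using A.smult_r_distr[of a x y] A.smult_assoc2[of a x y] sub by (simp_all add: complex_ring_def)
  qed (use closed sub A.smult_one in \<open>auto simp: complex_ring_def\<close>)
qed

lemma algebra_sub_alg:
  assumes f: "continuous_map Y euclidean f"
  shows "algebra complex_ring (sub_alg Y f)" "gen_alg Y f \<subseteq> carrier (cont_algebra Y)"
proof -
  show sub: "gen_alg Y f \<subseteq> carrier (cont_algebra Y)"
    using cont_algebra_cpoly[OF f] by (auto simp: gen_alg_def)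
  have mem: "(\<lambda>y\<in>topspace Y. Q (f y)) \<in> gen_alg Y f" if "Q \<in> cpoly" for Q
    using that by (auto simp: gen_alg_def)
  show "algebra complex_ring (sub_alg Y f)"
    unfolding sub_alg_def
  proof (rule algebra_subalgebra[OF algebra_cont_algebra sub])
    show "\<one>\<^bsub>cont_algebra Y\<^esub> \<in> gen_alg Y f"
      using mem[OF cpoly_const[of 1]] by (simp add: cont_algebra_def)
    fix a b assume "a \<in> gen_alg Y f" "b \<in> gen_alg Y f"
    then obtain P Q where PQ: "P \<in> cpoly" "Q \<in> cpoly" "a = (\<lambda>y\<in>topspace Y. P (f y))" "b = (\<lambda>y\<in>topspace Y. Q (f y))"
      by (auto simp: gen_alg_def)
    have "a \<oplus>\<^bsub>cont_algebra Y\<^esub> b = (\<lambda>y\<in>topspace Y. P (f y) + Q (f y))"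
      "a \<otimes>\<^bsub>cont_algebra Y\<^esub> b = (\<lambda>y\<in>topspace Y. P (f y) * Q (f y))"
      by (auto simp: PQ cont_algebra_def fun_eq_iff)
    then show "a \<oplus>\<^bsub>cont_algebra Y\<^esub> b \<in> gen_alg Y f" "a \<otimes>\<^bsub>cont_algebra Y\<^esub> b \<in> gen_alg Y f"
      using mem[OF cpoly_add[OF PQ(1,2)]] mem[OF cpoly_mult[OF PQ(1,2)]] by simp_all
  next
    fix c a assume "a \<in> gen_alg Y f"
    then obtain P where P: "P \<in> cpoly" "a = (\<lambda>y\<in>topspace Y. P (f y))" by (auto simp: gen_alg_def)
    have "c \<odot>\<^bsub>cont_algebra Y\<^esub> a = (\<lambda>y\<in>topspace Y. c * P (f y))" by (auto simp: P cont_algebra_def fun_eq_iff)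
    then show "c \<odot>\<^bsub>cont_algebra Y\<^esub> a \<in> gen_alg Y f" using mem[OF cpoly_mult[OF cpoly_const P(1), of c]] by simp
  qed
qed

section \<open>Evaluation at points of the Zariski closure\<close>

definition zariski_closure :: "'x topology \<Rightarrow> ('x \<Rightarrow> nat \<Rightarrow> real) \<Rightarrow> nat \<Rightarrow> (nat \<Rightarrow> real) set" where
  "zariski_closure Y f n = zero_set {..<n} {q \<in> polyfun UNIV. \<forall>y\<in>topspace Y. q (f y) = 0}"

text \<open>Substitution of \<open>k\<close> for \<open>f\<close> in a polynomial expression. The
  representing polynomial is chosen arbitrarily; \<open>ev_eq\<close> shows when the choice is
  irrelevant.\<close>

definition ev :: "'x topology \<Rightarrow> ('x \<Rightarrow> nat \<Rightarrow> real) \<Rightarrow> 'x topology \<Rightarrow> ('x \<Rightarrow> nat \<Rightarrow> real) \<Rightarrow>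
    ('x \<Rightarrow> complex) \<Rightarrow> ('x \<Rightarrow> complex)" where
  "ev Y f T k = (\<lambda>a\<in>gen_alg Y f. \<lambda>t\<in>topspace T.
     (SOME Q. Q \<in> cpoly \<and> a = (\<lambda>y\<in>topspace Y. Q (f y))) (k t))"

text \<open>Two representatives agree on the image of \<open>f\<close>, so the real and imaginary
  parts of their difference are relations and vanish on the Zariski closure, where \<open>k\<close>
  takes its values.\<close>

lemma ev_eq:
  assumes k: "k ` topspace T \<subseteq> zariski_closure Y f n" and Q: "Q \<in> cpoly"
  shows "ev Y f T k (\<lambda>y\<in>topspace Y. Q (f y)) = (\<lambda>t\<in>topspace T. Q (k t))"
proof -
  let ?a = "\<lambda>y\<in>topspace Y. Q (f y)"
  define R where "R = (SOME Q. Q \<in> cpoly \<and> ?a = (\<lambda>y\<in>topspace Y. Q (f y)))"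
  have "R \<in> cpoly \<and> ?a = (\<lambda>y\<in>topspace Y. R (f y))"
    unfolding R_def by (rule someI[of _ Q]) (use Q in simp)
  then have R: "R \<in> cpoly" "?a = (\<lambda>y\<in>topspace Y. R (f y))" by blast+
  have RQ: "R (f y) = Q (f y)" if "y \<in> topspace Y" for y
    using fun_cong[OF R(2), of y] that by simp
  have "R (k t) = Q (k t)" if t: "t \<in> topspace T" for t
  proof -
    have "k t \<in> zariski_closure Y f n" using k t by blast
    moreover have "(\<lambda>x. Re (R x - Q x)) \<in> polyfun UNIV" "(\<lambda>x. Im (R x - Q x)) \<in> polyfun UNIV"
      using cpoly_diff[OF R(1) Q] by (simp_all add: cpoly_def)
    ultimately have "Re (R (k t) - Q (k t)) = 0" "Im (R (k t) - Q (k t)) = 0"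
      using RQ unfolding zariski_closure_def zero_set_def by auto
    then show ?thesis by (simp add: complex_eq_iff)
  qed
  then have "(\<lambda>t\<in>topspace T. R (k t)) = (\<lambda>t\<in>topspace T. Q (k t))" by (auto simp: fun_eq_iff)
  moreover have "?a \<in> gen_alg Y f" using Q by (auto simp: gen_alg_def)
  ultimately show ?thesis by (simp add: ev_def R_def[symmetric])
qed

lemma ev_mor:
  assumes f: "continuous_map Y euclidean f" and k: "k ` topspace T \<subseteq> zariski_closure Y f n" "continuous_map T euclidean k"
  shows "ev Y f T k \<in> Mor comm_algebras (sub_alg Y f) (cont_algebra T)"
proof -
  note e = ev_eq[OF k(1)]
  have obt: "\<exists>Q\<in>cpoly. a = (\<lambda>y\<in>topspace Y. Q (f y))" if "a \<in> gen_alg Y f" for a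
    using that by (auto simp: gen_alg_def)
  have ops: "(\<lambda>y\<in>topspace Z. P (g y)) \<oplus>\<^bsub>cont_algebra Z\<^esub> (\<lambda>y\<in>topspace Z. Q (g y)) = (\<lambda>y\<in>topspace Z. P (g y) + Q (g y))"
      "(\<lambda>y\<in>topspace Z. P (g y)) \<otimes>\<^bsub>cont_algebra Z\<^esub> (\<lambda>y\<in>topspace Z. Q (g y)) = (\<lambda>y\<in>topspace Z. P (g y) * Q (g y))"
      "c \<odot>\<^bsub>cont_algebra Z\<^esub> (\<lambda>y\<in>topspace Z. P (g y)) = (\<lambda>y\<in>topspace Z. c * P (g y))"
      "\<one>\<^bsub>cont_algebra Z\<^esub> = (\<lambda>y\<in>topspace Z. (\<lambda>x. 1) (g y))"
    for P Q c and g :: "'a \<Rightarrow> nat \<Rightarrow> real" and Z :: "'a topology"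
    by (auto simp: cont_algebra_def fun_eq_iff)
  have "ev Y f T k \<in> ring_hom (sub_alg Y f) (cont_algebra T)"
  proof (rule ring_hom_memI)
    fix a assume "a \<in> carrier (sub_alg Y f)"
    then obtain P where P: "P \<in> cpoly" "a = (\<lambda>y\<in>topspace Y. P (f y))" using obt by (auto simp: sub_alg_def)
    show "ev Y f T k a \<in> carrier (cont_algebra T)" unfolding P(2) e[OF P(1)] by (rule cont_algebra_cpoly[OF k(2) P(1)])
    fix b assume "b \<in> carrier (sub_alg Y f)"
    then obtain Q where Q: "Q \<in> cpoly" "b = (\<lambda>y\<in>topspace Y. Q (f y))" using obt by (auto simp: sub_alg_def)
    have "ev Y f T k (a \<otimes>\<^bsub>cont_algebra Y\<^esub> b) = ev Y f T k a \<otimes>\<^bsub>cont_algebra T\<^esub> ev Y f T k b"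
      unfolding P(2) Q(2) e[OF P(1)] e[OF Q(1)] ops by (rule e[OF cpoly_mult[OF P(1) Q(1)]])
    then show "ev Y f T k (a \<otimes>\<^bsub>sub_alg Y f\<^esub> b) = ev Y f T k a \<otimes>\<^bsub>cont_algebra T\<^esub> ev Y f T k b"
      by (simp add: sub_alg_def)
    have "ev Y f T k (a \<oplus>\<^bsub>cont_algebra Y\<^esub> b) = ev Y f T k a \<oplus>\<^bsub>cont_algebra T\<^esub> ev Y f T k b"
      unfolding P(2) Q(2) e[OF P(1)] e[OF Q(1)] ops by (rule e[OF cpoly_add[OF P(1) Q(1)]])
    then show "ev Y f T k (a \<oplus>\<^bsub>sub_alg Y f\<^esub> b) = ev Y f T k a \<oplus>\<^bsub>cont_algebra T\<^esub> ev Y f T k b"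
      by (simp add: sub_alg_def)
  next
    have "ev Y f T k \<one>\<^bsub>cont_algebra Y\<^esub> = \<one>\<^bsub>cont_algebra T\<^esub>"
      unfolding ops(4)[where Z = Y] ops(4)[where Z = T] by (rule e[OF cpoly_const[of 1]])
    then show "ev Y f T k \<one>\<^bsub>sub_alg Y f\<^esub> = \<one>\<^bsub>cont_algebra T\<^esub>" by (simp add: sub_alg_def)
  qed
  moreover have "ev Y f T k (c \<odot>\<^bsub>sub_alg Y f\<^esub> a) = c \<odot>\<^bsub>cont_algebra T\<^esub> ev Y f T k a" if "a \<in> carrier (sub_alg Y f)" for a c
  proof -
    obtain P where P: "P \<in> cpoly" "a = (\<lambda>y\<in>topspace Y. P (f y))" using obt \<open>a \<in> _\<close> by (auto simp: sub_alg_def)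
    have "ev Y f T k (c \<odot>\<^bsub>cont_algebra Y\<^esub> a) = c \<odot>\<^bsub>cont_algebra T\<^esub> ev Y f T k a"
      unfolding P(2) e[OF P(1)] ops by (rule e[OF cpoly_mult[OF cpoly_const P(1)]])
    then show ?thesis by (simp add: sub_alg_def)
  qed
  moreover have "ev Y f T k \<in> extensional (carrier (sub_alg Y f))" by (simp add: sub_alg_def ev_def)
  ultimately show ?thesis by (simp add: mor_alg)
qed

lemma ev_cong: "(\<And>t. t \<in> topspace T \<Longrightarrow> k t = k' t) \<Longrightarrow> ev Y f T k = ev Y f T k'"
  unfolding ev_def by (intro restrict_ext) (auto intro: restrict_ext)

lemma ev_self:
  assumes "coord_map Y n f"
  shows "ev Y f Y f = restrict id (gen_alg Y f)" "f ` topspace Y \<subseteq> zariski_closure Y f n"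
proof -
  show V: "f ` topspace Y \<subseteq> zariski_closure Y f n"
    using assms by (auto simp: zariski_closure_def zero_set_def coord_map_def)
  show "ev Y f Y f = restrict id (gen_alg Y f)"
  proof
    fix a show "ev Y f Y f a = restrict id (gen_alg Y f) a"
    proof (cases "a \<in> gen_alg Y f")
      case True
      then obtain Q where "Q \<in> cpoly" "a = (\<lambda>y\<in>topspace Y. Q (f y))" by (auto simp: gen_alg_def)
      then show ?thesis using ev_eq[OF V, of Q] True by simp
    qed (simp add: ev_def)
  qed
qed

lemma ev_comp:
  assumes f: "continuous_map Y euclidean f" and k: "k ` topspace T \<subseteq> zariski_closure Y f n" "continuous_map T euclidean k"
    and \<phi>: "continuous_map T' T \<phi>"
  shows "Comp comm_algebras (sub_alg Y f) (cont_algebra T) (cont_algebra T') (mmap cont_functor T T' \<phi>) (ev Y f T k) =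
    ev Y f T' (k \<circ> \<phi>)"
proof -
  have pt: "\<phi> t \<in> topspace T" if "t \<in> topspace T'" for t using \<phi> that by (auto simp: continuous_map_def)
  then have V: "(k \<circ> \<phi>) ` topspace T' \<subseteq> zariski_closure Y f n" using k(1) by auto
  show ?thesis
  proof
    fix a
    show "Comp comm_algebras (sub_alg Y f) (cont_algebra T) (cont_algebra T') (mmap cont_functor T T' \<phi>) (ev Y f T k) a =
      ev Y f T' (k \<circ> \<phi>) a"
    proof (cases "a \<in> gen_alg Y f")
      case True
      then obtain Q where Q: "Q \<in> cpoly" "a = (\<lambda>y\<in>topspace Y. Q (f y))" by (auto simp: gen_alg_def)
      have "(\<lambda>t\<in>topspace T. Q (k t)) \<in> carrier (cont_algebra T)" by (rule cont_algebra_cpoly[OF k(2) Q(1)])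
      then have "mmap cont_functor T T' \<phi> (\<lambda>t\<in>topspace T. Q (k t)) = (\<lambda>t\<in>topspace T'. Q ((k \<circ> \<phi>) t))"
        using pt by (auto simp: cont_functor_def compose_def fun_eq_iff)
      then show ?thesis
        using True ev_eq[OF k(1) Q(1)] ev_eq[OF V Q(1)] Q(2) by (simp add: comp_alg compose_def sub_alg_def)
    qed (simp add: comp_alg compose_def sub_alg_def ev_def)
  qed
qed

text \<open>Packs two sequences into one. It serves twice: to put two finitely generated algebras
  into a third, and to treat a pair of maps as a single map.\<close>

definition interleave :: "(nat \<Rightarrow> real) \<Rightarrow> (nat \<Rightarrow> real) \<Rightarrow> nat \<Rightarrow> real" where
  "interleave a b i = (if even i then a (i div 2) else b (i div 2))"

lemma interleave_simps: "interleave a b (2 * i) = a i" "interleave a b (2 * i + 1) = b i"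
  by (simp_all add: interleave_def)

lemma interleave_coord_space:
  "a \<in> coord_space {..<n} \<Longrightarrow> b \<in> coord_space {..<n} \<Longrightarrow> interleave a b \<in> coord_space {..<2 * n}"
  by (auto simp: coord_space_def interleave_def)

lemma continuous_map_coords:
  fixes f :: "'a \<Rightarrow> nat \<Rightarrow> real"
  shows "continuous_map X euclidean f \<longleftrightarrow> (\<forall>i. continuous_map X euclidean (\<lambda>x. f x i))"
  using continuous_map_componentwise_UNIV[of X "\<lambda>_. euclidean" f] by (simp add: euclidean_product_topology)

lemma continuous_map_interleave:
  assumes "continuous_map X euclidean f" "continuous_map X euclidean g"
  shows "continuous_map X euclidean (\<lambda>x. interleave (f x) (g x))"
proof -
  have "continuous_map X euclidean (\<lambda>x. interleave (f x) (g x) i)" for i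
    using assms by (cases "even i") (simp_all add: interleave_def continuous_map_coords)
  then show ?thesis by (simp only: continuous_map_coords) blast
qed

text \<open>Reals are coded by sets of naturals, and a sequence of such sets by one set of pairs.
  This is the source of room in the fixed universes, both for the index category and for copies of
  polyhedra.\<close>

lemma inj_sequences_real: "\<exists>e :: (nat \<Rightarrow> real) \<Rightarrow> real. inj e"
proof -
  obtain c :: "nat set \<Rightarrow> real" where c: "bij c"
    using nat_sets_eqpoll_reals by (auto simp: eqpoll_def)
  define d where "d s = {prod_encode (n, m) |n m. m \<in> inv_into UNIV c (s n)}" for s :: "nat \<Rightarrow> real"
  have ic: "inj (inv_into UNIV c)" using c by (simp add: bij_is_surj surj_imp_inj_inv)
  have "inj d"
  proof (rule injI)
    fix s t assume st: "d s = d t"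
    have mem: "m \<in> inv_into UNIV c (s n) \<longleftrightarrow> prod_encode (n, m) \<in> d s" for s n m by (auto simp: d_def)
    have "inv_into UNIV c (s n) = inv_into UNIV c (t n)" for n using mem[of _ s n] mem[of _ t n] st by blast
    then show "s = t" using ic by (auto simp: inj_eq)
  qed
  then have "inj (c \<circ> d)" using c by (simp add: bij_is_inj inj_compose)
  then show ?thesis by (rule exI[of inj "c \<circ> d"])
qed

text \<open>\<open>cont_algebra Y\<close> is the directed union of its subalgebras
  \<open>gen_alg Y f\<close>, and every element of a filtered colimit of groups comes from some
  stage.\<close>

lemma finitely_generated_surj:
  fixes F :: "(('x \<Rightarrow> complex) calg, ('x \<Rightarrow> complex) \<Rightarrow> ('x \<Rightarrow> complex), 'g monoid, 'g \<Rightarrow> 'g) fctr"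
  assumes F: "is_functor comm_algebras abelian_groups F" "commutes_with_filtered_colimits F"
    and \<alpha>: "\<alpha> \<in> carrier (omap F (cont_algebra Y))"
  shows "\<exists>f n \<beta>. coord_map Y n f \<and> \<beta> \<in> carrier (omap F (sub_alg Y f)) \<and>
    mmap F (sub_alg Y f) (cont_algebra Y) (restrict id (gen_alg Y f)) \<beta> = \<alpha>"
proof -
  obtain e0 :: "(nat \<Rightarrow> real) \<Rightarrow> real" where "inj e0" using inj_sequences_real by blast
  define e where "e = complex_of_real \<circ> e0"
  have "inj e" unfolding e_def using \<open>inj e0\<close> by (auto simp: inj_def)
  then have inv: "inv_into UNIV e \<circ> (e \<circ> f) = f" for f :: "'x \<Rightarrow> nat \<Rightarrow> real" by (auto simp: fun_eq_iff)
  \<comment> \<open>The index of a subalgebra is its generating map, coded as one complex function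
    so that it has the type demanded of index objects.\<close>
  define S where "S = {e \<circ> f |f n. coord_map Y n f}"
  define B where "B j = gen_alg Y (inv_into UNIV e \<circ> j)" for j
  have SD: "\<exists>n. coord_map Y n (inv_into UNIV e \<circ> j)" if "j \<in> S" for j
    using that inv by (auto simp: S_def)
  have SI: "e \<circ> f \<in> S" "B (e \<circ> f) = gen_alg Y f" if "coord_map Y n f" for f n
    using that inv by (auto simp: S_def B_def)
  have sub: "(cont_algebra Y)\<lparr>carrier := B j\<rparr> = sub_alg Y (inv_into UNIV e \<circ> j)" for j
    by (simp add: B_def sub_alg_def)
  have Balg: "algebra complex_ring ((cont_algebra Y)\<lparr>carrier := B j\<rparr>)" "B j \<subseteq> carrier (cont_algebra Y)"
    if j: "j \<in> S" for j
  proof -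
    have c: "continuous_map Y euclidean (inv_into UNIV e \<circ> j)" using SD[OF j] by (auto simp: coord_map_def)
    show "algebra complex_ring ((cont_algebra Y)\<lparr>carrier := B j\<rparr>)" unfolding sub by (rule algebra_sub_alg(1)[OF c])
    show "B j \<subseteq> carrier (cont_algebra Y)" unfolding B_def by (rule algebra_sub_alg(2)[OF c])
  qed
  have dir: "\<exists>k\<in>S. B i \<subseteq> B k \<and> B j \<subseteq> B k" if ij: "i \<in> S" "j \<in> S" for i j
  proof -
    obtain n where n: "coord_map Y n (inv_into UNIV e \<circ> i)" using SD[OF ij(1)] by blast
    obtain m where m: "coord_map Y m (inv_into UNIV e \<circ> j)" using SD[OF ij(2)] by blast
    define f g where "f = inv_into UNIV e \<circ> i" and "g = inv_into UNIV e \<circ> j"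
    have fc: "f ` topspace Y \<subseteq> coord_space {..<max n m}" "g ` topspace Y \<subseteq> coord_space {..<max n m}"
      using n m by (fastforce simp: coord_map_def f_def g_def coord_space_def)+
    define h where "h y = interleave (f y) (g y)" for y
    have h: "coord_map Y (2 * max n m) h"
      unfolding coord_map_def
    proof
      show "continuous_map Y euclidean h"
        unfolding h_def using n m by (intro continuous_map_interleave) (simp_all only: coord_map_def f_def g_def)
      show "h ` topspace Y \<subseteq> coord_space {..<2 * max n m}"
        using fc unfolding h_def by (auto intro!: interleave_coord_space)
    qed
    have "gen_alg Y f \<subseteq> gen_alg Y h"
    proof
      fix a assume "a \<in> gen_alg Y f"
      then obtain Q where Q: "Q \<in> cpoly" "a = (\<lambda>y\<in>topspace Y. Q (f y))" by (auto simp: gen_alg_def)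
      have "a = (\<lambda>y\<in>topspace Y. (\<lambda>x. Q (\<lambda>i. x (2 * i))) (h y))" by (simp add: Q h_def interleave_simps)
      then show "a \<in> gen_alg Y h" unfolding gen_alg_def by (rule image_eqI[where x = "\<lambda>x. Q (\<lambda>i. x (2 * i))"]) (rule cpoly_reindex[OF Q(1)])
    qed
    moreover have "gen_alg Y g \<subseteq> gen_alg Y h"
    proof
      fix a assume "a \<in> gen_alg Y g"
      then obtain Q where Q: "Q \<in> cpoly" "a = (\<lambda>y\<in>topspace Y. Q (g y))" by (auto simp: gen_alg_def)
      have "a = (\<lambda>y\<in>topspace Y. (\<lambda>x. Q (\<lambda>i. x (2 * i + 1))) (h y))"
        unfolding Q h_def interleave_simps by simp
      then show "a \<in> gen_alg Y h" unfolding gen_alg_def by (rule image_eqI[where x = "\<lambda>x. Q (\<lambda>i. x (2 * i + 1))"]) (rule cpoly_reindex[OF Q(1)])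
    qed
    ultimately show ?thesis using SI[OF h] by (intro bexI[of _ "e \<circ> h"]) (simp_all add: B_def f_def g_def)
  qed
  have "coord_map Y 0 (\<lambda>y i. 0)" by (auto simp: coord_map_def coord_space_def)
  then have ne: "S \<noteq> {}" using SI(1) by blast
  have un: "\<exists>j\<in>S. a \<in> B j" if a: "a \<in> carrier (cont_algebra Y)" for a
  proof -
    \<comment> \<open>Two real coordinates, the real and imaginary part, already generate a
      subalgebra containing \<open>a\<close>.\<close>
    define f where "f y = (\<lambda>i::nat. if i = 0 then Re (a y) else if i = 1 then Im (a y) else 0)" for y
    have ac: "continuous_map Y euclidean a" "a \<in> extensional (topspace Y)" using a by (auto simp: cont_algebra_def)
    have "continuous_map Y euclidean (\<lambda>y. Re (a y))" "continuous_map Y euclidean (\<lambda>y. Im (a y))"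
      using continuous_map_compose[OF ac(1), of euclidean Re] continuous_map_compose[OF ac(1), of euclidean Im]
      by (simp_all add: o_def continuous_on_Re continuous_on_Im)
    then have "continuous_map Y euclidean (\<lambda>y. f y i)" for i
      by (cases "i = 0"; cases "i = 1") (simp_all add: f_def)
    then have "continuous_map Y euclidean f" by (simp only: continuous_map_coords) blast
    then have f: "coord_map Y 2 f" by (auto simp: coord_map_def coord_space_def f_def)
    have "(\<lambda>x. Complex (x 0) (x 1)) \<in> cpoly" by (simp add: cpoly_def polyfun.coord)
    moreover have "a = (\<lambda>y\<in>topspace Y. (\<lambda>x. Complex (x 0) (x 1)) (f y))"
      using ac(2) by (auto simp: f_def extensional_def fun_eq_iff)
    ultimately have "a \<in> gen_alg Y f" unfolding gen_alg_def
      by (intro image_eqI[where x = "\<lambda>x. Complex (x 0) (x 1)"])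
    then show ?thesis using SI[OF f] by (intro bexI[of _ "e \<circ> f"]) simp_all
  qed
  let ?J = "incl_cat S B" and ?D = "incl_diagram (cont_algebra Y) B"
  have J: "is_filtered ?J" by (rule is_filtered_incl_cat[OF ne dir])
  have D: "is_functor ?J comm_algebras ?D"
    and L: "is_colimit ?J comm_algebras ?D (cont_algebra Y) (\<lambda>j. restrict id (B j))"
    using directed_union_colimit[OF algebra_cont_algebra Balg ne dir un] by blast+
  have "preserves_colimits_of_shape ?J comm_algebras abelian_groups F"
    using F(2) J unfolding commutes_with_filtered_colimits_def by blast
  then have L': "is_colimit ?J abelian_groups (fctr_comp F ?D) (omap F (cont_algebra Y))
      (\<lambda>j. mmap F (omap ?D j) (cont_algebra Y) (restrict id (B j)))"
    using D L unfolding preserves_colimits_of_shape_def by blast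
  obtain j b where j: "j \<in> S" and b: "b \<in> carrier (omap (fctr_comp F ?D) j)"
    "mmap F (omap ?D j) (cont_algebra Y) (restrict id (B j)) b = \<alpha>"
    using filtered_colimit_surj[OF J is_functor_fctr_comp[OF D F(1)] L' \<alpha>] by (auto simp: incl_cat_def)
  have "omap ?D j = sub_alg Y (inv_into UNIV e \<circ> j)" by (simp add: incl_diagram_def sub)
  then show ?thesis using SD[OF j] b by (auto simp: fctr_comp_def B_def)
qed

section \<open>Homotopy invariance\<close>

lemma continuous_map_real_coord: "continuous_map X euclidean f \<Longrightarrow> continuous_map X euclideanreal (\<lambda>x. f x i)"
  for f :: "'a \<Rightarrow> nat \<Rightarrow> real"
  by (simp add: continuous_map_coords)

text \<open>The point with parameter \<tau> on the segment joining the two halves of an interleaved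
  pair.\<close>

definition seg :: "(nat \<Rightarrow> real) \<Rightarrow> real \<Rightarrow> nat \<Rightarrow> real" where
  "seg c \<tau> i = (1 - \<tau>) * c (2 * i) + \<tau> * c (2 * i + 1)"

lemma seg_interleave: "seg (interleave a b) 0 = a" "seg (interleave a b) 1 = b" "seg (interleave a a) \<tau> = a"
  by (simp_all add: seg_def fun_eq_iff interleave_def algebra_simps)

lemma continuous_map_seg:
  assumes "continuous_map X euclidean c" "continuous_map X euclideanreal t"
  shows "continuous_map X euclidean (\<lambda>x. seg (c x) (t x))"
proof -
  have "continuous_map X euclideanreal (\<lambda>x. seg (c x) (t x) i)" for i
    unfolding seg_def
    by (rule continuous_map_add; rule continuous_map_real_mult)
      (rule continuous_map_real_coord[OF assms(1)] assms(2) continuous_map_diff continuous_map_const[THEN iffD2]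
        disjI2, simp?)+
  then show ?thesis by (simp only: continuous_map_coords) blast
qed

text \<open>Tube lemma: the condition is open for each parameter jointly with the pair, and the
  parameter interval is compact.\<close>

lemma open_seg:
  assumes "open S"
  shows "open {c. \<forall>\<tau>\<in>{0..1}. seg c \<tau> \<in> S}"
proof (subst open_subopen, rule ballI)
  fix c assume c: "c \<in> {c. \<forall>\<tau>\<in>{0..1}. seg c \<tau> \<in> S}"
  let ?P = "prod_topology (euclidean :: (nat \<Rightarrow> real) topology) euclideanreal"
  have "continuous_map ?P euclidean (\<lambda>p. seg (fst p) (snd p))"
    by (rule continuous_map_seg) (rule continuous_map_fst continuous_map_snd)+
  then have "openin ?P {p \<in> topspace ?P. seg (fst p) (snd p) \<in> S}"
    by (rule openin_continuous_map_preimage) (use assms in simp)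
  moreover have "compactin euclideanreal {0..1}" by simp
  moreover have "{c} \<times> {0..1} \<subseteq> {p \<in> topspace ?P. seg (fst p) (snd p) \<in> S}" using c by auto
  ultimately obtain U V where UV: "openin euclidean U" "c \<in> U" "{0..1} \<subseteq> V"
    "U \<times> V \<subseteq> {p \<in> topspace ?P. seg (fst p) (snd p) \<in> S}"
    using tube_lemma_right[of euclidean euclideanreal "{p \<in> topspace ?P. seg (fst p) (snd p) \<in> S}" "{0..1}" c] by auto
  have "U \<subseteq> {c. \<forall>\<tau>\<in>{0..1}. seg c \<tau> \<in> S}"
  proof (intro subsetI CollectI ballI)
    fix d \<tau> assume "d \<in> U" "\<tau> \<in> {0..1::real}"
    then have "(d, \<tau>) \<in> U \<times> V" using UV(3) by blast
    then show "seg d \<tau> \<in> S" using UV(4) by auto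
  qed
  then show "\<exists>T. open T \<and> c \<in> T \<and> T \<subseteq> {c. \<forall>\<tau>\<in>{0..1}. seg c \<tau> \<in> S}" using UV(1,2) by auto
qed

lemma copy_exists:
  fixes P :: "'p topology" and e :: "'p \<Rightarrow> 'x"
  assumes "inj e"
  shows "\<exists>(Y :: 'x topology) g. homeomorphic_maps P Y e g"
proof -
  define g where "g = inv_into UNIV e"
  have inv: "g (e p) = p" for p using assms by (simp add: g_def)
  have "homeomorphic_maps P (pullback_topology (range e) g P) e g"
    unfolding homeomorphic_maps_def
  proof (intro conjI ballI)
    show "continuous_map P (pullback_topology (range e) g P) e"
      by (rule continuous_map_pullback') (auto simp: comp_def inv intro: continuous_map_eq[OF continuous_map_id])
    show "continuous_map (pullback_topology (range e) g P) P g"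
      using continuous_map_pullback[OF continuous_map_id, where A = "range e" and f = g] by simp
  qed (auto simp: topspace_pullback_topology inv)
  then show ?thesis by blast
qed

text \<open>Cardinal arithmetic: an infinite set absorbs a factor that is no larger than
  itself.\<close>

lemma inj_prod_real:
  assumes "inj (i :: real \<Rightarrow> 'x)"
  shows "\<exists>e :: 'x \<times> real \<Rightarrow> 'x. inj e"
proof -
  have inf: "infinite (UNIV :: 'x set)"
    using assms infinite_UNIV_char_0[where 'a = real] finite_imageD[of i UNIV] finite_subset[of "range i" UNIV] by auto
  have "\<exists>f :: real \<Rightarrow> 'x. inj_on f UNIV \<and> f ` UNIV \<subseteq> UNIV" using assms by auto
  then have "ordLeq3 (card_of (UNIV :: real set)) (card_of (UNIV :: 'x set))"
    unfolding card_of_ordLeq .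
  from card_of_Times_infinite[OF inf UNIV_not_empty this]
  have "ordLeq3 (card_of ((UNIV :: 'x set) \<times> (UNIV :: real set))) (card_of (UNIV :: 'x set))"
    using ordIso_imp_ordLeq by blast
  from this[unfolded card_of_ordLeq[symmetric]] show ?thesis by auto
qed

lemma mor_ch: "\<phi> \<in> Mor compact_hausdorff X Y \<longleftrightarrow> \<phi> \<in> extensional (topspace X) \<and> continuous_map X Y \<phi>"
  by (simp add: compact_hausdorff_def)

lemma obj_ch: "X \<in> Obj compact_hausdorff \<longleftrightarrow> compact_space X \<and> Hausdorff_space X"
  by (simp add: compact_hausdorff_def)

lemma obj_cp: "X \<in> Obj compact_polyhedra \<longleftrightarrow> X \<in> Obj compact_hausdorff \<and> is_polyhedron X"
  by (simp add: compact_polyhedra_def full_subcategory_def)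

lemma restrict_mor_ch: "continuous_map X Y \<phi> \<Longrightarrow> restrict \<phi> (topspace X) \<in> Mor compact_hausdorff X Y"
  by (auto simp: mor_ch elim: continuous_map_eq)

section \<open>Consequences of functoriality on compact Hausdorff spaces\<close>

context
  fixes G :: "('x topology, 'x \<Rightarrow> 'x, 'g monoid, 'g \<Rightarrow> 'g) fctr"
  assumes G: "is_functor (opposite compact_hausdorff) abelian_groups G"
begin

lemma functor_hom:
  assumes "X \<in> Obj compact_hausdorff" "Y \<in> Obj compact_hausdorff" "\<phi> \<in> Mor compact_hausdorff X Y"
  shows "mmap G Y X \<phi> \<in> hom (omap G Y) (omap G X)"
  using G assms by (simp add: is_functor_def opposite_def mor_ab)

lemma functor_id:
  assumes "X \<in> Obj compact_hausdorff" "x \<in> carrier (omap G X)"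
  shows "mmap G X X (restrict id (topspace X)) x = x"
proof -
  have "mmap G X X (Ident compact_hausdorff X) = Ident abelian_groups (omap G X)"
    using G assms(1) by (simp add: is_functor_def opposite_def)
  then show ?thesis using assms(2) by (simp add: compact_hausdorff_def abelian_groups_def)
qed

lemma functor_comp:
  assumes "S \<in> Obj compact_hausdorff" "T \<in> Obj compact_hausdorff" "Y \<in> Obj compact_hausdorff"
    "\<psi> \<in> Mor compact_hausdorff S T" "\<phi> \<in> Mor compact_hausdorff T Y" "x \<in> carrier (omap G Y)"
  shows "mmap G Y S (compose (topspace S) \<phi> \<psi>) x = mmap G T S \<psi> (mmap G Y T \<phi> x)"
proof -
  have "mmap G Y S (Comp (opposite compact_hausdorff) Y T S \<psi> \<phi>) =
      Comp abelian_groups (omap G Y) (omap G T) (omap G S) (mmap G T S \<psi>) (mmap G Y T \<phi>)"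
    using G assms(1-5) by (simp add: is_functor_def opposite_def)
  then have "mmap G Y S (compose (topspace S) \<phi> \<psi>) = compose (carrier (omap G Y)) (mmap G T S \<psi>) (mmap G Y T \<phi>)"
    by (simp add: opposite_def compact_hausdorff_def comp_ab)
  then show ?thesis using assms(6) by (simp add: compose_eq)
qed

text \<open>Both ends of the cylinder are inverse to the projection.\<close>

lemma polyhedron_cylinder_ends:
  assumes hinv: "homotopy_invariant compact_polyhedra G"
    and D: "D \<in> Obj compact_polyhedra" and E: "E \<in> Obj compact_hausdorff"
    and \<theta>: "homeomorphic_maps (prod_topology D (top_of_set {0..1::real})) E \<theta> \<theta>'"
    and x: "x \<in> carrier (omap G E)"
  shows "mmap G E D (\<lambda>d\<in>topspace D. \<theta> (d, 0)) x = mmap G E D (\<lambda>d\<in>topspace D. \<theta> (d, 1)) x"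
proof -
  have DC: "D \<in> Obj compact_hausdorff" "is_polyhedron D" using D by (simp_all add: obj_cp)
  have \<theta>h: "homeomorphic_map (prod_topology D (top_of_set {0..1::real})) E \<theta>"
    using \<theta> homeomorphic_map_maps by blast
  have EP: "E \<in> Obj compact_polyhedra" using E is_polyhedron_cylinder[OF DC(2) \<theta>h] by (simp add: obj_cp)
  define \<iota> where "\<iota> s = (\<lambda>d\<in>topspace D. \<theta> (d, s))" for s
  define p where "p = (\<lambda>y\<in>topspace E. fst (\<theta>' y))"
  have c: "continuous_map (prod_topology D (top_of_set {0..1::real})) E \<theta>"
    "continuous_map E (prod_topology D (top_of_set {0..1::real})) \<theta>'"
    "\<And>p. p \<in> topspace D \<times> {0..1} \<Longrightarrow> \<theta>' (\<theta> p) = p"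
    using \<theta> by (auto simp: homeomorphic_maps_def)
  have \<iota>: "\<iota> s \<in> Mor compact_hausdorff D E" if s: "s \<in> {0..1}" for s
  proof -
    have "continuous_map D (prod_topology D (top_of_set {0..1::real})) (\<lambda>d. (d, s))"
      using s by (intro continuous_map_pairedI) auto
    from continuous_map_compose[OF this c(1)] have "continuous_map D E (\<lambda>d. \<theta> (d, s))" by (simp add: o_def)
    then show ?thesis unfolding \<iota>_def by (rule restrict_mor_ch)
  qed
  have p: "p \<in> Mor compact_hausdorff E D"
    unfolding p_def
    using continuous_map_compose[OF c(2) continuous_map_fst] by (intro restrict_mor_ch) (simp add: o_def)
  have comp: "compose (topspace D) p (\<iota> s) = restrict id (topspace D)" if s: "s \<in> {0..1}" for s
  proof
    fix d
    show "compose (topspace D) p (\<iota> s) d = restrict id (topspace D) d"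
    proof (cases "d \<in> topspace D")
      case True
      then have "\<iota> s d \<in> topspace E" using \<iota>[OF s] by (auto simp: mor_ch continuous_map_def)
      then show ?thesis using True c(3)[of "(d, s)"] s by (simp add: compose_eq p_def \<iota>_def)
    qed (simp add: compose_def)
  qed
  have ret: "mmap G E D (\<iota> s) (mmap G D E p z) = z" if "s \<in> {0..1}" "z \<in> carrier (omap G D)" for s z
    using functor_comp[OF DC(1) E DC(1) \<iota>[OF that(1)] p that(2)] functor_id[OF DC(1) that(2)] comp[OF that(1)] by simp
  have "mmap G E D (\<iota> 0) \<in> iso (omap G E) (omap G D)"
    using hinv D EP \<theta>h unfolding homotopy_invariant_def \<iota>_def by blast
  then have inj: "inj_on (mmap G E D (\<iota> 0)) (carrier (omap G E))"
    by (simp add: iso_def bij_betw_def)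
  define z where "z = mmap G E D (\<iota> 0) x"
  have z: "z \<in> carrier (omap G D)"
    using functor_hom[OF DC(1) E \<iota>[of 0]] x by (auto simp: z_def hom_def)
  have "mmap G D E p z \<in> carrier (omap G E)" using functor_hom[OF E DC(1) p] z by (auto simp: hom_def)
  then have "mmap G D E p z = x" using inj ret[of 0 z] z x by (auto simp: z_def inj_on_def)
  then show ?thesis using ret[of 0 z] ret[of 1 z] z by (simp add: \<iota>_def)
qed

end

section \<open>Pulling back a class along maps into the Zariski closure\<close>

text \<open>One class \<beta> over one finitely generated subalgebra is fixed. The injection of the
  reals provides copies in \<open>'x\<close> of polyhedra and of their cylinders.\<close>

locale polynomial_class =
  fixes F :: "(('x \<Rightarrow> complex) calg, ('x \<Rightarrow> complex) \<Rightarrow> ('x \<Rightarrow> complex), 'g monoid, 'g \<Rightarrow> 'g) fctr"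
    and Y :: "'x topology" and f :: "'x \<Rightarrow> nat \<Rightarrow> real" and n :: nat and \<beta> :: 'g
  assumes F: "is_functor comm_algebras abelian_groups F"
    and hinv: "homotopy_invariant (compact_polyhedra :: ('x topology, 'x \<Rightarrow> 'x) cat) (fctr_comp F cont_functor)"
    and Y: "Y \<in> Obj compact_hausdorff" and f: "coord_map Y n f" and \<beta>: "\<beta> \<in> carrier (omap F (sub_alg Y f))"
    and inj: "\<exists>i :: real \<Rightarrow> 'x. inj i"
begin

abbreviation "G \<equiv> fctr_comp F cont_functor"

lemma G: "is_functor (opposite compact_hausdorff) abelian_groups G"
  by (rule is_functor_fctr_comp[OF is_functor_cont_functor F])

definition pull :: "'x topology \<Rightarrow> ('x \<Rightarrow> nat \<Rightarrow> real) \<Rightarrow> 'g" where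
  "pull T k = mmap F (sub_alg Y f) (cont_algebra T) (ev Y f T k) \<beta>"

lemma pull_cong: "(\<And>t. t \<in> topspace T \<Longrightarrow> k t = k' t) \<Longrightarrow> pull T k = pull T k'"
  unfolding pull_def using ev_cong[of T k k' Y f] by simp

lemma fc: "continuous_map Y euclidean f" "f ` topspace Y \<subseteq> coord_space {..<n}"
  using f by (auto simp: coord_map_def)

lemma pull_mem:
  assumes "T \<in> Obj compact_hausdorff" "k ` topspace T \<subseteq> zariski_closure Y f n" "continuous_map T euclidean k"
  shows "pull T k \<in> carrier (omap G T)"
proof -
  have "mmap F (sub_alg Y f) (cont_algebra T) (ev Y f T k) \<in> hom (omap F (sub_alg Y f)) (omap F (cont_algebra T))"
    using F ev_mor[OF fc(1) assms(2,3)] algebra_sub_alg(1)[OF fc(1)] algebra_cont_algebra[of T]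
    unfolding is_functor_def obj_alg[symmetric] by (meson mor_ab)
  then show ?thesis using \<beta> by (auto simp: pull_def fctr_comp_def cont_functor_def hom_def)
qed

lemma pull_natural:
  assumes T: "T \<in> Obj compact_hausdorff" "T' \<in> Obj compact_hausdorff"
    and k: "k ` topspace T \<subseteq> zariski_closure Y f n" "continuous_map T euclidean k"
    and \<phi>: "\<phi> \<in> Mor compact_hausdorff T' T"
  shows "mmap G T T' \<phi> (pull T k) = pull T' (k \<circ> \<phi>)"
proof -
  have \<phi>c: "continuous_map T' T \<phi>" using \<phi> by (simp add: mor_ch)
  have cm: "mmap cont_functor T T' \<phi> \<in> Mor comm_algebras (cont_algebra T) (cont_algebra T')"
    using is_functor_cont_functor T \<phi> by (auto simp: is_functor_def opposite_def cont_functor_def)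
  have obj: "sub_alg Y f \<in> Obj comm_algebras" "cont_algebra T \<in> Obj comm_algebras" "cont_algebra T' \<in> Obj comm_algebras"
    using algebra_sub_alg(1)[OF fc(1)] algebra_cont_algebra by (simp_all add: obj_alg)
  have "mmap F (sub_alg Y f) (cont_algebra T') (ev Y f T' (k \<circ> \<phi>)) =
      Comp abelian_groups (omap F (sub_alg Y f)) (omap F (cont_algebra T)) (omap F (cont_algebra T'))
        (mmap F (cont_algebra T) (cont_algebra T') (mmap cont_functor T T' \<phi>))
        (mmap F (sub_alg Y f) (cont_algebra T) (ev Y f T k))"
    using F obj ev_mor[OF fc(1) k] cm unfolding ev_comp[OF fc(1) k \<phi>c, symmetric] is_functor_def by blast
  then show ?thesis using \<beta> by (simp add: pull_def fctr_comp_def cont_functor_def comp_ab compose_eq)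
qed

text \<open>The homotopy defines a class on a copy of the cylinder; its restrictions to the two ends
  are equal by \<open>polyhedron_cylinder_ends\<close>.\<close>

lemma pull_polyhedron:
  assumes D: "D \<in> Obj compact_polyhedra"
    and K: "continuous_map (prod_topology D (top_of_set {0..1::real})) euclidean K"
      "K ` (topspace D \<times> {0..1}) \<subseteq> zariski_closure Y f n"
  shows "pull D (\<lambda>d. K (d, 0)) = pull D (\<lambda>d. K (d, 1))"
proof -
  have DC: "D \<in> Obj compact_hausdorff" using D by (simp add: obj_cp)
  obtain e :: "'x \<times> real \<Rightarrow> 'x" where e: "inj e" using inj inj_prod_real by blast
  obtain E :: "'x topology" and \<theta> where E: "E \<in> Obj compact_hausdorff" "homeomorphic_map (prod_topology D (top_of_set {0..1::real})) E \<theta>"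
    using cylinder_exists[OF e DC] by blast
  obtain \<theta>' where \<theta>: "homeomorphic_maps (prod_topology D (top_of_set {0..1::real})) E \<theta> \<theta>'"
    using E(2) homeomorphic_map_maps by blast
  have c: "continuous_map (prod_topology D (top_of_set {0..1::real})) E \<theta>"
    "continuous_map E (prod_topology D (top_of_set {0..1::real})) \<theta>'"
    "\<And>p. p \<in> topspace D \<times> {0..1} \<Longrightarrow> \<theta>' (\<theta> p) = p"
    using \<theta> by (auto simp: homeomorphic_maps_def)
  have kc: "continuous_map E euclidean (K \<circ> \<theta>')" by (rule continuous_map_compose[OF c(2) K(1)])
  have "\<theta>' y \<in> topspace D \<times> {0..1}" if "y \<in> topspace E" for y
    using c(2) that by (auto simp: continuous_map_def)
  then have kV: "(K \<circ> \<theta>') ` topspace E \<subseteq> zariski_closure Y f n" using K(2) by force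
  have ends: "mmap G E D (\<lambda>d\<in>topspace D. \<theta> (d, s)) (pull E (K \<circ> \<theta>')) = pull D (\<lambda>d. K (d, s))" if s: "s \<in> {0..1}" for s
  proof -
    have "continuous_map D (prod_topology D (top_of_set {0..1::real})) (\<lambda>d. (d, s))"
      using s by (intro continuous_map_pairedI) auto
    from continuous_map_compose[OF this c(1)] have "continuous_map D E (\<lambda>d. \<theta> (d, s))" by (simp add: o_def)
    from pull_natural[OF E(1) DC kV kc restrict_mor_ch[OF this]]
    have "mmap G E D (\<lambda>d\<in>topspace D. \<theta> (d, s)) (pull E (K \<circ> \<theta>')) = pull D (K \<circ> \<theta>' \<circ> (\<lambda>d\<in>topspace D. \<theta> (d, s)))" .
    also have "\<dots> = pull D (\<lambda>d. K (d, s))" by (rule pull_cong) (use c(3) s in simp)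
    finally show ?thesis .
  qed
  show ?thesis
    using polyhedron_cylinder_ends[OF G hinv D E(1) \<theta> pull_mem[OF E(1) kV kc]] ends[of 0] ends[of 1] by simp
qed

text \<open>\<open>W\<close> is a neighbourhood of the diagonal, made of pairs whose segment stays
  in the domain of the retraction. It is found before \<open>T\<close>, \<open>a\<close> and
  \<open>b\<close>, so one \<open>W\<close> serves all steps of a chain.\<close>

lemma pull_local:
  obtains W where "open W" "\<And>y. y \<in> topspace Y \<Longrightarrow> interleave (f y) (f y) \<in> W"
    and "\<And>T a b. T \<in> Obj compact_hausdorff \<Longrightarrow> continuous_map T euclidean a \<Longrightarrow> continuous_map T euclidean b \<Longrightarrow>
      a ` topspace T \<subseteq> f ` topspace Y \<Longrightarrow> b ` topspace T \<subseteq> f ` topspace Y \<Longrightarrow>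
      (\<And>t. t \<in> topspace T \<Longrightarrow> interleave (a t) (b t) \<in> W) \<Longrightarrow> pull T a = pull T b"
proof -
  let ?V = "zariski_closure Y f n"
  have fV: "f ` topspace Y \<subseteq> ?V" by (rule ev_self(2)[OF f])
  have "compactin euclidean (f ` topspace Y)"
    using image_compactin[OF _ fc(1), of "topspace Y"] Y by (simp add: obj_ch compact_space_def)
  then have cpt: "compact (f ` topspace Y)" by simp
  have "\<exists>b. \<forall>x\<in>f ` topspace Y. \<bar>x i\<bar> \<le> b" for i
  proof -
    have "compact ((\<lambda>x. x i) ` f ` topspace Y)" by (rule compact_continuous_image[OF continuous_on_proj cpt])
    from compact_imp_bounded[OF this] obtain b where "\<forall>u\<in>(\<lambda>x. x i) ` f ` topspace Y. norm u \<le> b"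
      unfolding bounded_iff by (elim exE)
    then show ?thesis by (intro exI[of _ b]) auto
  qed
  then obtain b where b: "\<And>i x. x \<in> f ` topspace Y \<Longrightarrow> \<bar>x i\<bar> \<le> b i" by metis
  define B where "B = (\<Sum>i<n. \<bar>b i\<bar>)"
  have B: "\<bar>x i\<bar> \<le> B" if "x \<in> f ` topspace Y" "i < n" for x i
  proof -
    have "\<bar>b i\<bar> \<le> B" unfolding B_def by (rule member_le_sum) (use that in auto)
    then show ?thesis using b[OF that(1), of i] by linarith
  qed
  have fcube: "f ` topspace Y \<subseteq> cube {..<n} B" "f ` topspace Y \<subseteq> cube {..<n} (B + 1)"
    using B fc(2) by (fastforce simp: cube_def)+
  obtain U r where U: "open U" "?V \<inter> cube {..<n} B \<subseteq> U" "continuous_on (cube {..<n} (B + 1) \<inter> U) r"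
    "r ` (cube {..<n} (B + 1) \<inter> U) \<subseteq> ?V" "\<And>x. x \<in> ?V \<inter> cube {..<n} B \<inter> cube {..<n} (B + 1) \<Longrightarrow> r x = x"
    using zero_set_retraction[of "{..<n}" "{q \<in> polyfun UNIV. \<forall>y\<in>topspace Y. q (f y) = 0}" B "B + 1"]
    unfolding zariski_closure_def by auto
  have fU: "x \<in> U" "r x = x" if "x \<in> f ` topspace Y" for x using that U(2,5) fV fcube by blast+
  \<comment> \<open>The strict bound \<open>B + 1\<close> is open and still gives points of the
    closed cube on which \<open>r\<close> is continuous; the image of \<open>f\<close> lies in the
    cube of radius \<open>B\<close> and so has a margin.\<close>
  define S where "S = U \<inter> (\<Inter>i\<in>{..<n}. {x. \<bar>x i\<bar> < B + 1})"
  define W where "W = {c. \<forall>\<tau>\<in>{0..1}. seg c \<tau> \<in> S}"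
  have "open S" unfolding S_def
    by (intro open_Int U(1) open_INT ballI open_Collect_less continuous_on_rabs continuous_on_proj continuous_on_const) auto
  then have W: "open W" unfolding W_def by (rule open_seg)
  have S_in: "seg c \<tau> \<in> cube {..<n} (B + 1) \<inter> U" if "c \<in> W" "c \<in> coord_space {..<2 * n}" "\<tau> \<in> {0..1}" for c \<tau>
  proof -
    have "seg c \<tau> \<in> S" using that by (simp add: W_def)
    moreover have "seg c \<tau> \<in> coord_space {..<n}" using that(2) by (simp add: coord_space_def seg_def)
    ultimately show ?thesis by (auto simp: S_def cube_def less_imp_le)
  qed
  show ?thesis
  proof (rule that[OF W])
    fix y assume "y \<in> topspace Y"
    then have x: "f y \<in> f ` topspace Y" by blast
    show "interleave (f y) (f y) \<in> W"
      using fU(1)[OF x] B[OF x] by (fastforce simp: W_def S_def seg_interleave)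
  next
    fix T :: "'x topology" and a b
    assume T: "T \<in> Obj compact_hausdorff" and a: "continuous_map T euclidean a" and b: "continuous_map T euclidean b"
      and im: "a ` topspace T \<subseteq> f ` topspace Y" "b ` topspace T \<subseteq> f ` topspace Y"
      and ab: "\<And>t. t \<in> topspace T \<Longrightarrow> interleave (a t) (b t) \<in> W"
    define c where "c t = interleave (a t) (b t)" for t
    have cc: "continuous_map T euclidean c" unfolding c_def by (rule continuous_map_interleave[OF a b])
    define Z where "Z = c ` topspace T"
    have "compactin euclidean Z"
      unfolding Z_def using image_compactin[OF _ cc, of "topspace T"] T by (simp add: obj_ch compact_space_def)
    then have Z: "compact Z" by simp
    have ZW: "Z \<subseteq> W" using ab by (auto simp: Z_def c_def)
    have Zcube: "Z \<subseteq> cube {..<2 * n} B"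
    proof
      fix z assume "z \<in> Z"
      then obtain t where t: "t \<in> topspace T" "z = interleave (a t) (b t)" by (auto simp: Z_def c_def)
      then have *: "a t \<in> cube {..<n} B" "b t \<in> cube {..<n} B" using im fcube by blast+
      then have "z \<in> coord_space {..<2 * n}" unfolding t(2) by (intro interleave_coord_space) (auto simp: cube_def)
      moreover have "\<bar>z i\<bar> \<le> B" if "i < 2 * n" for i
      proof -
        have "i div 2 < n" using that by auto
        then show ?thesis using * by (simp add: t(2) interleave_def cube_def)
      qed
      ultimately show "z \<in> cube {..<2 * n} B" by (simp add: cube_def)
    qed
    obtain K g h where K: "finite_simplicial_complex K" "continuous_on Z g" "g ` Z \<subseteq> geo K"
      "continuous_on (geo K) h" "h ` geo K \<subseteq> W \<inter> coord_space {..<2 * n}" "\<And>z. z \<in> Z \<Longrightarrow> h (g z) = z"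
      using polyhedral_factorization[OF finite_lessThan Z Zcube W ZW] by blast
    obtain i0 :: "(nat \<Rightarrow> real) \<Rightarrow> real" where i0: "inj i0" using inj_sequences_real by blast
    obtain i1 :: "real \<Rightarrow> 'x" where "inj i1" using inj by blast
    \<comment> \<open>Realizations consist of real sequences, so this injection gives the polyhedron
      points of type \<open>'x\<close>, as the category requires.\<close>
    then have "inj (i1 \<circ> i0)" using i0 by (rule inj_compose)
    from copy_exists[OF this, of "realization K"] obtain D \<eta> \<eta>' where \<eta>: "homeomorphic_maps (realization K) (D :: 'x topology) \<eta> \<eta>'"
      by blast
    have \<eta>c: "continuous_map (top_of_set (geo K)) D \<eta>" "continuous_map D (top_of_set (geo K)) \<eta>'"
      "\<And>p. p \<in> geo K \<Longrightarrow> \<eta>' (\<eta> p) = p"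
      using \<eta> by (auto simp: homeomorphic_maps_def realization_eq)
    have hs: "realization K homeomorphic_space D" using \<eta> by (auto simp: homeomorphic_space_def)
    have "compact_space (realization K)" "Hausdorff_space (realization K)"
      using compact_geo[OF K(1)] by (simp_all add: realization_eq compact_space_subtopology Hausdorff_space_subtopology)
    then have "compact_space D" "Hausdorff_space D"
      using homeomorphic_compact_space[OF hs] homeomorphic_Hausdorff_space[OF hs] by simp_all
    moreover have "is_polyhedron D" unfolding is_polyhedron_def
      using K(1) homeomorphic_space_sym[THEN iffD1, OF hs] by (intro exI conjI)
    ultimately have D: "D \<in> Obj compact_polyhedra" by (simp add: obj_cp obj_ch)
    then have DC: "D \<in> Obj compact_hausdorff" by (simp add: obj_cp)
    have \<eta>'geo: "\<eta>' d \<in> geo K" if "d \<in> topspace D" for d using \<eta>c(2) that by (auto simp: continuous_map_def)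
    let ?P = "prod_topology D (top_of_set {0..1::real})"
    define s where "s p = seg (h (\<eta>' (fst p))) (snd p)" for p
    have "continuous_map ?P euclidean (\<lambda>p. h (\<eta>' (fst p)))"
    proof -
      have "continuous_map D euclidean (h \<circ> \<eta>')"
        by (rule continuous_map_compose[OF \<eta>c(2)]) (use K(4) in simp)
      from continuous_map_compose[OF continuous_map_fst this] show ?thesis by (simp add: o_def)
    qed
    moreover have "continuous_map ?P euclideanreal snd"
      using continuous_map_into_fulltopology[OF continuous_map_snd[of D "top_of_set {0..1::real}"]] .
    ultimately have "continuous_map ?P euclidean s" unfolding s_def by (rule continuous_map_seg)
    moreover have s_in: "s p \<in> cube {..<n} (B + 1) \<inter> U" if "p \<in> topspace ?P" for p
    proof -
      have "h (\<eta>' (fst p)) \<in> W \<inter> coord_space {..<2 * n}" using K(5) \<eta>'geo[of "fst p"] that by auto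
      then show ?thesis unfolding s_def using that by (intro S_in) auto
    qed
    ultimately have "continuous_map ?P (top_of_set (cube {..<n} (B + 1) \<inter> U)) s"
      by (intro continuous_map_into_subtopology) auto
    moreover have "continuous_map (top_of_set (cube {..<n} (B + 1) \<inter> U)) euclidean r" using U(3) by simp
    ultimately have Kc: "continuous_map ?P euclidean (r \<circ> s)" by (rule continuous_map_compose)
    have KV: "(r \<circ> s) ` (topspace D \<times> {0..1}) \<subseteq> ?V"
      using s_in U(4) by force
    define \<phi> where "\<phi> = (\<lambda>t\<in>topspace T. \<eta> (g (c t)))"
    have \<phi>: "\<phi> \<in> Mor compact_hausdorff T D"
    proof -
      have "continuous_map T (top_of_set Z) c" using cc by (intro continuous_map_into_subtopology) (auto simp: Z_def)
      moreover have "continuous_map (top_of_set Z) (top_of_set (geo K)) g" using K(2,3) by (auto simp: image_subset_iff)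
      ultimately have "continuous_map T D (\<eta> \<circ> (g \<circ> c))" by (intro continuous_map_compose[OF _ \<eta>c(1)] continuous_map_compose)
      then show ?thesis unfolding \<phi>_def by (intro restrict_mor_ch) (simp add: o_def)
    qed
    have pulled: "mmap G D T \<phi> (pull D (\<lambda>d. (r \<circ> s) (d, \<tau>))) = pull T (\<lambda>t. r (seg (c t) \<tau>))" if \<tau>: "\<tau> \<in> {0..1}" for \<tau>
    proof -
      have dc: "continuous_map D euclidean (\<lambda>d. (r \<circ> s) (d, \<tau>))"
      proof -
        have "continuous_map D ?P (\<lambda>d. (d, \<tau>))" using \<tau> by (intro continuous_map_pairedI) auto
        from continuous_map_compose[OF this Kc] show ?thesis by (simp add: o_def)
      qed
      have dV: "(\<lambda>d. (r \<circ> s) (d, \<tau>)) ` topspace D \<subseteq> ?V" using KV \<tau> by blast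
      have "mmap G D T \<phi> (pull D (\<lambda>d. (r \<circ> s) (d, \<tau>))) = pull T ((\<lambda>d. (r \<circ> s) (d, \<tau>)) \<circ> \<phi>)"
        by (rule pull_natural[OF DC T dV dc \<phi>])
      also have "\<dots> = pull T (\<lambda>t. r (seg (c t) \<tau>))"
      proof (rule pull_cong)
        fix t assume t: "t \<in> topspace T"
        then have cZ: "c t \<in> Z" by (simp add: Z_def)
        then have "\<eta>' (\<eta> (g (c t))) = g (c t)" using \<eta>c(3) K(3) by blast
        then show "((\<lambda>d. (r \<circ> s) (d, \<tau>)) \<circ> \<phi>) t = r (seg (c t) \<tau>)"
          using t K(6)[OF cZ] by (simp add: \<phi>_def s_def)
      qed
      finally show ?thesis .
    qed
    \<comment> \<open>At the parameters 0 and 1 the segment is at \<open>a\<close> and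
      \<open>b\<close>, whose values lie in the image of \<open>f\<close>, where \<open>r\<close> is
      the identity.\<close>
    have "pull T a = pull T (\<lambda>t. r (seg (c t) 0))"
      by (rule pull_cong) (use im(1) fU(2) in \<open>auto simp: c_def seg_interleave\<close>)
    also have "\<dots> = pull T (\<lambda>t. r (seg (c t) 1))"
      using pulled[of 0] pulled[of 1] pull_polyhedron[OF D Kc KV] by simp
    also have "\<dots> = pull T b"
      by (rule pull_cong) (use im(2) fU(2) in \<open>auto simp: c_def seg_interleave\<close>)
    finally show "pull T a = pull T b" .
  qed
qed

text \<open>The class of a slice of the homotopy is a locally constant function of the parameter:
  compactness of \<open>Y\<close> turns closeness at each point into closeness of whole
  slices.\<close>

lemma pull_homotopic:
  assumes H: "continuous_map (prod_topology Y (top_of_set {0..1::real})) Y H"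
  shows "pull Y (\<lambda>y. f (H (y, 0))) = pull Y (\<lambda>y. f (H (y, 1)))"
proof (rule pull_local)
  let ?I = "top_of_set {0..1::real}" and ?P = "prod_topology Y (top_of_set {0..1::real})"
  fix W assume W: "open W" "\<And>y. y \<in> topspace Y \<Longrightarrow> interleave (f y) (f y) \<in> W"
    "\<And>T a b. T \<in> Obj compact_hausdorff \<Longrightarrow> continuous_map T euclidean a \<Longrightarrow> continuous_map T euclidean b \<Longrightarrow>
      a ` topspace T \<subseteq> f ` topspace Y \<Longrightarrow> b ` topspace T \<subseteq> f ` topspace Y \<Longrightarrow>
      (\<And>t. t \<in> topspace T \<Longrightarrow> interleave (a t) (b t) \<in> W) \<Longrightarrow> pull T a = pull T b"
  have Hpt: "H (y, s) \<in> topspace Y" if "y \<in> topspace Y" "s \<in> {0..1}" for y s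
    using H that by (auto simp: continuous_map_def)
  have fH: "continuous_map ?P euclidean (\<lambda>p. f (H p))"
    using continuous_map_compose[OF H fc(1)] by (simp add: o_def)
  have slice: "continuous_map Y euclidean (\<lambda>y. f (H (y, s)))" if s: "s \<in> {0..1}" for s
  proof -
    have "continuous_map Y ?P (\<lambda>y. (y, s))" using s by (intro continuous_map_pairedI) auto
    from continuous_map_compose[OF this fH] show ?thesis by (simp add: o_def)
  qed
  define \<Phi> where "\<Phi> s = pull Y (\<lambda>y. f (H (y, s)))" for s
  have "\<forall>s0\<in>{0..1}. eventually (\<lambda>s. \<Phi> s0 = \<Phi> s) (at s0 within {0..1})"
  proof
    fix s0 :: real assume s0: "s0 \<in> {0..1}"
    \<comment> \<open>An open set containing the slice at \<open>s0\<close>; the tube lemma finds in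
      it a strip over all of \<open>Y\<close>.\<close>
    define N where "N = {p \<in> topspace ?P. interleave (f (H (fst p, s0))) (f (H p)) \<in> W}"
    have "continuous_map ?P euclidean (\<lambda>p. f (H (fst p, s0)))"
      using continuous_map_compose[OF continuous_map_fst slice[OF s0]] by (simp add: o_def)
    from openin_continuous_map_preimage[OF continuous_map_interleave[OF this fH]] have "openin ?P N"
      unfolding N_def using W(1) by simp
    moreover have "compactin Y (topspace Y)" using Y by (simp add: obj_ch compact_space_def)
    moreover have "s0 \<in> topspace ?I" using s0 by simp
    moreover have "topspace Y \<times> {s0} \<subseteq> N" using W(2) Hpt s0 by (auto simp: N_def)
    ultimately obtain A V where AV: "openin ?I V" "topspace Y \<subseteq> A" "s0 \<in> V" "A \<times> V \<subseteq> N"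
      using tube_lemma_left[of Y ?I N "topspace Y" s0] by blast
    have sub: "(\<lambda>y. f (H (y, s))) ` topspace Y \<subseteq> f ` topspace Y" if "s \<in> {0..1}" for s
      using Hpt[OF _ that] by (intro image_subsetI imageI)
    have eq: "\<Phi> s0 = \<Phi> s" if s: "s \<in> V" for s
    proof -
      have "V \<subseteq> {0..1}" using openin_subset[OF AV(1)] by simp
      then have sI: "s \<in> {0..1}" using s by blast
      show ?thesis
        unfolding \<Phi>_def
      proof (rule W(3)[OF Y slice[OF s0] slice[OF sI] sub[OF s0] sub[OF sI]])
        fix t assume "t \<in> topspace Y"
        then have "(t, s) \<in> N" by (intro subsetD[OF AV(4)] SigmaI subsetD[OF AV(2)] s)
        then show "interleave (f (H (t, s0))) (f (H (t, s))) \<in> W" by (simp add: N_def)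
      qed
    qed
    obtain O' where O': "open O'" "V = {0..1} \<inter> O'" using AV(1) unfolding openin_open by (elim exE conjE)
    have "s0 \<in> O'" using AV(3) O'(2) by simp
    moreover have "\<forall>s\<in>O'. s \<noteq> s0 \<longrightarrow> s \<in> {0..1} \<longrightarrow> \<Phi> s0 = \<Phi> s" using eq O'(2) by simp
    ultimately show "eventually (\<lambda>s. \<Phi> s0 = \<Phi> s) (at s0 within {0..1})"
      unfolding eventually_at_topological using O'(1) by (intro exI[of _ O'] conjI)
  qed
  from connected_local_const[OF connected_Icc _ _ this, of 0 1]
  show "pull Y (\<lambda>y. f (H (y, 0))) = pull Y (\<lambda>y. f (H (y, 1)))" by (simp add: \<Phi>_def)
qed

end

text \<open>The projection induces the inverse map. One composite is the identity on the nose; the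
  other comes from a self-map of the cylinder homotopic to the identity, and is compared with the
  identity on one element at a time, each coming from a finitely generated subalgebra.\<close>

theorem theorem1p13:
  fixes F :: "(('x \<Rightarrow> complex) calg, ('x \<Rightarrow> complex) \<Rightarrow> ('x \<Rightarrow> complex), 'g monoid, 'g \<Rightarrow> 'g) fctr"
  assumes "is_functor comm_algebras abelian_groups F"
    and "commutes_with_filtered_colimits F"
    and "homotopy_invariant (compact_polyhedra :: ('x topology, 'x \<Rightarrow> 'x) cat) (fctr_comp F cont_functor)"
  shows "homotopy_invariant (compact_hausdorff :: ('x topology, 'x \<Rightarrow> 'x) cat) (fctr_comp F cont_functor)"
  unfolding homotopy_invariant_def
proof (intro ballI allI impI)
  let ?G = "fctr_comp F cont_functor"
  note G = is_functor_fctr_comp[OF is_functor_cont_functor assms(1)]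
  fix X Y :: "'x topology" and \<theta>
  assume X: "X \<in> Obj compact_hausdorff" and Y: "Y \<in> Obj compact_hausdorff"
    and h: "homeomorphic_map (prod_topology X (top_of_set {0..1::real})) Y \<theta>"
  let ?P = "prod_topology X (top_of_set {0..1::real})"
  obtain \<theta>' where \<theta>: "homeomorphic_maps ?P Y \<theta> \<theta>'" using h homeomorphic_map_maps by blast
  have c: "continuous_map ?P Y \<theta>" "continuous_map Y ?P \<theta>'" "\<And>p. p \<in> topspace ?P \<Longrightarrow> \<theta>' (\<theta> p) = p"
    "\<And>y. y \<in> topspace Y \<Longrightarrow> \<theta> (\<theta>' y) = y"
    using \<theta> by (auto simp: homeomorphic_maps_def)
  define \<iota> where "\<iota> = (\<lambda>x\<in>topspace X. \<theta> (x, 0))"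
  define p where "p = (\<lambda>y\<in>topspace Y. fst (\<theta>' y))"
  have \<theta>': "\<theta>' y \<in> topspace X \<times> {0..1}" if "y \<in> topspace Y" for y
    using c(2) that by (auto simp: continuous_map_def)
  have \<iota>: "\<iota> \<in> Mor compact_hausdorff X Y"
  proof -
    have "continuous_map X ?P (\<lambda>x. (x, 0))" by (intro continuous_map_pairedI) auto
    from continuous_map_compose[OF this c(1)] have "continuous_map X Y (\<lambda>x. \<theta> (x, 0))" by (simp add: o_def)
    then show ?thesis unfolding \<iota>_def by (rule restrict_mor_ch)
  qed
  have p: "p \<in> Mor compact_hausdorff Y X"
    unfolding p_def
    using continuous_map_compose[OF c(2) continuous_map_fst] by (intro restrict_mor_ch) (simp add: o_def)
  have p\<iota>: "compose (topspace X) p \<iota> = restrict id (topspace X)"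
  proof
    fix x show "compose (topspace X) p \<iota> x = restrict id (topspace X) x"
    proof (cases "x \<in> topspace X")
      case True
      then have "\<iota> x \<in> topspace Y" using \<iota> by (auto simp: mor_ch continuous_map_def)
      then show ?thesis using True c(3)[of "(x, 0)"] by (simp add: compose_eq p_def \<iota>_def)
    qed (simp add: compose_def)
  qed
  have i_hom: "mmap ?G Y X \<iota> \<in> hom (omap ?G Y) (omap ?G X)" by (rule functor_hom[OF G X Y \<iota>])
  have p_hom: "mmap ?G X Y p \<in> hom (omap ?G X) (omap ?G Y)" by (rule functor_hom[OF G Y X p])
  have left: "mmap ?G Y X \<iota> (mmap ?G X Y p z) = z" if "z \<in> carrier (omap ?G X)" for z
    using functor_comp[OF G X Y X \<iota> p that] functor_id[OF G X that] p\<iota> by simp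
  have right: "mmap ?G X Y p (mmap ?G Y X \<iota> \<alpha>) = \<alpha>" if \<alpha>: "\<alpha> \<in> carrier (omap ?G Y)" for \<alpha>
  \<comment> \<open>Over an empty space the cylinder is empty and yields no injection of the reals
    into \<open>'x\<close>; but then both composites are identities.\<close>
  proof (cases "topspace X = {}")
    case True
    then have tY: "topspace Y = {}" using \<theta>' by fastforce
    have "compose (topspace Y) \<iota> p = restrict id (topspace Y)" using tY by (auto simp: compose_def fun_eq_iff)
    then show ?thesis using functor_comp[OF G Y X Y p \<iota> \<alpha>] functor_id[OF G Y \<alpha>] by simp
  next
    case False
    then obtain x0 where x0: "x0 \<in> topspace X" by blast
    obtain b where b: "bij_betw b (UNIV :: real set) {0..1::real}"
      using closed_interval_eqpoll_reals[of 0 1] eqpoll_sym unfolding eqpoll_def by (metis zero_less_one)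
    \<comment> \<open>The fibre over \<open>x0\<close> is an interval inside \<open>'x\<close>, so
      \<open>'x\<close> has at least the cardinality of the reals.\<close>
    have "inj (\<lambda>t. \<theta> (x0, b t))"
    proof (rule injI)
      fix t u assume eq: "\<theta> (x0, b t) = \<theta> (x0, b u)"
      have "b t \<in> {0..1}" "b u \<in> {0..1}" using bij_betwE[OF b] by blast+
      then have "(x0, b t) = (x0, b u)"
        using homeomorphic_imp_injective_map[OF h] eq x0 by (auto simp: inj_on_def)
      then show "t = u" using b by (auto simp: bij_betw_def inj_on_def)
    qed
    then have inj: "\<exists>i :: real \<Rightarrow> 'x. inj i" by blast
    have "\<alpha> \<in> carrier (omap F (cont_algebra Y))" using \<alpha> by (simp add: fctr_comp_def cont_functor_def)
    from finitely_generated_surj[OF assms(1,2) this] obtain f n \<beta> where gen: "coord_map Y n f"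
      "\<beta> \<in> carrier (omap F (sub_alg Y f))"
      "mmap F (sub_alg Y f) (cont_algebra Y) (restrict id (gen_alg Y f)) \<beta> = \<alpha>" by blast
    interpret polynomial_class F Y f n \<beta> by unfold_locales (fact assms Y gen inj)+
    have pull_f: "pull Y f = \<alpha>" unfolding pull_def using gen(3) ev_self(1)[OF gen(1)] by simp
    \<comment> \<open>Scales the height of a cylinder point by the parameter: parameter 0 pushes
      everything to the bottom, parameter 1 moves nothing.\<close>
    define H where "H q = \<theta> (fst (\<theta>' (fst q)), snd q * snd (\<theta>' (fst q)))" for q
    have "continuous_map (prod_topology Y (top_of_set {0..1::real})) Y H"
    proof -
      let ?Q = "prod_topology Y (top_of_set {0..1::real})"
      have t: "continuous_map ?Q ?P (\<lambda>q. \<theta>' (fst q))"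
        using continuous_map_compose[OF continuous_map_fst c(2)] by (simp add: o_def)
      have t1: "continuous_map ?Q X (\<lambda>q. fst (\<theta>' (fst q)))"
        using continuous_map_compose[OF t continuous_map_fst] by (simp add: o_def)
      have "continuous_map ?Q (top_of_set {0..1}) (\<lambda>q. snd (\<theta>' (fst q)))"
        using continuous_map_compose[OF t continuous_map_snd] by (simp add: o_def)
      then have "continuous_map ?Q euclideanreal (\<lambda>q. snd q * snd (\<theta>' (fst q)))"
        by (rule continuous_map_real_mult[OF continuous_map_into_fulltopology[OF continuous_map_snd]
          continuous_map_into_fulltopology])
      moreover have "snd q * snd (\<theta>' (fst q)) \<in> {0..1}" if "q \<in> topspace ?Q" for q
      proof -
        have "snd q \<in> {0..1}" "snd (\<theta>' (fst q)) \<in> {0..1}"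
          using \<theta>'[of "fst q"] that by (simp_all add: mem_Times_iff)
        then show ?thesis by (simp add: mult_le_one)
      qed
      ultimately have "continuous_map ?Q (top_of_set {0..1}) (\<lambda>q. snd q * snd (\<theta>' (fst q)))"
        unfolding continuous_map_in_subtopology by (simp only: image_subset_iff Pi_iff) blast
      from continuous_map_compose[OF continuous_map_pairedI[OF t1 this] c(1)] show ?thesis by (simp add: H_def[abs_def] o_def)
    qed
    note hom = pull_homotopic[OF this]
    have fV: "f ` topspace Y \<subseteq> zariski_closure Y f n" by (rule ev_self(2)[OF gen(1)])
    have ipY: "\<iota> (p y) = \<theta> (fst (\<theta>' y), 0)" if "y \<in> topspace Y" for y
      using \<theta>'[OF that] that by (auto simp: \<iota>_def p_def mem_Times_iff)
    have fi: "(f \<circ> \<iota>) ` topspace X \<subseteq> zariski_closure Y f n" "continuous_map X euclidean (f \<circ> \<iota>)"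
    proof -
      have \<iota>c: "continuous_map X Y \<iota>" using \<iota> by (simp add: mor_ch)
      show "continuous_map X euclidean (f \<circ> \<iota>)" by (rule continuous_map_compose[OF \<iota>c fc(1)])
      have "\<iota> ` topspace X \<subseteq> topspace Y" by (rule continuous_map_image_subset_topspace[OF \<iota>c])
      then show "(f \<circ> \<iota>) ` topspace X \<subseteq> zariski_closure Y f n" using fV by auto
    qed
    have "mmap ?G X Y p (mmap ?G Y X \<iota> \<alpha>) = pull Y (f \<circ> \<iota> \<circ> p)"
      using pull_natural[OF Y X fV fc(1) \<iota>] pull_natural[OF X Y fi p] by (simp add: pull_f)
    also have "\<dots> = pull Y (\<lambda>y. f (H (y, 0)))" by (rule pull_cong) (simp add: ipY H_def)
    also have "\<dots> = pull Y (\<lambda>y. f (H (y, 1)))" by (rule hom)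
    also have "\<dots> = pull Y f" by (rule pull_cong) (simp add: H_def c(4))
    finally show ?thesis by (simp add: pull_f)
  qed
  have "bij_betw (mmap ?G Y X \<iota>) (carrier (omap ?G Y)) (carrier (omap ?G X))"
  proof (rule bij_betwI[where g = "mmap ?G X Y p"])
    show "mmap ?G Y X \<iota> \<in> carrier (omap ?G Y) \<rightarrow> carrier (omap ?G X)" using i_hom unfolding hom_def by blast
    show "mmap ?G X Y p \<in> carrier (omap ?G X) \<rightarrow> carrier (omap ?G Y)" using p_hom unfolding hom_def by blast
  qed (rule right left; assumption)+
  then show "mmap ?G Y X (\<lambda>x\<in>topspace X. \<theta> (x, 0)) \<in> iso (omap ?G Y) (omap ?G X)"
    using i_hom by (simp add: iso_def \<iota>_def)
qed

end
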